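(* Let $n,m,r$ be natural numbers with $r\le\min\{n,m\}$, let $\ell:=\min\{m,n,2r\}$, and let $\delta\in[0,1)$ be given. Consider the following system of conditions (C) on a constant $\alpha\in(1-\delta,(1+\delta)/2]$, a diagonal matrix $\Sigma\in\mathbb{R}^{r\times r}$, a diagonal matrix $\Lambda\in\mathbb{R}^{(\ell-r)\times(\ell-r)}$ and matrices $A\in\mathbb{R}^{r\times r}$, $B\in\mathbb{R}^{r\times r}$, $C\in\mathbb{R}^{(\ell-r)\times r}$, $D\in\mathbb{R}^{(\ell-r)\times r}$: \begin{align*} &(1+\delta)\min_{1\le i\le r}\Sigma_{ii}\ \ge\ \max_{1\le i\le \ell-r}\Lambda_{ii},\qquad \Sigma\succ0,\quad \Lambda\succeq0,\\ &\langle\Lambda,CD^T\rangle=\alpha\left[\mathrm{tr}(\Sigma^2)-2\langle\Sigma,AB^T\rangle+\|AB^T\|_F^2+\|AD^T\|_F^2+\|CB^T\|_F^2+\|CD^T\|_F^2\right],\\ &\mathrm{tr}(\Lambda^2)\le\alpha^{-1}(2\alpha-1+\delta^2)\cdot\langle\Lambda,CD^T\rangle,\qquad \langle\Lambda,CD^T\rangle\ne0. \end{align*} (Necessity) There exists a function $f_a$ with the $\delta$-RIP$_{2r,2r}$ property such that the factorized problem (respectively, the regularized factorized problem) associated with $f_a$ has a spurious second-order critical point only if there exist a constant $\alpha\in(1-\delta,(1+\delta)/2]$, a diagonal matrix $\Sigma\in\mathbb{R}^{r\times r}$, a diagonal matrix $\Lambda\in\mathbb{R}^{(\ell-r)\times(\ell-r)}$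 and matrices $A\in\mathbb{R}^{r\times r}$, $B\in\mathbb{R}^{r\times r}$, $C\in\mathbb{R}^{(\ell-r)\times r}$, $D\in\mathbb{R}^{(\ell-r)\times r}$ satisfying (C). (Sufficiency) If there exist a constant $\alpha\in(1-\delta,(1+\delta)/2]$, a diagonal matrix $\Sigma\in\mathbb{R}^{r\times r}$, a diagonal matrix $\Lambda\in\mathbb{R}^{(\ell-r)\times(\ell-r)}$ and matrices $A\in\mathbb{R}^{r\times r}$, $B\in\mathbb{R}^{r\times r}$, $C\in\mathbb{R}^{(\ell-r)\times r}$, $D\in\mathbb{R}^{(\ell-r)\times r}$ satisfying (C) and, in addition, $CB^T=0$ and $AD^T=0$, then there exists a function $f_a$ with the $\delta$-RIP$_{2r,2r}$ property such that both the factorized problem and the regularized factorized problem associated with $f_a$ have a spurious second-order critical point.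
   Context: All functions $f_a:\mathbb{R}^{n\times m}\to\mathbb{R}$ are twice continuously differentiable. Standing assumption: $f_a$ has a first-order critical point $M_a^*$ (i.e. $\nabla f_a(M_a^* )=0$) with $\mathrm{rank}(M_a^* )\le r$. $\delta$-RIP$_{2r,2t}$: $f_a$ satisfies $(1-\delta)\|K\|_F^2\le[\nabla^2f_a(M)](K,K)\le(1+\delta)\|K\|_F^2$ for all $M,K\in\mathbb{R}^{n\times m}$ with $\mathrm{rank}(M)\le2r$, $\mathrm{rank}(K)\le2t$. Factorized problem: minimize $h_a(U,V):=f_a(UV^T)$ over $U\in\mathbb{R}^{n\times r},V\in\mathbb{R}^{m\times r}$. Regularized factorized problem: minimize $\rho(U,V):=h_a(U,V)+\frac{\mu}{4}\|U^TU-V^TV\|_F^2$ over the same variables, where $\mu>0$ is a constant. A second-order critical point of such an unconstrained problem is a point where the gradient of the objective vanishes and its Hessian is positive semidefinite; it is spurious if it is not a global minimizer of the problem. $\langle X,Y\rangle=\mathrm{tr}(X^TY)$; $\|\cdot\|_F$ is the Frobenius norm. If $\ell=r$, the maximum over the empty index set is vacuous. *)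

theory Defs
  imports "HOL-Analysis.Analysis" "Jordan_Normal_Form.Matrix"
begin

text \<open>
  The domain of the objective functions is the Euclidean space \<open>real ^ 'm ^ 'n\<close>; its library
  inner product is \<open>tr (X\<^sup>T Y)\<close> and its library norm is the Frobenius norm.
  The matrices of the algebraic system have dimensions \<open>r\<close> and \<open>\<ell> - r\<close>; the latter is
  computed from the other dimensions and may be \<open>0\<close>, so that it cannot be a type. They are
  therefore matrices of type \<open>real mat\<close> with explicit dimensions, indexed from \<open>0\<close>.
\<close>

section \<open>Derivatives\<close>

definition grad :: "('a::real_inner \<Rightarrow> real) \<Rightarrow> 'a \<Rightarrow> 'a" where
  "grad f x = (THE D. GDERIV f x :> D)"

definition hessian :: "('a::real_inner \<Rightarrow> real) \<Rightarrow> 'a \<Rightarrow> 'a \<Rightarrow> 'a \<Rightarrow> real" where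
  "hessian f x h k = inner (frechet_derivative (grad f) (at x) h) k"

definition twice_continuously_differentiable :: "('a::euclidean_space \<Rightarrow> real) \<Rightarrow> bool" where
  "twice_continuously_differentiable f \<longleftrightarrow>
     (\<forall>x. f differentiable (at x)) \<and>
     (\<exists>H :: 'a \<Rightarrow> 'a \<Rightarrow>\<^sub>L 'a.
        (\<forall>x. (grad f has_derivative blinfun_apply (H x)) (at x)) \<and> continuous_on UNIV H)"

definition first_order_critical :: "('a::real_inner \<Rightarrow> real) \<Rightarrow> 'a \<Rightarrow> bool" where
  "first_order_critical f x \<longleftrightarrow> GDERIV f x :> 0"

text \<open>The Hessian of a twice continuously differentiable function is symmetric, so positive
  semidefiniteness is only the condition on the quadratic form.\<close>

definition second_order_critical :: "('a::real_inner \<Rightarrow> real) \<Rightarrow> 'a \<Rightarrow> bool" where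
  "second_order_critical f x \<longleftrightarrow> first_order_critical f x \<and> (\<forall>h. hessian f x h h \<ge> 0)"

definition spurious_second_order_critical :: "('a::real_inner \<Rightarrow> real) \<Rightarrow> 'a \<Rightarrow> bool" where
  "spurious_second_order_critical f x \<longleftrightarrow>
     second_order_critical f x \<and> \<not> (\<forall>y. f x \<le> f y)"

section \<open>Low-rank problems\<close>

definition RIP :: "real \<Rightarrow> nat \<Rightarrow> nat \<Rightarrow> (real ^ 'm ^ 'n \<Rightarrow> real) \<Rightarrow> bool" where
  "RIP \<delta> p q f \<longleftrightarrow>
     (\<forall>M K. rank M \<le> p \<and> rank K \<le> q \<longrightarrow>
        (1 - \<delta>) * (norm K)\<^sup>2 \<le> hessian f M K K \<and> hessian f M K K \<le> (1 + \<delta>) * (norm K)\<^sup>2)"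

definition admissible :: "nat \<Rightarrow> (real ^ 'm ^ 'n \<Rightarrow> real) \<Rightarrow> bool" where
  "admissible r f \<longleftrightarrow>
     twice_continuously_differentiable f \<and> (\<exists>M. first_order_critical f M \<and> rank M \<le> r)"

definition factorized ::
  "(real ^ 'm ^ 'n \<Rightarrow> real) \<Rightarrow> (real ^ 'r ^ 'n) \<times> (real ^ 'r ^ 'm) \<Rightarrow> real" where
  "factorized f = (\<lambda>(U, V). f (U ** transpose V))"

definition regularized ::
  "real \<Rightarrow> (real ^ 'm ^ 'n \<Rightarrow> real) \<Rightarrow> (real ^ 'r ^ 'n) \<times> (real ^ 'r ^ 'm) \<Rightarrow> real" where
  "regularized \<mu> f =
     (\<lambda>(U, V). factorized f (U, V) + \<mu> / 4 * (norm (transpose U ** U - transpose V ** V))\<^sup>2)"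

section \<open>The algebraic system\<close>

definition mat_trace :: "real mat \<Rightarrow> real" where
  "mat_trace X = (\<Sum>i<dim_row X. X $$ (i, i))"

definition mat_inner :: "real mat \<Rightarrow> real mat \<Rightarrow> real" where
  "mat_inner X Y = mat_trace (transpose_mat X * Y)"

definition frob_norm :: "real mat \<Rightarrow> real" where
  "frob_norm X = sqrt (mat_inner X X)"

definition pos_semidef :: "real mat \<Rightarrow> bool" where
  "pos_semidef X \<longleftrightarrow> square_mat X \<and> transpose_mat X = X \<and>
     (\<forall>v \<in> carrier_vec (dim_row X). scalar_prod v (mult_mat_vec X v) \<ge> 0)"

definition pos_def :: "real mat \<Rightarrow> bool" where
  "pos_def X \<longleftrightarrow> square_mat X \<and> transpose_mat X = X \<and>
     (\<forall>v \<in> carrier_vec (dim_row X). v \<noteq> 0\<^sub>v (dim_row X) \<longrightarrow> scalar_prod v (mult_mat_vec X v) > 0)"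

text \<open>Here \<open>s\<close> stands for \<open>\<ell> - r\<close>. For \<open>s = 0\<close> the maximum is over the empty set and the first
  condition is vacuous, hence the guard.\<close>

definition system_C ::
  "nat \<Rightarrow> nat \<Rightarrow> real \<Rightarrow> real \<Rightarrow> real mat \<Rightarrow> real mat \<Rightarrow>
   real mat \<Rightarrow> real mat \<Rightarrow> real mat \<Rightarrow> real mat \<Rightarrow> bool" where
  "system_C r s \<delta> \<alpha> \<Sigma> \<Lambda> A B C D \<longleftrightarrow>
     1 - \<delta> < \<alpha> \<and> \<alpha> \<le> (1 + \<delta>) / 2 \<and>
     \<Sigma> \<in> carrier_mat r r \<and> diagonal_mat \<Sigma> \<and>
     \<Lambda> \<in> carrier_mat s s \<and> diagonal_mat \<Lambda> \<and>
     A \<in> carrier_mat r r \<and> B \<in> carrier_mat r r \<and>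
     C \<in> carrier_mat s r \<and> D \<in> carrier_mat s r \<and>
     (s > 0 \<longrightarrow> (1 + \<delta>) * Min ((\<lambda>i. \<Sigma> $$ (i, i)) ` {..<r}) \<ge> Max ((\<lambda>i. \<Lambda> $$ (i, i)) ` {..<s})) \<and>
     pos_def \<Sigma> \<and> pos_semidef \<Lambda> \<and>
     mat_inner \<Lambda> (C * transpose_mat D) =
       \<alpha> * (mat_trace (\<Sigma> * \<Sigma>) - 2 * mat_inner \<Sigma> (A * transpose_mat B)
            + (frob_norm (A * transpose_mat B))\<^sup>2 + (frob_norm (A * transpose_mat D))\<^sup>2
            + (frob_norm (C * transpose_mat B))\<^sup>2 + (frob_norm (C * transpose_mat D))\<^sup>2) \<and>
     mat_trace (\<Lambda> * \<Lambda>) \<le>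
       inverse \<alpha> * (2 * \<alpha> - 1 + \<delta>\<^sup>2) * mat_inner \<Lambda> (C * transpose_mat D) \<and>
     mat_inner \<Lambda> (C * transpose_mat D) \<noteq> 0"

end

theory Submission
  imports Defs
begin

text \<open>
  Necessity. Let \<open>M = U V\<^sup>T\<close> be the spurious point, \<open>N\<close> the low-rank critical point, \<open>E = N - M\<close>
  and \<open>P\<close> the projection onto the sum of the ranges of \<open>U\<close> and \<open>N\<close>. Put \<open>Q = - P \<nabla>f(M)\<close>. The
  Hessian averaged over the segment from \<open>M\<close> to \<open>N\<close> maps \<open>E\<close> to \<open>- \<nabla>f(M)\<close>, which acts like \<open>Q\<close> on
  all matrices with columns in the range of \<open>P\<close>. With \<open>\<alpha> = \<langle>Q, N\<rangle> / \<Parallel>E\<Parallel>\<^sup>2\<close> the RIP on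
  the plane spanned by \<open>E\<close> and \<open>Q\<close> is the bound on \<open>\<Parallel>Q\<Parallel>\<^sup>2\<close>, the second-order condition in directions
  \<open>(u a\<^sup>T, v b\<^sup>T)\<close> bounds the singular values of \<open>Q\<close> by those of \<open>M\<close>, and the Eckart--Young inequality
  for \<open>M + Q / (1 + \<delta>)\<close> gives \<open>\<alpha> \<le> (1 + \<delta>) / 2\<close>. The matrices \<open>A\<close>, \<open>B\<close>, \<open>C\<close>, \<open>D\<close> are the
  coordinates of \<open>N\<close> in the singular bases of \<open>M\<close> and \<open>Q\<close>; dropping the other coordinates of \<open>N\<close>
  only decreases \<open>\<Parallel>E\<Parallel>\<close>, and scaling \<open>D\<close> restores equality.

  Sufficiency. Take the quadratic function with minimizer \<open>N\<close> whose Hessian is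
  \<open>(1 + \<delta>) I - \<gamma> w w\<^sup>T\<close> with \<open>w = (1 + \<delta>) E - \<Lambda>\<close> and \<open>\<gamma>\<close> chosen such that it maps \<open>E\<close> to \<open>\<Lambda>\<close>. If
  \<open>C B\<^sup>T = 0\<close> and \<open>A D\<^sup>T = 0\<close> then \<open>w\<close> has no off-diagonal blocks, and the condition on the maximum
  of \<open>\<Lambda>\<close> makes the Hessian of the factorized problem at the balanced factorization of \<open>\<Sigma>\<close>
  positive semidefinite.
\<close>

section \<open>Orthogonal systems\<close>

definition orthonormal_on :: "'i set \<Rightarrow> ('i \<Rightarrow> 'a::real_inner) \<Rightarrow> bool" where
  "orthonormal_on I e \<longleftrightarrow> (\<forall>i\<in>I. \<forall>j\<in>I. inner (e i) (e j) = (if i = j then 1 else 0))"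

text \<open>Zero vectors are allowed, so that a family of singular vectors may be padded with zeros
  up to a prescribed length; Bessel's inequality survives this.\<close>

definition sub_orthonormal_on :: "'i set \<Rightarrow> ('i \<Rightarrow> 'a::real_inner) \<Rightarrow> bool" where
  "sub_orthonormal_on I e \<longleftrightarrow>
     (\<forall>i\<in>I. inner (e i) (e i) \<le> 1) \<and> (\<forall>i\<in>I. \<forall>j\<in>I. i \<noteq> j \<longrightarrow> inner (e i) (e j) = 0)"

lemma orthonormal_imp_sub_orthonormal: "orthonormal_on I e \<Longrightarrow> sub_orthonormal_on I e"
  by (simp add: orthonormal_on_def sub_orthonormal_on_def)

lemma orthonormal_on_subset: "orthonormal_on J e \<Longrightarrow> I \<subseteq> J \<Longrightarrow> orthonormal_on I e"
  unfolding orthonormal_on_def by blast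

text \<open>For the sum \<open>S\<close> of the components of \<open>x\<close> along the family, <S,
  S> is at most <x, S>; then expand |x - S|^2 \<ge> 0.\<close>

lemma bessel:
  fixes x :: "'a::real_inner"
  assumes "finite I" "sub_orthonormal_on I e"
  shows "(\<Sum>i\<in>I. (inner x (e i))\<^sup>2) \<le> (norm x)\<^sup>2"
proof -
  define S where "S = (\<Sum>i\<in>I. inner x (e i) *\<^sub>R e i)"
  have xS: "inner x S = (\<Sum>i\<in>I. (inner x (e i))\<^sup>2)"
    by (simp add: S_def inner_sum_right power2_eq_square)
  have "inner S S = (\<Sum>i\<in>I. inner x (e i) * inner (e i) S)"
    by (simp add: S_def inner_sum_left)
  also have "\<dots> = (\<Sum>i\<in>I. inner x (e i) * (inner x (e i) * inner (e i) (e i)))"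
  proof (rule sum.cong[OF refl])
    fix i assume i: "i \<in> I"
    have "inner (e i) S = (\<Sum>j\<in>I. inner x (e j) * inner (e i) (e j))"
      by (simp add: S_def inner_sum_right)
    also have "\<dots> = (\<Sum>j\<in>I. if j = i then inner x (e i) * inner (e i) (e i) else 0)"
      using assms(2) i by (intro sum.cong) (auto simp: sub_orthonormal_on_def)
    also have "\<dots> = inner x (e i) * inner (e i) (e i)"
      using i assms(1) by simp
    finally show "inner x (e i) * inner (e i) S = inner x (e i) * (inner x (e i) * inner (e i) (e i))"
      by simp
  qed
  also have "\<dots> \<le> (\<Sum>i\<in>I. (inner x (e i))\<^sup>2)"
  proof (rule sum_mono)
    fix i assume "i \<in> I"
    then have "(inner x (e i))\<^sup>2 * inner (e i) (e i) \<le> (inner x (e i))\<^sup>2 * 1"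
      using assms(2) by (intro mult_left_mono) (auto simp: sub_orthonormal_on_def)
    then show "inner x (e i) * (inner x (e i) * inner (e i) (e i)) \<le> (inner x (e i))\<^sup>2"
      by (simp add: power2_eq_square mult.assoc)
  qed
  finally have SS: "inner S S \<le> (\<Sum>i\<in>I. (inner x (e i))\<^sup>2)" .
  have "0 \<le> inner (x - S) (x - S)" by simp
  also have "\<dots> = inner x x - 2 * inner x S + inner S S"
    by (simp add: inner_diff_left inner_diff_right inner_commute)
  finally show ?thesis using xS SS by (simp add: power2_norm_eq_inner)
qed

lemma inner_orthonormal_sum:
  assumes "finite I" "orthonormal_on I e" "i \<in> I"
  shows "inner (\<Sum>j\<in>I. c j *\<^sub>R e j) (e i) = c i"
proof -
  have "inner (\<Sum>j\<in>I. c j *\<^sub>R e j) (e i) = (\<Sum>j\<in>I. if j = i then c i else 0)"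
    unfolding inner_sum_left using assms by (intro sum.cong) (auto simp: orthonormal_on_def)
  then show ?thesis using assms by simp
qed

lemma inner_orthonormal_sums:
  assumes "finite I" "orthonormal_on I e"
  shows "inner (\<Sum>j\<in>I. c j *\<^sub>R e j) (\<Sum>j\<in>I. d j *\<^sub>R e j) = (\<Sum>j\<in>I. c j * d j)"
proof -
  have "inner (\<Sum>j\<in>I. c j *\<^sub>R e j) (\<Sum>j\<in>I. d j *\<^sub>R e j)
      = (\<Sum>i\<in>I. d i * inner (\<Sum>j\<in>I. c j *\<^sub>R e j) (e i))"
    by (subst inner_sum_right) simp
  also have "\<dots> = (\<Sum>i\<in>I. d i * c i)"
    using inner_orthonormal_sum[OF assms] by simp
  finally show ?thesis by (simp add: mult.commute)
qed

lemma card_orthonormal_le_dim: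
  fixes e :: "'i \<Rightarrow> 'a::euclidean_space"
  assumes "finite I" "orthonormal_on I e" "e ` I \<subseteq> S"
  shows "card I \<le> dim S"
proof -
  have inj: "inj_on e I"
  proof (rule inj_onI)
    fix i j assume "i \<in> I" "j \<in> I" "e i = e j"
    then show "i = j" using assms(2) unfolding orthonormal_on_def by (metis zero_neq_one)
  qed
  have "pairwise Linear_Algebra.orthogonal (e ` I)"
    using assms(2) by (auto simp: pairwise_def Linear_Algebra.orthogonal_def orthonormal_on_def)
  moreover have "0 \<notin> e ` I" using assms(2) by (force simp: orthonormal_on_def)
  ultimately have "independent (e ` I)" by (rule pairwise_orthogonal_independent)
  then have "card (e ` I) \<le> dim S" using assms(3) independent_card_le_dim by blast
  then show ?thesis using card_image[OF inj] by simp
qed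

section \<open>Concatenation of finite families\<close>

text \<open>Serves both for joining bases of two orthogonal subspaces and for stacking matrices on
  top of each other.\<close>

definition append_fun :: "nat \<Rightarrow> (nat \<Rightarrow> 'a) \<Rightarrow> (nat \<Rightarrow> 'a) \<Rightarrow> nat \<Rightarrow> 'a" where
  "append_fun k f g i = (if i < k then f i else g (i - k))"

lemma append_fun_simps [simp]:
  "i < k \<Longrightarrow> append_fun k f g i = f i" "append_fun k f g (k + j) = g j" "append_fun k f g k = g 0"
  by (simp_all add: append_fun_def)

lemma sum_append:
  fixes F :: "nat \<Rightarrow> 'a::comm_monoid_add"
  shows "(\<Sum>i<k+l. F i) = (\<Sum>i<k. F i) + (\<Sum>j<l. F (k + j))"
  by (induction l) (simp_all add: add.assoc)

lemma all_less_append: "(\<forall>i<k+l. Q i) \<longleftrightarrow> (\<forall>i<k. Q i) \<and> (\<forall>j<l. Q (k + j))" for k l :: nat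
proof safe
  fix i assume "\<forall>i<k. Q i" "\<forall>j<l. Q (k + j)" "i < k + l"
  then show "Q i" by (cases "i < k") (auto dest: spec[where x="i - k"])
qed auto

lemma orthonormal_append:
  assumes "orthonormal_on {..<k} f" "orthonormal_on {..<l} g"
    "\<And>i j. i < k \<Longrightarrow> j < l \<Longrightarrow> inner (f i) (g j) = 0"
  shows "orthonormal_on {..<k+l} (append_fun k f g)"
  using assms unfolding orthonormal_on_def Ball_def lessThan_iff all_less_append
  by (auto simp: inner_commute)

lemma sub_orthonormal_append:
  assumes "sub_orthonormal_on {..<k} f" "sub_orthonormal_on {..<l} g"
    "\<And>i j. i < k \<Longrightarrow> j < l \<Longrightarrow> inner (f i) (g j) = 0"
  shows "sub_orthonormal_on {..<k+l} (append_fun k f g)"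
  using assms unfolding sub_orthonormal_on_def Ball_def lessThan_iff all_less_append
  by (auto simp: inner_commute)

section \<open>Rank-one matrices\<close>

definition outer :: "real ^ 'n \<Rightarrow> real ^ 'm \<Rightarrow> real ^ 'm ^ 'n" where
  "outer u v = (\<chi> i j. vec_nth u i * vec_nth v j)"

lemma bounded_bilinear_outer: "bounded_bilinear outer"
  by (rule bilinear_conv_bounded_bilinear[THEN iffD1])
    (auto simp: bilinear_def outer_def Finite_Cartesian_Product.vec_eq_iff algebra_simps intro!: linearI)

interpretation outer: bounded_bilinear outer by (rule bounded_bilinear_outer)

lemma outer_mult_vec: "outer u v *v w = inner v w *\<^sub>R u"
  by (simp add: outer_def Finite_Cartesian_Product.vec_eq_iff matrix_vector_mult_def inner_vec_def sum_distrib_left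
      mult_ac)

lemma transpose_outer: "transpose (outer u v) = outer v u"
  by (simp add: outer_def Finite_Cartesian_Product.vec_eq_iff transpose_def)

lemma mult_outer: "A ** outer u v = outer (A *v u) v"
  by (simp add: outer_def Finite_Cartesian_Product.vec_eq_iff matrix_matrix_mult_def matrix_vector_mult_def sum_distrib_left
      mult_ac)

lemma outer_mult: "outer u v ** A = outer u (transpose A *v v)"
  by (simp add: outer_def Finite_Cartesian_Product.vec_eq_iff matrix_matrix_mult_def matrix_vector_mult_def
      transpose_def vector_matrix_mult_def sum_distrib_left mult_ac)

lemma inner_outer_right: "inner A (outer u v) = inner u (A *v v)"
  by (simp add: outer_def inner_vec_def matrix_vector_mult_def sum_distrib_left mult_ac)

lemma inner_transpose_mult_vec: "inner (transpose A *v x) y = inner x (A *v y)" for A :: "real^'m^'n"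
  by (simp add: dot_lmul_matrix)

lemma inner_outer_right': "inner A (outer u v) = inner v (transpose A *v u)"
  by (metis inner_outer_right inner_commute inner_transpose_mult_vec)

lemma inner_outer_outer: "inner (outer u v) (outer u' v') = inner u u' * inner v v'"
  by (simp add: inner_outer_right outer_mult_vec inner_commute)

lemma inner_transpose: "inner (transpose A) (transpose B) = inner A B" for A :: "real^'m^'n"
  by (simp add: inner_vec_def transpose_def, subst sum.swap) simp

lemma inner_matrix_mult_left: "inner (A ** B) C = inner B (transpose A ** C)" 
  for A :: "real^'m^'n" and B :: "real^'k^'m"
proof -
  have 1: "inner (A ** B) C = (\<Sum>i\<in>UNIV. \<Sum>j\<in>UNIV. \<Sum>k\<in>UNIV. vec_nth (vec_nth A i) k * vec_nth (vec_nth B k) j * vec_nth (vec_nth C i) j)"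
    by (simp add: inner_vec_def matrix_matrix_mult_def sum_distrib_right)
  have "inner B (transpose A ** C) = (\<Sum>k\<in>UNIV. \<Sum>j\<in>UNIV. \<Sum>i\<in>UNIV. vec_nth (vec_nth A i) k * vec_nth (vec_nth B k) j * vec_nth (vec_nth C i) j)"
    by (simp add: inner_vec_def matrix_matrix_mult_def transpose_def sum_distrib_left mult_ac)
  also have "\<dots> = (\<Sum>k\<in>UNIV. \<Sum>i\<in>UNIV. \<Sum>j\<in>UNIV. vec_nth (vec_nth A i) k * vec_nth (vec_nth B k) j * vec_nth (vec_nth C i) j)"
    by (subst (2) sum.swap) simp
  also have "\<dots> = (\<Sum>i\<in>UNIV. \<Sum>k\<in>UNIV. \<Sum>j\<in>UNIV. vec_nth (vec_nth A i) k * vec_nth (vec_nth B k) j * vec_nth (vec_nth C i) j)"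
    by (rule sum.swap)
  also have "\<dots> = (\<Sum>i\<in>UNIV. \<Sum>j\<in>UNIV. \<Sum>k\<in>UNIV. vec_nth (vec_nth A i) k * vec_nth (vec_nth B k) j * vec_nth (vec_nth C i) j)"
    by (subst (2) sum.swap) simp
  finally show ?thesis using 1 by simp
qed

lemma bounded_bilinear_matrix_mult:
  "bounded_bilinear (\<lambda>(A::real^'m^'n) (B::real^'k^'m). A ** B)"
  by (rule bilinear_conv_bounded_bilinear[THEN iffD1])
    (auto simp: bilinear_def matrix_matrix_mult_def Finite_Cartesian_Product.vec_eq_iff algebra_simps sum.distrib
      sum_distrib_left intro!: linearI)

lemma bounded_linear_transpose: "bounded_linear (transpose :: real^'m^'n \<Rightarrow> real^'n^'m)"
  by (rule linear_conv_bounded_linear[THEN iffD1])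
    (auto simp: transpose_def Finite_Cartesian_Product.vec_eq_iff intro!: linearI)

lemma bounded_bilinear_matrix_vector_mult:
  "bounded_bilinear (\<lambda>(A::real^'m^'n) x. A *v x)"
  by (rule bilinear_conv_bounded_bilinear[THEN iffD1])
    (auto simp: bilinear_def matrix_vector_mult_def Finite_Cartesian_Product.vec_eq_iff algebra_simps sum.distrib
      sum_distrib_left intro!: linearI)

lemma sub_orthonormal_outer:
  assumes "sub_orthonormal_on I e" "sub_orthonormal_on J e'"
  shows "sub_orthonormal_on (I \<times> J) (\<lambda>(i, j). outer (e i) (e' j))"
proof -
  have "inner (e i) (e i) * inner (e' j) (e' j) \<le> 1" if "i \<in> I" "j \<in> J" for i j
    using assms that by (intro mult_le_one) (auto simp: sub_orthonormal_on_def)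
  then show ?thesis
    using assms by (auto simp: sub_orthonormal_on_def inner_outer_outer)
qed

lemma orthonormal_outer:
  assumes "orthonormal_on I e" "orthonormal_on J e'"
  shows "orthonormal_on (I \<times> J) (\<lambda>(i, j). outer (e i) (e' j))"
  using assms by (auto simp: orthonormal_on_def inner_outer_outer)

lemma rank_le_dim:
  fixes K :: "real^'m^'n"
  assumes "\<And>w. K *v w \<in> X"
  shows "rank K \<le> dim X"
  unfolding rank_dim_range using assms by (intro dim_subset) auto

section \<open>Singular value decomposition\<close>

text \<open>A unit vector \<open>v\<close> at which |A v| is maximal works: stationarity of |A v|^2
  on the sphere says that A^T A v = \<sigma>^2 v.\<close>

lemma svd_peel:
  fixes A :: "real^'m^'n"
  assumes "A \<noteq> 0"
  obtains \<sigma> u v where "\<sigma> > 0" "norm u = 1" "norm v = 1"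
    "A *v v = \<sigma> *\<^sub>R u" "transpose A *v u = \<sigma> *\<^sub>R v"
proof -
  let ?S = "sphere (0::real^'m) 1"
  have "continuous_on ?S (\<lambda>x. norm (A *v x))"
    by (intro continuous_intros linear_continuous_on matrix_vector_mul_bounded_linear)
  moreover have "?S \<noteq> {}" by simp
  ultimately obtain v where v: "norm v = 1" and vmax: "\<And>x. norm x = 1 \<Longrightarrow> norm (A *v x) \<le> norm (A *v v)"
    using continuous_attains_sup[of ?S "\<lambda>x. norm (A *v x)"] by auto
  define \<sigma> where "\<sigma> = norm (A *v v)"
  have bd: "norm (A *v x) \<le> \<sigma> * norm x" for x
  proof (cases "x = 0")
    case False
    then have "norm (A *v ((1 / norm x) *\<^sub>R x)) \<le> \<sigma>" unfolding \<sigma>_def by (intro vmax) simp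
    then show ?thesis using False by (simp add: matrix_vector_mult_scaleR field_simps)
  qed simp
  have "\<sigma> > 0"
  proof (rule ccontr)
    assume "\<not> \<sigma> > 0"
    then have "\<sigma> = 0" by (simp add: \<sigma>_def)
    then have "A *v x = 0" for x using bd[of x] by simp
    then show False using assms by (simp add: matrix_eq)
  qed
  \<comment> \<open>Perturbing \<open>v\<close> by \<open>t *\<^sub>R w\<close> gives a quadratic in
    \<open>t\<close> without constant term that is nowhere positive, so its linear coefficient
    \<open>b\<close> vanishes.\<close>
  have grad0: "inner (A *v v) (A *v w) = \<sigma>\<^sup>2 * inner v w" for w
  proof -
    define b where "b = 2 * (inner (A *v v) (A *v w) - \<sigma>\<^sup>2 * inner v w)"
    define c where "c = (norm (A *v w))\<^sup>2 - \<sigma>\<^sup>2 * (norm w)\<^sup>2"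
    have "t * b + t\<^sup>2 * c \<le> 0" for t
    proof -
      have "(norm (A *v (v + t *\<^sub>R w)))\<^sup>2 \<le> (\<sigma> * norm (v + t *\<^sub>R w))\<^sup>2"
        by (rule power_mono[OF bd]) simp
      then have le: "inner (A *v v + t *\<^sub>R (A *v w)) (A *v v + t *\<^sub>R (A *v w)) \<le> \<sigma>\<^sup>2 * inner (v + t *\<^sub>R w) (v + t *\<^sub>R w)"
        by (simp add: power_mult_distrib power2_norm_eq_inner matrix_vector_right_distrib matrix_vector_mult_scaleR)
      have vv: "inner v v = 1" "inner (A *v v) (A *v v) = \<sigma>\<^sup>2"
        using v by (simp_all add: \<sigma>_def power2_norm_eq_inner[symmetric])
      show ?thesis using le unfolding b_def c_def power2_norm_eq_inner
        by (simp add: inner_add_left inner_add_right inner_commute vv algebra_simps power2_eq_square)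
    qed
    note q = this
    have "b = 0"
    proof (rule ccontr)
      assume b0: "b \<noteq> 0"
      \<comment> \<open>So small that the quadratic term costs at most half of the positive linear
        term.\<close>
      define t where "t = b / (2 * (abs c + 1))"
      have "t\<^sup>2 * abs c \<le> t\<^sup>2 * (abs c + 1)" by (intro mult_left_mono) auto
      also have "\<dots> = t * (t * (abs c + 1))" by (simp add: power2_eq_square)
      also have "t * (abs c + 1) = b / 2" by (simp add: t_def divide_simps)
      finally have "t\<^sup>2 * abs c \<le> t * b / 2" by simp
      moreover have "t\<^sup>2 * (- abs c) \<le> t\<^sup>2 * c" by (intro mult_left_mono) auto
      moreover have "t * b > 0" using b0 by (simp add: t_def zero_less_mult_iff flip: power2_eq_square)
      ultimately show False using q[of t] by simp
    qed
    then show ?thesis by (simp add: b_def)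
  qed
  define u where "u = (1 / \<sigma>) *\<^sub>R (A *v v)"
  have "A *v v = \<sigma> *\<^sub>R u" using \<open>\<sigma> > 0\<close> by (simp add: u_def)
  moreover have "norm u = 1" using \<open>\<sigma> > 0\<close> by (simp add: u_def \<sigma>_def)
  moreover have "transpose A *v u = \<sigma> *\<^sub>R v"
  proof (rule vector_eq_ldot[THEN iffD1], intro allI)
    fix w
    have "inner (transpose A *v u) w = inner (A *v v) (A *v w) / \<sigma>"
      unfolding inner_transpose_mult_vec by (simp add: u_def)
    then show "inner w (transpose A *v u) = inner w (\<sigma> *\<^sub>R v)"
      using \<open>\<sigma> > 0\<close> by (simp add: grad0 inner_commute power2_eq_square)
  qed
  ultimately show ?thesis using that \<open>\<sigma> > 0\<close> v by blast
qed

text \<open>This is the thin decomposition: only positive singular values occur, in no particular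
  order, so that \<open>k\<close> is forced to be the rank.\<close>

definition svd :: "nat \<Rightarrow> (nat \<Rightarrow> real) \<Rightarrow> (nat \<Rightarrow> real^'n) \<Rightarrow> (nat \<Rightarrow> real^'m) \<Rightarrow> real^'m^'n \<Rightarrow> bool" where
  "svd k \<sigma> u v A \<longleftrightarrow> (\<forall>i<k. \<sigma> i > 0) \<and> orthonormal_on {..<k} u \<and> orthonormal_on {..<k} v \<and>
     A = (\<Sum>i<k. \<sigma> i *\<^sub>R outer (u i) (v i))"

lemma outer_sum_mult_vec:
  "(\<Sum>i\<in>I. s i *\<^sub>R outer (x i) (y i)) *v w = (\<Sum>i\<in>I. (s i * inner (y i) w) *\<^sub>R x i)"
proof -
  interpret mv: bounded_bilinear "\<lambda>(A::real^'b^'a) x. A *v x"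
    by (rule bounded_bilinear_matrix_vector_mult)
  show ?thesis by (simp add: mv.sum_left mv.scaleR_left outer_mult_vec)
qed

lemma svd_mult_vec:
  assumes "svd k \<sigma> u v A"
  shows "A *v w = (\<Sum>i<k. (\<sigma> i * inner (v i) w) *\<^sub>R u i)"
  using assms outer_sum_mult_vec[of \<sigma> u v "{..<k}" w] by (simp add: svd_def)

lemma svd_transpose: "svd k \<sigma> u v A \<Longrightarrow> svd k \<sigma> v u (transpose A)"
  unfolding svd_def
  by (simp add: bounded_linear.linear[OF bounded_linear_transpose] linear_sum linear_cmul transpose_outer)

lemma svd_right:
  assumes "svd k \<sigma> u v A" "i < k"
  shows "A *v v i = \<sigma> i *\<^sub>R u i"
proof -
  have "A *v v i = (\<Sum>j<k. if j = i then \<sigma> i *\<^sub>R u i else 0)"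
    unfolding svd_mult_vec[OF assms(1)] using assms
    by (intro sum.cong) (auto simp: svd_def orthonormal_on_def)
  then show ?thesis using assms by simp
qed

lemma svd_left: "svd k \<sigma> u v A \<Longrightarrow> i < k \<Longrightarrow> transpose A *v u i = \<sigma> i *\<^sub>R v i"
  using svd_right[OF svd_transpose] .

text \<open>Induction on the bound for the rank: removing one singular triple \<tau> a b^T makes
  \<open>A\<close> vanish on \<open>b\<close> and its transpose vanish on \<open>a\<close>, which
  lowers the rank and keeps the remaining singular vectors orthogonal to \<open>a\<close> and
  \<open>b\<close>.\<close>

lemma svd_exists_le:
  fixes A :: "real^'m^'n"
  assumes "rank A \<le> n"
  shows "\<exists>k \<sigma> u v. svd k \<sigma> u v A \<and> k \<le> n"
  using assms
proof (induction n arbitrary: A)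
  case 0
  then have "A = 0" by (simp add: rank_eq_0)
  then have "svd 0 undefined undefined undefined A" by (simp add: svd_def orthonormal_on_def)
  then show ?case by blast
next
  case (Suc n)
  show ?case
  proof (cases "A = 0")
    case True
    then have "svd 0 undefined undefined undefined A" by (simp add: svd_def orthonormal_on_def)
    then show ?thesis by blast
  next
    case False
    then obtain \<tau> a b where \<tau>: "\<tau> > 0" and a: "norm a = 1" and b: "norm b = 1"
      and Ab: "A *v b = \<tau> *\<^sub>R a" and Aa: "transpose A *v a = \<tau> *\<^sub>R b"
      using svd_peel by blast
    define A' where "A' = A - \<tau> *\<^sub>R outer a b"
    have aa: "inner a a = 1" and bb: "inner b b = 1" using a b by (simp_all add: norm_eq_1)
    have A'w: "A' *v w = A *v w - (\<tau> * inner b w) *\<^sub>R a" for w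
      by (simp add: A'_def matrix_vector_mult_diff_rdistrib scaleR_matrix_vector_assoc[symmetric] outer_mult_vec)
    have A'tw: "transpose A' *v w = transpose A *v w - (\<tau> * inner a w) *\<^sub>R b" for w
    proof -
      have "transpose A' = transpose A - \<tau> *\<^sub>R outer b a"
        by (simp add: A'_def bounded_linear.linear[OF bounded_linear_transpose] linear_diff linear_cmul transpose_outer)
      then show ?thesis
        by (simp only: matrix_vector_mult_diff_rdistrib scaleR_matrix_vector_assoc[symmetric] outer_mult_vec scaleR_scaleR)
    qed
    have A'b: "A' *v b = 0" using Ab bb by (simp add: A'w)
    have A'a: "transpose A' *v a = 0" using Aa aa unfolding A'tw by simp
    \<comment> \<open>The vector \<open>a\<close> lies in the range of \<open>A\<close> but is
      orthogonal to the range of \<open>A'\<close>, so the inclusion is strict.\<close>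
    have "range ((*v) A') \<subset> range ((*v) A)"
    proof
      show "range ((*v) A') \<subseteq> range ((*v) A)"
      proof safe
        fix w
        have "A' *v w = A *v (w - inner b w *\<^sub>R b)"
          by (simp add: A'w matrix_vector_mult_diff_distrib matrix_vector_mult_scaleR Ab mult.commute)
        then show "A' *v w \<in> range ((*v) A)" by blast
      qed
      have "a \<notin> range ((*v) A')"
      proof
        assume "a \<in> range ((*v) A')"
        then obtain w where "a = A' *v w" by blast
        then have "inner a a = inner (transpose A' *v a) w" by (metis inner_transpose_mult_vec)
        then show False using A'a aa by simp
      qed
      moreover have "a = A *v ((1 / \<tau>) *\<^sub>R b)" using \<tau> by (simp add: matrix_vector_mult_scaleR Ab)
      ultimately show "range ((*v) A') \<noteq> range ((*v) A)" by blast
    qed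
    moreover have "span (range ((*v) A')) = range ((*v) A')" "span (range ((*v) A)) = range ((*v) A)"
      by (auto intro!: span_eq_iff[THEN iffD2] linear_subspace_image)
    ultimately have "rank A' < rank A"
      unfolding rank_dim_range by (intro dim_psubset) (simp only:)
    then have "rank A' \<le> n" using Suc.prems by simp
    from Suc.IH[OF this] obtain k \<sigma> u v where k: "svd k \<sigma> u v A'" "k \<le> n" by blast
    have ua: "inner a (u i) = 0" if "i < k" for i
    proof -
      have "\<sigma> i * inner a (u i) = inner (transpose A' *v a) (v i)"
        using svd_right[OF k(1) that] by (simp only: inner_transpose_mult_vec) simp
      then show ?thesis using A'a k(1) that by (auto simp: svd_def)
    qed
    have vb: "inner b (v i) = 0" if "i < k" for i
    proof -
      have "\<sigma> i * inner b (v i) = inner (transpose (transpose A') *v b) (u i)"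
        using svd_left[OF k(1) that] by (simp only: inner_transpose_mult_vec) simp
      then show ?thesis using A'b k(1) that by (auto simp: svd_def)
    qed
    have "svd (k + 1) (append_fun k \<sigma> (\<lambda>_. \<tau>)) (append_fun k u (\<lambda>_. a)) (append_fun k v (\<lambda>_. b)) A"
      unfolding svd_def sum_append
    proof (intro conjI)
      show "orthonormal_on {..<k+1} (append_fun k u (\<lambda>_. a))"
        using k(1) ua aa by (intro orthonormal_append) (auto simp: svd_def orthonormal_on_def inner_commute)
      show "orthonormal_on {..<k+1} (append_fun k v (\<lambda>_. b))"
        using k(1) vb bb by (intro orthonormal_append) (auto simp: svd_def orthonormal_on_def inner_commute)
      show "\<forall>i<k+1. append_fun k \<sigma> (\<lambda>_. \<tau>) i > 0"
        using k(1) \<tau> by (simp add: append_fun_def svd_def)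
      have "A = A' + \<tau> *\<^sub>R outer a b" by (simp add: A'_def)
      also have "A' = (\<Sum>i<k. append_fun k \<sigma> (\<lambda>_. \<tau>) i *\<^sub>R outer (append_fun k u (\<lambda>_. a) i) (append_fun k v (\<lambda>_. b) i))"
        using k(1) by (simp add: svd_def)
      finally show "A = (\<Sum>i<k. append_fun k \<sigma> (\<lambda>_. \<tau>) i *\<^sub>R outer (append_fun k u (\<lambda>_. a) i) (append_fun k v (\<lambda>_. b) i))
        + (\<Sum>j<1. append_fun k \<sigma> (\<lambda>_. \<tau>) (k + j) *\<^sub>R outer (append_fun k u (\<lambda>_. a) (k + j)) (append_fun k v (\<lambda>_. b) (k + j)))"
        by simp
    qed
    then show ?thesis using k(2) by (metis Suc_eq_plus1 Suc_le_mono)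
  qed
qed

lemma dim_family_le: "dim (span (f ` {..<k})) \<le> k" for f :: "nat \<Rightarrow> 'a::euclidean_space"
  using dim_le_card'[of "f ` {..<k}"] card_image_le[of "{..<k}" f] by (simp add: dim_span)

lemma rank_le_svd:
  assumes "svd k \<sigma> u v A"
  shows "rank A \<le> k"
proof -
  have "A *v w \<in> span (u ` {..<k})" for w
    unfolding svd_mult_vec[OF assms] by (intro span_sum span_mul span_base) auto
  then have "rank A \<le> dim (span (u ` {..<k}))" by (rule rank_le_dim)
  then show ?thesis using dim_family_le order_trans by blast
qed

lemma svd_exists:
  fixes A :: "real^'m^'n"
  obtains \<sigma> u v where "svd (rank A) \<sigma> u v A"
proof -
  obtain k \<sigma> u v where "svd k \<sigma> u v A" "k \<le> rank A" using svd_exists_le[of A "rank A"] by blast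
  moreover from this have "rank A \<le> k" using rank_le_svd by blast
  ultimately show ?thesis using that by (metis le_antisym)
qed

section \<open>Second derivatives\<close>

lemma grad_eq: "GDERIV f x :> D \<Longrightarrow> grad f x = D"
  unfolding grad_def
proof (rule the_equality)
  fix D' assume "GDERIV f x :> D" "GDERIV f x :> D'"
  then have "(\<lambda>h. inner h D) = (\<lambda>h. inner h D')"
    unfolding gderiv_def by (rule has_derivative_unique)
  then show "D' = D" by (metis vector_eq_ldot)
qed

context
  fixes h :: "'a::euclidean_space \<Rightarrow> real" and D :: "'a \<Rightarrow> 'a \<Rightarrow> real"
  assumes D: "\<And>x. (h has_derivative D x) (at x)"
begin

lemma derivative_expand: "D x k = (\<Sum>b\<in>Basis. inner k b * D x b)"
proof -
  have "D x k = D x (\<Sum>b\<in>Basis. inner k b *\<^sub>R b)" by (simp add: euclidean_representation)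
  also have "\<dots> = (\<Sum>b\<in>Basis. inner k b * D x b)"
    using has_derivative_linear[OF D] by (simp add: linear_sum linear_cmul)
  finally show ?thesis .
qed

lemma gderiv_from_derivative: "GDERIV h x :> (\<Sum>b\<in>Basis. D x b *\<^sub>R b)"
proof -
  have "D x = (\<lambda>k. inner k (\<Sum>b\<in>Basis. D x b *\<^sub>R b))"
    by (rule ext, subst derivative_expand) (simp add: inner_sum_right mult.commute)
  then show ?thesis using D[of x] unfolding gderiv_def by metis
qed

lemma inner_grad: "inner (grad h x) k = D x k"
  unfolding grad_eq[OF gderiv_from_derivative] derivative_expand[of x k]
  by (simp add: inner_sum_left) (simp add: mult.commute inner_commute)

lemma first_order_critical_iff: "first_order_critical h x \<longleftrightarrow> (\<forall>k. D x k = 0)"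
proof
  assume "first_order_critical h x"
  then have "grad h x = 0" unfolding first_order_critical_def by (rule grad_eq)
  then show "\<forall>k. D x k = 0" using inner_grad[of x] by simp
next
  assume "\<forall>k. D x k = 0"
  then show "first_order_critical h x"
    using gderiv_from_derivative[of x] by (simp add: first_order_critical_def)
qed

text \<open>It suffices to differentiate \<open>D y k\<close> in \<open>y\<close> for each fixed
  \<open>k\<close>, since the gradient is a finite combination of these functions over the standard
  basis.\<close>

lemma
  assumes D2: "\<And>k. ((\<lambda>y. D y k) has_derivative (\<lambda>u. D2 u k)) (at x)"
  shows grad_has_derivative: "(grad h has_derivative (\<lambda>u. \<Sum>b\<in>Basis. D2 u b *\<^sub>R b)) (at x)"
    and hessian_eq: "hessian h x u k = D2 u k"
proof -
  have "grad h = (\<lambda>y. \<Sum>b\<in>Basis. D y b *\<^sub>R b)"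
    using grad_eq[OF gderiv_from_derivative] by blast
  then show 1: "(grad h has_derivative (\<lambda>u. \<Sum>b\<in>Basis. D2 u b *\<^sub>R b)) (at x)"
    by (auto intro!: has_derivative_sum has_derivative_scaleR_left D2)
  have "((\<lambda>y. D y k) has_derivative (\<lambda>u. \<Sum>b\<in>Basis. inner k b * D2 u b)) (at x)"
    by (subst derivative_expand) (intro has_derivative_sum has_derivative_mult_right D2)
  then have "(\<lambda>u. D2 u k) = (\<lambda>u. \<Sum>b\<in>Basis. inner k b * D2 u b)"
    using D2[of k] has_derivative_unique by blast
  then have "D2 u k = (\<Sum>b\<in>Basis. inner k b * D2 u b)" by metis
  then show "hessian h x u k = D2 u k"
    unfolding hessian_def frechet_derivative_at[OF 1, symmetric]
    by (simp add: inner_sum_left) (simp add: mult.commute inner_commute)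
qed

end

text \<open>The second derivative is fixed as data \<open>H\<close> with values in the bounded
  linear maps, so that it can be integrated along a segment as an operator.\<close>

locale C2_function =
  fixes f :: "'a::euclidean_space \<Rightarrow> real" and H :: "'a \<Rightarrow> 'a \<Rightarrow>\<^sub>L 'a"
  assumes f_derivative: "(f has_derivative (\<lambda>k. inner (grad f x) k)) (at x)"
    and grad_derivative: "(grad f has_derivative blinfun_apply (H x)) (at x)"
    and H_continuous: "continuous_on UNIV H"
begin

lemma hessian_H: "hessian f x u k = inner (H x u) k"
  by (simp add: hessian_def frechet_derivative_at[OF grad_derivative, symmetric])

lemma f_line_derivative:
  "((\<lambda>t. f (x + t *\<^sub>R u)) has_real_derivative inner (grad f (x + t *\<^sub>R u)) u) (at t)"
proof -
  have "((\<lambda>t. f (x + t *\<^sub>R u)) has_derivative (\<lambda>s. inner (grad f (x + t *\<^sub>R u)) (s *\<^sub>R u))) (at t)"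
    by (rule has_derivative_compose[OF _ f_derivative]) (auto intro!: derivative_eq_intros)
  then show ?thesis by (simp add: has_field_derivative_def mult_commute_abs)
qed

lemma grad_line_derivative:
  "((\<lambda>t. grad f (x + t *\<^sub>R u)) has_vector_derivative H (x + t *\<^sub>R u) u) (at t)"
proof -
  have "((\<lambda>t. grad f (x + t *\<^sub>R u)) has_derivative (\<lambda>s. H (x + t *\<^sub>R u) (s *\<^sub>R u))) (at t)"
    by (rule has_derivative_compose[OF _ grad_derivative]) (auto intro!: derivative_eq_intros)
  then show ?thesis by (simp add: has_vector_derivative_def blinfun.scaleR_right)
qed

lemma grad_line_inner_derivative:
  "((\<lambda>t. inner (grad f (x + t *\<^sub>R u)) k) has_real_derivative inner (H (x + t *\<^sub>R u) u) k) (at t)"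
  using has_derivative_inner_left[OF grad_line_derivative[of x u t, unfolded has_vector_derivative_def], of k]
  by (simp add: has_field_derivative_def mult_commute_abs)

text \<open>The mean value theorem is used twice: along \<open>u\<close> for the difference of
  \<open>f\<close> on two lines parallel to \<open>u\<close>, then along \<open>k\<close> for the
  derivative in direction \<open>u\<close>.\<close>

lemma second_difference:
  assumes "h > 0"
  obtains a b where "0 < a" "a < h" "0 < b" "b < h"
    "f (x + h *\<^sub>R u + h *\<^sub>R k) - f (x + h *\<^sub>R u) - f (x + h *\<^sub>R k) + f x
      = h\<^sup>2 * inner (H (x + a *\<^sub>R u + b *\<^sub>R k) k) u"
proof -
  have "((\<lambda>s. f (x + h *\<^sub>R k + s *\<^sub>R u) - f (x + s *\<^sub>R u)) has_real_derivative
      inner (grad f (x + h *\<^sub>R k + s *\<^sub>R u)) u - inner (grad f (x + s *\<^sub>R u)) u) (at s)" for s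
    by (intro DERIV_diff f_line_derivative)
  from MVT2[OF assms this] obtain a where a: "0 < a" "a < h" and
    1: "f (x + h *\<^sub>R k + h *\<^sub>R u) - f (x + h *\<^sub>R u) - (f (x + h *\<^sub>R k) - f x)
      = h * (inner (grad f (x + h *\<^sub>R k + a *\<^sub>R u)) u - inner (grad f (x + a *\<^sub>R u)) u)"
    by auto
  from MVT2[OF assms grad_line_inner_derivative[of "x + a *\<^sub>R u" k u]] obtain b
    where b: "0 < b" "b < h" and
    2: "inner (grad f (x + a *\<^sub>R u + h *\<^sub>R k)) u - inner (grad f (x + a *\<^sub>R u)) u
      = h * inner (H (x + a *\<^sub>R u + b *\<^sub>R k) k) u"
    by auto
  show ?thesis
    using that[OF a b] 1 2 by (simp add: add_ac algebra_simps power2_eq_square)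
qed

text \<open>Schwarz's theorem. The second difference does not change when \<open>u\<close> and
  \<open>k\<close> are exchanged, so Hessian entries at two points arbitrarily near \<open>x\<close>
  coincide; continuity moves both to \<open>x\<close>.\<close>

lemma H_symmetric: "inner (H x u) k = inner (H x k) u"
proof (rule ccontr)
  assume neq: "inner (H x u) k \<noteq> inner (H x k) u"
  define \<epsilon> where "\<epsilon> = \<bar>inner (H x u) k - inner (H x k) u\<bar> / 2"
  have \<epsilon>: "\<epsilon> > 0" using neq by (simp add: \<epsilon>_def)
  have "isCont (\<lambda>y. inner (H y p) q) x" for p q
    using H_continuous by (intro continuous_intros) (simp add: continuous_on_eq_continuous_at)
  then have "\<forall>p q. \<exists>d>0. \<forall>y. dist y x < d \<longrightarrow> \<bar>inner (H y p) q - inner (H x p) q\<bar> < \<epsilon>"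
    using \<epsilon> unfolding continuous_at_eps_delta dist_real_def by blast
  then obtain d1 d2 where d: "d1 > 0" "d2 > 0"
    and 1: "\<And>y. dist y x < d1 \<Longrightarrow> \<bar>inner (H y u) k - inner (H x u) k\<bar> < \<epsilon>"
    and 2: "\<And>y. dist y x < d2 \<Longrightarrow> \<bar>inner (H y k) u - inner (H x k) u\<bar> < \<epsilon>"
    by blast
  \<comment> \<open>Keeps all intermediate points within both radii; the summand 1 avoids division
    by zero.\<close>
  define h where "h = min d1 d2 / (norm u + norm k + 1)"
  have h: "h > 0" using d by (simp add: h_def add_nonneg_pos)
  have hd: "h * (norm u + norm k) < min d1 d2"
  proof -
    have "h * (norm u + norm k) < h * (norm u + norm k + 1)" using h by simp
    also have "\<dots> = min d1 d2" unfolding h_def by (simp add: add_nonneg_eq_0_iff)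
    finally show ?thesis .
  qed
  have near: "dist (x + a *\<^sub>R p + b *\<^sub>R q) x < min d1 d2"
    if "0 < a" "a < h" "0 < b" "b < h" "norm p + norm q = norm u + norm k" for a b p q
  proof -
    have "dist (x + a *\<^sub>R p + b *\<^sub>R q) x \<le> a * norm p + b * norm q"
      using that norm_triangle_ineq[of "a *\<^sub>R p" "b *\<^sub>R q"] by (simp add: dist_norm)
    also have "\<dots> \<le> h * norm p + h * norm q" using that by (intro add_mono mult_right_mono) auto
    also have "\<dots> = h * (norm u + norm k)" using that(5) by (simp flip: distrib_left)
    finally show ?thesis using hd by simp
  qed
  obtain a b where ab: "0 < a" "a < h" "0 < b" "b < h"
    "f (x + h *\<^sub>R u + h *\<^sub>R k) - f (x + h *\<^sub>R u) - f (x + h *\<^sub>R k) + f x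
      = h\<^sup>2 * inner (H (x + a *\<^sub>R u + b *\<^sub>R k) k) u"
    using second_difference[OF h] by blast
  obtain a' b' where ab': "0 < a'" "a' < h" "0 < b'" "b' < h"
    "f (x + h *\<^sub>R k + h *\<^sub>R u) - f (x + h *\<^sub>R k) - f (x + h *\<^sub>R u) + f x
      = h\<^sup>2 * inner (H (x + a' *\<^sub>R k + b' *\<^sub>R u) u) k"
    using second_difference[OF h] by blast
  have "h\<^sup>2 * inner (H (x + a *\<^sub>R u + b *\<^sub>R k) k) u = h\<^sup>2 * inner (H (x + a' *\<^sub>R k + b' *\<^sub>R u) u) k"
    using ab(5) ab'(5)[unfolded add.assoc[of x] add.commute[of "h *\<^sub>R k"], folded add.assoc[of x]]
    by linarith
  then have "inner (H (x + a *\<^sub>R u + b *\<^sub>R k) k) u = inner (H (x + a' *\<^sub>R k + b' *\<^sub>R u) u) k"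
    using h by simp
  moreover have "\<bar>inner (H (x + a *\<^sub>R u + b *\<^sub>R k) k) u - inner (H x k) u\<bar> < \<epsilon>"
    using near[OF ab(1-4)] by (intro 2) simp
  moreover have "\<bar>inner (H (x + a' *\<^sub>R k + b' *\<^sub>R u) u) k - inner (H x u) k\<bar> < \<epsilon>"
    using near[OF ab'(1-4)] by (intro 1) simp
  ultimately have "\<bar>inner (H x u) k - inner (H x k) u\<bar> < 2 * \<epsilon>" by linarith
  then show False by (simp add: \<epsilon>_def)
qed

text \<open>The operator is the integral of the Hessian over the segment from \<open>x\<close> to
  \<open>x + e\<close>. The fundamental theorem of calculus gives its value at \<open>e\<close>;
  symmetry and bounds on the quadratic form pass through the integral.\<close>

lemma averaged_hessian:
  obtains A :: "'a \<Rightarrow>\<^sub>L 'a" where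
    "A e = grad f (x + e) - grad f x"
    "\<And>u k. inner (A u) k = inner (A k) u"
    "\<And>k c. (\<And>t. hessian f (x + t *\<^sub>R e) k k \<ge> c) \<Longrightarrow> inner (A k) k \<ge> c"
    "\<And>k c. (\<And>t. hessian f (x + t *\<^sub>R e) k k \<le> c) \<Longrightarrow> inner (A k) k \<le> c"
proof -
  define A where "A = integral {0..1} (\<lambda>t. H (x + t *\<^sub>R e))"
  have "continuous_on {0..1} (\<lambda>t. H (x + t *\<^sub>R e))"
    by (rule continuous_on_compose2[OF H_continuous]) (auto intro!: continuous_intros)
  then have I: "((\<lambda>t. H (x + t *\<^sub>R e)) has_integral A) {0..1}"
    unfolding A_def by (intro integrable_integral integrable_continuous_interval)
  have Iu: "((\<lambda>t. H (x + t *\<^sub>R e) u) has_integral A u) {0..1}" for u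
    using has_integral_linear[OF I blinfun.bounded_linear_left[of u]] by (simp add: o_def)
  have Iuk: "((\<lambda>t. inner (H (x + t *\<^sub>R e) u) k) has_integral inner (A u) k) {0..1}" for u k
    using has_integral_linear[OF Iu bounded_linear_inner_left[of k]] by (simp add: o_def)
  have one: "((\<lambda>t. c) has_integral c) {0..1::real}" for c :: real
    using has_integral_const_real[of c 0 1] by simp
  show ?thesis
  proof
    have "((\<lambda>t. H (x + t *\<^sub>R e) e) has_integral
        grad f (x + 1 *\<^sub>R e) - grad f (x + 0 *\<^sub>R e)) {0..1}"
      by (intro fundamental_theorem_of_calculus has_vector_derivative_at_within[OF grad_line_derivative]) simp
    then show "A e = grad f (x + e) - grad f x" using has_integral_unique[OF Iu] by simp
    show "inner (A u) k = inner (A k) u" for u k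
      using has_integral_unique[OF Iuk[of u k] Iuk[of k u, unfolded H_symmetric[of _ k u]]] .
    show "inner (A k) k \<ge> c" if "\<And>t. hessian f (x + t *\<^sub>R e) k k \<ge> c" for k c
      using has_integral_le[OF one Iuk[of k k]] that by (simp add: hessian_H)
    show "inner (A k) k \<le> c" if "\<And>t. hessian f (x + t *\<^sub>R e) k k \<le> c" for k c
      using has_integral_le[OF Iuk[of k k] one] that by (simp add: hessian_H)
  qed
qed

text \<open>Along the line through \<open>x\<close> the directional derivative is 0 at
  \<open>t = 0\<close> and does not decrease, so \<open>f\<close> does not decrease for
  \<open>t \<ge> 0\<close>.\<close>

lemma critical_le:
  assumes "grad f x = 0" "\<And>t. hessian f (x + t *\<^sub>R e) e e \<ge> 0"
  shows "f x \<le> f (x + e)"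
proof -
  have g: "inner (grad f (x + t *\<^sub>R e)) e \<ge> 0" if "t \<ge> 0" for t
    using DERIV_nonneg_imp_nondecreasing[OF that, of "\<lambda>t. inner (grad f (x + t *\<^sub>R e)) e"]
      grad_line_inner_derivative[of x e e] assms by (auto simp: hessian_H)
  have "f (x + 0 *\<^sub>R e) \<le> f (x + 1 *\<^sub>R e)"
    using DERIV_nonneg_imp_nondecreasing[of 0 1 "\<lambda>t. f (x + t *\<^sub>R e)"] f_line_derivative[of x e] g
    by fastforce
  then show ?thesis by simp
qed

end

lemma twice_continuously_differentiable_iff:
  "twice_continuously_differentiable f \<longleftrightarrow> (\<exists>H. C2_function f H)"
proof
  assume "twice_continuously_differentiable f"
  then obtain H where f: "\<And>x. f differentiable at x"
    and H: "\<forall>x. (grad f has_derivative blinfun_apply (H x)) (at x)" "continuous_on UNIV H"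
    unfolding twice_continuously_differentiable_def by blast
  have F: "(f has_derivative frechet_derivative f (at x)) (at x)" for x
    using f frechet_derivative_works by blast
  have "frechet_derivative f (at x) = (\<lambda>k. inner (grad f x) k)" for x
    using inner_grad[OF F] by metis
  then have "C2_function f H" using F H by (simp add: C2_function_def)
  then show "\<exists>H. C2_function f H" by blast
next
  assume "\<exists>H. C2_function f H"
  then obtain H where "C2_function f H" ..
  then interpret C2_function f H .
  show "twice_continuously_differentiable f"
    unfolding twice_continuously_differentiable_def
    using f_derivative grad_derivative H_continuous differentiableI by blast
qed

section \<open>The factorized objective\<close>

type_synonym ('n, 'm, 'r) factors = "(real ^ 'r ^ 'n) \<times> (real ^ 'r ^ 'm)"

text \<open>Polarizations of \<open>(U, V) \<mapsto> U V\<^sup>T\<close> and of \<open>(U, V) \<mapsto> U\<^sup>T U - V\<^sup>T V\<close>, each multiplied by two.\<close>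

definition prod_polar :: "('n::finite, 'm::finite, 'r::finite) factors \<Rightarrow> ('n, 'm, 'r) factors \<Rightarrow> real ^ 'm ^ 'n" where
  "prod_polar W w = fst w ** transpose (snd W) + fst W ** transpose (snd w)"

definition gap_polar :: "('n::finite, 'm::finite, 'r::finite) factors \<Rightarrow> ('n, 'm, 'r) factors \<Rightarrow> real ^ 'r ^ 'r" where
  "gap_polar W w = transpose (fst w) ** fst W + transpose (fst W) ** fst w
     - (transpose (snd w) ** snd W + transpose (snd W) ** snd w)"

definition gap :: "('n::finite, 'm::finite, 'r::finite) factors \<Rightarrow> real ^ 'r ^ 'r" where
  "gap W = transpose (fst W) ** fst W - transpose (snd W) ** snd W"

lemma matrix_bilinear_simps:
  fixes A B :: "real^'m^'n" and C D :: "real^'k^'m"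
  shows "(A + B) ** C = A ** C + B ** C" "A ** (C + D) = A ** C + A ** D"
    "(c *\<^sub>R A) ** C = c *\<^sub>R (A ** C)" "A ** (c *\<^sub>R C) = c *\<^sub>R (A ** C)"
    "transpose (A + B) = transpose A + transpose B" "transpose (c *\<^sub>R A) = c *\<^sub>R transpose A"
proof -
  interpret mm: bounded_bilinear "\<lambda>(A::real^'m^'n) (B::real^'k^'m). A ** B"
    by (rule bounded_bilinear_matrix_mult)
  interpret tr: bounded_linear "transpose :: real^'m^'n \<Rightarrow> real^'n^'m"
    by (rule bounded_linear_transpose)
  show "(A + B) ** C = A ** C + B ** C" "A ** (C + D) = A ** C + A ** D"
    "(c *\<^sub>R A) ** C = c *\<^sub>R (A ** C)" "A ** (c *\<^sub>R C) = c *\<^sub>R (A ** C)"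
    by (fact mm.add_left mm.add_right mm.scaleR_left mm.scaleR_right)+
  show "transpose (A + B) = transpose A + transpose B" "transpose (c *\<^sub>R A) = c *\<^sub>R transpose A"
    by (fact tr.add tr.scaleR)+
qed

lemma bounded_bilinear_prod_polar: "bounded_bilinear prod_polar"
  by (rule bilinear_conv_bounded_bilinear[THEN iffD1])
    (auto simp: bilinear_def prod_polar_def matrix_bilinear_simps scaleR_add_right intro!: linearI)

lemma bounded_bilinear_gap_polar: "bounded_bilinear gap_polar"
  by (rule bilinear_conv_bounded_bilinear[THEN iffD1])
    (auto simp: bilinear_def gap_polar_def matrix_bilinear_simps scaleR_add_right scaleR_diff_right intro!: linearI)

interpretation prod_polar: bounded_bilinear prod_polar by (rule bounded_bilinear_prod_polar)
interpretation gap_polar: bounded_bilinear gap_polar by (rule bounded_bilinear_gap_polar)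

lemma prod_polar_commute: "prod_polar W w = prod_polar w W"
  by (simp add: prod_polar_def add.commute)

lemma gap_polar_commute: "gap_polar W w = gap_polar w W"
  by (simp add: gap_polar_def add.commute)

lemma prod_polar_self: "prod_polar W W = 2 *\<^sub>R (fst W ** transpose (snd W))"
  by (simp add: prod_polar_def scaleR_2)

lemma gap_polar_self: "gap_polar W W = 2 *\<^sub>R gap W"
  by (simp add: gap_polar_def gap_def scaleR_2)

lemma regularized_eq:
  "regularized \<mu> f W = f (fst W ** transpose (snd W)) + \<mu> / 4 * inner (gap W) (gap W)"
  by (cases W) (simp add: regularized_def factorized_def gap_def power2_norm_eq_inner)

text \<open>Makes the factorized problem the case \<open>\<mu> = 0\<close>, so that both problems
  are treated together for \<open>\<mu> \<ge> 0\<close>.\<close>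

lemma factorized_eq_regularized: "factorized f = regularized 0 f"
  by (auto simp: regularized_def)

lemma product_derivative:
  "((\<lambda>W. fst W ** transpose (snd W)) has_derivative prod_polar W) (at W)"
proof -
  have "((\<lambda>W. (1/2) *\<^sub>R prod_polar W W) has_derivative
      (\<lambda>w. (1/2) *\<^sub>R (prod_polar W w + prod_polar w W))) (at W)"
    by (intro has_derivative_scaleR_right prod_polar.FDERIV has_derivative_ident)
  moreover have "(\<lambda>w. (1/2) *\<^sub>R (prod_polar W w + prod_polar w W)) = prod_polar W"
    by (auto simp: prod_polar_commute[of _ W] simp flip: scaleR_2)
  ultimately show ?thesis by (simp add: prod_polar_self)
qed

lemma gap_derivative: "(gap has_derivative gap_polar W) (at W)"
proof -
  have "((\<lambda>W. (1/2) *\<^sub>R gap_polar W W) has_derivative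
      (\<lambda>w. (1/2) *\<^sub>R (gap_polar W w + gap_polar w W))) (at W)"
    by (intro has_derivative_scaleR_right gap_polar.FDERIV has_derivative_ident)
  moreover have "(\<lambda>w. (1/2) *\<^sub>R (gap_polar W w + gap_polar w W)) = gap_polar W"
    by (auto simp: gap_polar_commute[of _ W] simp flip: scaleR_2)
  ultimately show ?thesis by (simp add: gap_polar_self)
qed

context
  fixes f :: "real^'m^'n \<Rightarrow> real" and H and \<mu> :: real
  assumes "C2_function f H"
begin

interpretation C2_function f H by fact

lemma regularized_derivative:
  "(regularized \<mu> f has_derivative (\<lambda>w. inner (grad f (fst W ** transpose (snd W))) (prod_polar W w)
     + \<mu> / 2 * inner (gap W) (gap_polar W w))) (at W)"
  unfolding regularized_eq[abs_def]
  by (auto intro!: derivative_eq_intros has_derivative_compose[OF product_derivative f_derivative]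
      gap_derivative simp: inner_commute)

lemma first_order_critical_regularized:
  "first_order_critical (regularized \<mu> f) W \<longleftrightarrow>
    (\<forall>w. inner (grad f (fst W ** transpose (snd W))) (prod_polar W w)
       + \<mu> / 2 * inner (gap W) (gap_polar W w) = 0)"
  by (rule first_order_critical_iff[OF regularized_derivative])

text \<open>Besides the curvature of \<open>f\<close>, the gradient meets the second variation
  \<open>prod_polar w w\<close> of the product, and the penalty contributes the square of its first
  variation and a term that vanishes at balanced points.\<close>

lemma hessian_regularized:
  "hessian (regularized \<mu> f) W w w =
     hessian f (fst W ** transpose (snd W)) (prod_polar W w) (prod_polar W w)
     + inner (grad f (fst W ** transpose (snd W))) (prod_polar w w)
     + \<mu> / 2 * ((norm (gap_polar W w))\<^sup>2 + inner (gap W) (gap_polar w w))"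
proof -
  let ?P = "fst W ** transpose (snd W)"
  have "((\<lambda>W. inner (grad f (fst W ** transpose (snd W))) (prod_polar W k)
     + \<mu> / 2 * inner (gap W) (gap_polar W k)) has_derivative
    (\<lambda>w. inner (grad f ?P) (prod_polar w k) + inner (H ?P (prod_polar W w)) (prod_polar W k)
     + \<mu> / 2 * (inner (gap W) (gap_polar w k) + inner (gap_polar W w) (gap_polar W k)))) (at W)" for k
    by (intro has_derivative_add has_derivative_mult_right has_derivative_inner gap_derivative
        has_derivative_compose[OF product_derivative grad_derivative]
        bounded_linear_imp_has_derivative prod_polar.bounded_linear_left gap_polar.bounded_linear_left)
  from hessian_eq[OF regularized_derivative this] show ?thesis
    by (simp add: hessian_H power2_norm_eq_inner add_ac)
qed

end

section \<open>Singular values, low-rank approximation and projections\<close>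

lemma transpose_linear_simps:
  fixes A B :: "real^'m^'n"
  shows "transpose (0 :: real^'m^'n) = 0" "transpose (- A) = - transpose A"
    "transpose (A - B) = transpose A - transpose B"
  by (simp_all add: transpose_def Finite_Cartesian_Product.vec_eq_iff)

lemma rank_svd:
  fixes A :: "real^'m^'n"
  assumes "svd k \<sigma> u v A"
  shows "rank A = k"
proof (rule antisym[OF rank_le_svd[OF assms]])
  have "u i \<in> range ((*v) A)" if "i < k" for i
  proof -
    have "\<sigma> i > 0" using assms that by (simp add: svd_def)
    then have "u i = A *v ((1 / \<sigma> i) *\<^sub>R v i)"
      using svd_right[OF assms that] by (simp add: matrix_vector_mult_scaleR)
    then show ?thesis by blast
  qed
  then have "card {..<k} \<le> dim (range ((*v) A))"
    using assms by (intro card_orthonormal_le_dim[of _ u]) (auto simp: svd_def)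
  then show "k \<le> rank A" by (simp add: rank_dim_range)
qed

text \<open>Used to read off the rank and the singular values of a sum from those of two orthogonal
  summands.\<close>

lemma svd_append:
  assumes "svd k \<sigma> x y M" "svd l \<tau> u v N"
    "\<And>i j. i < k \<Longrightarrow> j < l \<Longrightarrow> inner (x i) (u j) = 0"
    "\<And>i j. i < k \<Longrightarrow> j < l \<Longrightarrow> inner (y i) (v j) = 0"
  shows "svd (k + l) (append_fun k \<sigma> \<tau>) (append_fun k x u) (append_fun k y v) (M + N)"
  using assms unfolding svd_def sum_append all_less_append
  by (auto intro!: orthonormal_append)

lemma svd_norm:
  assumes "svd k \<sigma> u v A"
  shows "(norm (transpose A *v w))\<^sup>2 = (\<Sum>i<k. (\<sigma> i)\<^sup>2 * (inner (u i) w)\<^sup>2)"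
    and "(norm A)\<^sup>2 = (\<Sum>i<k. (\<sigma> i)\<^sup>2)"
proof -
  have t: "svd k \<sigma> v u (transpose A)" using svd_transpose[OF assms] .
  have "orthonormal_on {..<k} v" using assms by (simp add: svd_def)
  from inner_orthonormal_sums[OF _ this] 
  show "(norm (transpose A *v w))\<^sup>2 = (\<Sum>i<k. (\<sigma> i)\<^sup>2 * (inner (u i) w)\<^sup>2)"
    unfolding svd_mult_vec[OF t] power2_norm_eq_inner
    by (simp add: power2_eq_square mult_ac)
  have "orthonormal_on {..<k} (\<lambda>i. outer (u i) (v i))"
    using assms by (auto simp: svd_def orthonormal_on_def inner_outer_outer)
  from inner_orthonormal_sums[OF _ this]
  show "(norm A)\<^sup>2 = (\<Sum>i<k. (\<sigma> i)\<^sup>2)"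
    unfolding power2_norm_eq_inner using assms by (simp add: svd_def power2_eq_square)
qed

text \<open>This is the Eckart--Young inequality \<open>\<Parallel>N - W\<Parallel>\<^sup>2 \<ge> \<Sum>i\<ge>r. \<omega>\<^sub>i\<^sup>2\<close> with the common terms
  cancelled.\<close>

lemma eckart_young:
  fixes N W :: "real^'m^'n"
  assumes W: "svd (r + k) \<omega> p q W" and ord: "\<And>i j. i < r \<Longrightarrow> j < k \<Longrightarrow> \<omega> (r + j) \<le> \<omega> i"
    and N: "rank N \<le> r"
  shows "2 * inner N W \<le> (norm N)\<^sup>2 + (\<Sum>i<r. (\<omega> i)\<^sup>2)"
proof -
  obtain \<kappa> \<tau> l \<rho> where sN: "svd \<kappa> \<tau> l \<rho> N" and \<kappa>: "\<kappa> \<le> r" using svd_exists_le[OF N] by blast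
  have pos: "\<And>i. i < r + k \<Longrightarrow> \<omega> i > 0" using W by (simp add: svd_def)
  \<comment> \<open>The threshold is the least of the first \<open>r\<close> values. For
    \<open>r = 0\<close> there is none, but then all weights below vanish.\<close>
  have ex: "\<exists>\<theta>\<ge>0. (\<forall>i<r. \<theta> \<le> \<omega> i) \<and> (\<forall>j<k. \<omega> (r + j) \<le> \<theta>)" if "r > 0"
  proof -
    let ?\<theta> = "Min (\<omega> ` {..<r})"
    have "?\<theta> \<in> \<omega> ` {..<r}" using that by (intro Min_in) auto
    then obtain i where i: "i < r" "?\<theta> = \<omega> i" by auto
    show ?thesis
    proof (intro exI[of _ ?\<theta>] conjI allI impI)
      show "?\<theta> \<le> \<omega> i'" if "i' < r" for i' using that by (intro Min_le) auto
      show "\<omega> (r + j) \<le> ?\<theta>" if "j < k" for j using i ord that by simp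
      show "?\<theta> \<ge> 0" using i pos[of i] by simp
    qed
  qed
  \<comment> \<open>\<open>P i\<close> is the squared length of the projection of \<open>p i\<close>
    onto the column space of \<open>N\<close>: each weight is at most 1 and their total is at most
    the rank of \<open>N\<close>.\<close>
  define P where "P i = (\<Sum>c<\<kappa>. (inner (p i) (l c))\<^sup>2)" for i
  have P1: "P i \<le> 1" if "i < r + k" for i
  proof -
    have "P i \<le> (norm (p i))\<^sup>2" unfolding P_def
      using sN by (intro bessel) (auto simp: svd_def orthonormal_imp_sub_orthonormal)
    then show ?thesis using W that by (simp add: svd_def orthonormal_on_def power2_norm_eq_inner)
  qed
  have P0: "P i \<ge> 0" for i by (simp add: P_def sum_nonneg)
  have "(\<Sum>i<r+k. P i) = (\<Sum>c<\<kappa>. \<Sum>i<r+k. (inner (l c) (p i))\<^sup>2)"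
    unfolding P_def by (subst sum.swap) (simp add: inner_commute)
  also have "\<dots> \<le> (\<Sum>c<\<kappa>. (norm (l c))\<^sup>2)"
    using W by (intro sum_mono bessel) (auto simp: svd_def orthonormal_imp_sub_orthonormal)
  also have "\<dots> = \<kappa>" using sN by (simp add: svd_def orthonormal_on_def power2_norm_eq_inner)
  finally have Psum: "(\<Sum>i<r. P i) + (\<Sum>j<k. P (r + j)) \<le> r" using \<kappa> by (simp add: sum_append)
  \<comment> \<open>Splitting \<open>N\<close> into singular triples and applying 2 <x, y> \<le>
    |x|^2 + |y|^2 to each separates \<open>N\<close> from \<open>W\<close>.\<close>
  have "inner N W = (\<Sum>c<\<kappa>. inner (transpose W *v l c) (\<tau> c *\<^sub>R \<rho> c))"
  proof -
    have "inner N W = (\<Sum>c<\<kappa>. \<tau> c * inner W (outer (l c) (\<rho> c)))"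
      using sN by (simp add: svd_def inner_sum_left inner_commute[of W])
    then show ?thesis by (simp only: inner_outer_right' inner_scaleR_right inner_commute)
  qed
  also have "2 * \<dots> \<le> (\<Sum>c<\<kappa>. (norm (transpose W *v l c))\<^sup>2 + (norm (\<tau> c *\<^sub>R \<rho> c))\<^sup>2)"
    unfolding sum_distrib_left
  proof (rule sum_mono)
    fix c
    have "0 \<le> (norm (transpose W *v l c - \<tau> c *\<^sub>R \<rho> c))\<^sup>2" by simp
    then show "2 * inner (transpose W *v l c) (\<tau> c *\<^sub>R \<rho> c)
        \<le> (norm (transpose W *v l c))\<^sup>2 + (norm (\<tau> c *\<^sub>R \<rho> c))\<^sup>2"
      unfolding power2_norm_eq_inner by (simp add: inner_diff_left inner_diff_right inner_commute)
  qed
  also have "\<dots> = (\<Sum>c<\<kappa>. (norm (transpose W *v l c))\<^sup>2) + (\<Sum>c<\<kappa>. (norm (\<tau> c *\<^sub>R \<rho> c))\<^sup>2)"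
    by (simp only: sum.distrib)
  also have "(\<Sum>c<\<kappa>. (norm (\<tau> c *\<^sub>R \<rho> c))\<^sup>2) = (norm N)\<^sup>2"
    unfolding svd_norm(2)[OF sN] unfolding power2_norm_eq_inner using sN
    by (intro sum.cong) (auto simp: svd_def orthonormal_on_def power2_eq_square)
  also have "(\<Sum>c<\<kappa>. (norm (transpose W *v l c))\<^sup>2) = (\<Sum>i<r+k. (\<omega> i)\<^sup>2 * P i)"
    unfolding svd_norm(1)[OF W] P_def sum_distrib_left by (rule sum.swap)
  \<comment> \<open>The weight on indices from \<open>r\<close> on is at most the weight missing
    from the first \<open>r\<close> indices; moving it there across the threshold can only increase
    the sum.\<close>
  also have "\<dots> \<le> (\<Sum>i<r. (\<omega> i)\<^sup>2)"
  proof (cases "r > 0")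
    case True
    then obtain \<theta> where \<theta>: "\<theta> \<ge> 0" "\<And>i. i < r \<Longrightarrow> \<theta> \<le> \<omega> i" "\<And>j. j < k \<Longrightarrow> \<omega> (r + j) \<le> \<theta>"
      using ex by blast
    have "(\<Sum>j<k. (\<omega> (r + j))\<^sup>2 * P (r + j)) \<le> (\<Sum>j<k. \<theta>\<^sup>2 * P (r + j))"
      using \<theta> pos P0 by (intro sum_mono mult_right_mono power_mono) (auto intro: less_imp_le)
    also have "\<dots> \<le> \<theta>\<^sup>2 * (r - (\<Sum>i<r. P i))"
      unfolding sum_distrib_left[symmetric] using Psum by (intro mult_left_mono) auto
    also have "\<dots> = (\<Sum>i<r. \<theta>\<^sup>2 * (1 - P i))"
      by (simp add: sum_subtractf flip: sum_distrib_left)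
    also have "\<dots> \<le> (\<Sum>i<r. (\<omega> i)\<^sup>2 * (1 - P i))"
      using \<theta> P1 by (intro sum_mono mult_right_mono power_mono) auto
    finally show ?thesis unfolding sum_append
      by (simp add: algebra_simps sum_subtractf sum.distrib)
  next
    case False
    then have "P i = 0" for i using \<kappa> by (simp add: P_def)
    then show ?thesis using False by simp
  qed
  finally show ?thesis by simp
qed

text \<open>\<open>P\<close> is the sum of b b^T over an orthonormal basis of \<open>X\<close>. It
  is given as a matrix so that it can act on the columns of other matrices.\<close>

lemma orthogonal_projection_exists:
  fixes X :: "(real^'n) set"
  assumes "subspace X"
  obtains P :: "real^'n^'n" where "transpose P = P" "\<And>x. P *v x \<in> X" "\<And>x. x \<in> X \<Longrightarrow> P *v x = x"
proof -
  obtain B where B: "B \<subseteq> X" "pairwise Linear_Algebra.orthogonal B" "\<And>x. x \<in> B \<Longrightarrow> norm x = 1"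
    "independent B" "card B = dim X" "span B = X"
    using orthonormal_basis_subspace[OF assms] by blast
  have fin: "finite B" using B(4) by (rule independent_imp_finite)
  define P where "P = (\<Sum>b\<in>B. outer b b)"
  have Px: "P *v x = (\<Sum>b\<in>B. inner b x *\<^sub>R b)" for x
  proof -
    interpret mv: bounded_bilinear "\<lambda>(A::real^'n^'n) x. A *v x"
      by (rule bounded_bilinear_matrix_vector_mult)
    show ?thesis by (simp add: P_def mv.sum_left outer_mult_vec)
  qed
  show ?thesis
  proof
    show "transpose P = P"
      by (simp add: P_def bounded_linear.linear[OF bounded_linear_transpose] linear_sum transpose_outer)
    show PX: "P *v x \<in> X" for x
      unfolding Px using B(1) assms by (intro subspace_sum subspace_mul) auto
    fix x assume "x \<in> X"
    then show "P *v x = x"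
      using orthonormal_basis_expand[OF B(2,3) _ fin] B(6) by (simp add: Px inner_commute[of _ x])
  qed
qed

section \<open>Scalar inequalities\<close>

lemma nonneg_quadratic_discriminant:
  fixes a b c :: real
  assumes "a \<ge> 0" "\<And>t. c + 2 * t * b + t\<^sup>2 * a \<ge> 0"
  shows "b\<^sup>2 \<le> a * c"
proof (cases "a = 0")
  case True
  have "b = 0"
  proof (rule ccontr)
    assume "b \<noteq> 0"
    \<comment> \<open>At this \<open>t\<close> the affine function \<open>c + 2 * t * b\<close>
      equals -1.\<close>
    then have "2 * (- (c + 1) / (2 * b)) * b = - (c + 1)" by simp
    then show False using assms(2)[of "- (c + 1) / (2 * b)"] True by (simp only: mult_zero_right)
  qed
  then show ?thesis using True by simp
next
  case False
  then have "a > 0" using assms(1) by simp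
  then show ?thesis using assms(2)[of "- b / a"] by (simp add: field_simps power2_eq_square)
qed

text \<open>The content is that a \<open>2 \<times> 2\<close> symmetric matrix with first column \<open>(\<alpha>, \<beta>)\<close> and eigenvalues in
  \<open>[1 - \<delta>, 1 + \<delta>]\<close> has \<open>\<beta>\<^sup>2 \<le> (\<alpha> - (1 - \<delta>)) (1 + \<delta> - \<alpha>)\<close>; here \<open>e\<close> and \<open>z\<close> are the squared lengths
  of the two basis vectors and \<open>\<beta>\<^sup>2 = z / e\<close>.\<close>

lemma two_dimensional_rip:
  fixes \<alpha> \<delta> e z h :: real
  assumes "e > 0" "z \<ge> 0" "1 - \<delta> \<le> \<alpha>" "\<alpha> \<le> 1 + \<delta>"
    and "(1 - \<delta>) * z \<le> h" "h \<le> (1 + \<delta>) * z"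
    and lo: "\<And>t. (1 - \<delta>) * (e + t\<^sup>2 * z) \<le> \<alpha> * e + 2 * t * z + t\<^sup>2 * h"
    and hi: "\<And>t. \<alpha> * e + 2 * t * z + t\<^sup>2 * h \<le> (1 + \<delta>) * (e + t\<^sup>2 * z)"
  shows "z \<le> (\<alpha> - 1 + \<delta>) * (1 + \<delta> - \<alpha>) * e"
proof -
  have 1: "z\<^sup>2 \<le> (h - (1 - \<delta>) * z) * ((\<alpha> - 1 + \<delta>) * e)"
    using assms(5) lo by (intro nonneg_quadratic_discriminant) (auto simp: algebra_simps)
  have 2: "(- z)\<^sup>2 \<le> ((1 + \<delta>) * z - h) * ((1 + \<delta> - \<alpha>) * e)"
    using assms(6) hi by (intro nonneg_quadratic_discriminant) (auto simp: algebra_simps)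
  \<comment> \<open>With these weights the unknown \<open>h\<close> cancels from the sum of the two
    discriminant inequalities.\<close>
  have "(1 + \<delta> - \<alpha>) * z\<^sup>2 + (\<alpha> - 1 + \<delta>) * z\<^sup>2
      \<le> (1 + \<delta> - \<alpha>) * ((h - (1 - \<delta>) * z) * ((\<alpha> - 1 + \<delta>) * e))
       + (\<alpha> - 1 + \<delta>) * (((1 + \<delta>) * z - h) * ((1 + \<delta> - \<alpha>) * e))"
    using 1 2 assms(3,4) by (intro add_mono mult_left_mono) auto
  then have "2 * \<delta> * z * z \<le> 2 * \<delta> * z * ((\<alpha> - 1 + \<delta>) * (1 + \<delta> - \<alpha>) * e)"
    by (simp add: algebra_simps power2_eq_square)
  moreover have nn: "(\<alpha> - 1 + \<delta>) * (1 + \<delta> - \<alpha>) * e \<ge> 0" using assms(1,3,4) by simp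
  moreover have "\<delta> \<ge> 0" using assms(3,4) by simp
  \<comment> \<open>The factor \<open>\<delta> * z\<close> can be cancelled unless it is zero; for
    \<delta> = 0 the bounds force \<alpha> = 1, and the first discriminant inequality gives
    \<open>z = 0\<close>.\<close>
  ultimately consider "z \<le> (\<alpha> - 1 + \<delta>) * (1 + \<delta> - \<alpha>) * e" | "\<delta> * z = 0"
    using assms(2) by (cases "\<delta> * z = 0") (auto simp: mult_le_cancel_left mult_less_0_iff)
  then show ?thesis
  proof cases
    case 2
    then consider "\<delta> = 0" | "z = 0" by auto
    then show ?thesis
    proof cases
      case 1
      then have "\<alpha> = 1" using assms(3,4) by simp
      then show ?thesis using \<open>z\<^sup>2 \<le> (h - (1 - \<delta>) * z) * ((\<alpha> - 1 + \<delta>) * e)\<close> 1 by simp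
    qed (use nn in simp)
  qed
qed

text \<open>The difference of the two sides is a quadratic in \<open>t\<close> with positive leading
  coefficient that is not positive at 1, so it has a zero at or beyond 1.\<close>

lemma scaling_exists:
  fixes p \<alpha> q0 q2 :: real
  assumes "\<alpha> > 0" "q2 > 0" "\<alpha> * (q0 + q2) \<le> p"
  obtains t where "t \<ge> 1" "t * p = \<alpha> * (q0 + t\<^sup>2 * q2)"
proof -
  define g where "g t = \<alpha> * (q0 + t\<^sup>2 * q2) - t * p" for t
  \<comment> \<open>Large enough that \<open>\<alpha> * q2 * T\<close> exceeds
    \<open>\<bar>p\<bar> + \<alpha> * \<bar>q0\<bar>\<close>, which makes \<open>g T\<close>
    nonnegative.\<close>
  define T where "T = 1 + (\<bar>p\<bar> + \<alpha> * \<bar>q0\<bar>) / (\<alpha> * q2)"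
  have T: "T \<ge> 1" using assms by (simp add: T_def)
  have aq: "\<alpha> * q2 > 0" using assms by simp
  have "\<alpha> * q2 * T = \<alpha> * q2 + \<alpha> * q2 * ((\<bar>p\<bar> + \<alpha> * \<bar>q0\<bar>) / (\<alpha> * q2))"
    unfolding T_def by (simp only: distrib_left mult_1_right)
  also have "\<alpha> * q2 * ((\<bar>p\<bar> + \<alpha> * \<bar>q0\<bar>) / (\<alpha> * q2)) = \<bar>p\<bar> + \<alpha> * \<bar>q0\<bar>"
    by (rule trans[OF times_divide_eq_right nonzero_mult_div_cancel_left]) (use aq in linarith)
  finally have "\<alpha> * q2 * T = \<alpha> * q2 + (\<bar>p\<bar> + \<alpha> * \<bar>q0\<bar>)" .
  then have "T * (\<alpha> * q2 * T) \<ge> T * (\<bar>p\<bar> + \<alpha> * \<bar>q0\<bar>)" using T aq by (intro mult_left_mono) auto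
  moreover have "T * p \<le> T * \<bar>p\<bar>" using T by (intro mult_left_mono) auto
  moreover have "\<alpha> * q0 \<ge> - (T * (\<alpha> * \<bar>q0\<bar>))"
  proof -
    have "1 * (\<alpha> * \<bar>q0\<bar>) \<le> T * (\<alpha> * \<bar>q0\<bar>)" using T assms(1) by (intro mult_right_mono) auto
    moreover have "\<alpha> * (- \<bar>q0\<bar>) \<le> \<alpha> * q0" using assms(1) by (intro mult_left_mono) auto
    ultimately show ?thesis by simp
  qed
  ultimately have "g T \<ge> 0" by (simp add: g_def algebra_simps power2_eq_square)
  moreover have "g 1 \<le> 0" using assms(3) by (simp add: g_def)
  moreover have "continuous_on {1..T} g" unfolding g_def by (intro continuous_intros)
  ultimately obtain t where "1 \<le> t" "g t = 0" using IVT'[of g 1 0 T] T by auto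
  then show ?thesis using that by (simp add: g_def)
qed

section \<open>Second-order critical points\<close>

text \<open>These are the two terms of the derivative of A^T A in direction A D, paired with
  \<open>D\<close>.\<close>

lemma inner_gram:
  fixes A :: "real^'r^'n" and D :: "real^'r^'r"
  assumes "transpose D = D"
  shows "inner D (transpose A ** (A ** D)) = inner (A ** D) (A ** D)"
    and "inner D (transpose (A ** D) ** A) = inner (A ** D) (A ** D)"
proof -
  show 1: "inner D (transpose A ** (A ** D)) = inner (A ** D) (A ** D)"
    by (rule inner_matrix_mult_left[symmetric])
  have "inner D (transpose (A ** D) ** A) = inner (transpose D) (transpose (transpose (A ** D) ** A))"
    by (rule inner_transpose[symmetric])
  also have "transpose (transpose (A ** D) ** A) = transpose A ** (A ** D)"
    by (simp only: matrix_transpose_mul[of "transpose (A ** D)"] Finite_Cartesian_Product.transpose_transpose)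
  finally show "inner D (transpose (A ** D) ** A) = inner (A ** D) (A ** D)"
    using 1 assms by simp
qed

context
  fixes f :: "real^'m^'n \<Rightarrow> real" and H and \<mu> :: real
    and W :: "('n::finite, 'm::finite, 'r::finite) factors" and U V G
  assumes f: "C2_function f H" and crit: "second_order_critical (regularized \<mu> f) W" and \<mu>: "\<mu> \<ge> 0"
  defines "U \<equiv> fst W" and "V \<equiv> snd W" and "G \<equiv> grad f (U ** transpose V)"
begin

interpretation C2_function f H by (rule f)

text \<open>For \<open>D = gap W\<close> the direction (U D, - V D) leaves the product unchanged to
  first order, so the first-order condition sees the penalty alone and forces U D = V D = 0. Then
  <D, D> = <U, U D> - <V, V D> = 0.\<close>

lemma critical_point_balanced: "\<mu> = 0 \<or> gap W = 0"
proof (cases "\<mu> = 0")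
  case False
  let ?D = "gap W"
  have sym: "transpose ?D = ?D"
    by (simp add: gap_def transpose_linear_simps matrix_transpose_mul)
  let ?w = "(U ** ?D, - (V ** ?D))"
  interpret mm: bounded_bilinear "\<lambda>(A::real^'r^'n) (B::real^'m^'r). A ** B"
    by (rule bounded_bilinear_matrix_mult)
  interpret mm2: bounded_bilinear "\<lambda>(A::real^'m^'r) (B::real^'r^'m). A ** B"
    by (rule bounded_bilinear_matrix_mult)
  have p0: "prod_polar W ?w = 0"
    by (simp add: prod_polar_def transpose_linear_simps mm.minus_right matrix_transpose_mul sym matrix_mul_assoc U_def V_def)
  have "inner ?D (gap_polar W ?w) = 2 * (inner (U ** ?D) (U ** ?D) + inner (V ** ?D) (V ** ?D))"
    by (simp add: gap_polar_def transpose_linear_simps mm2.minus_right mm2.minus_left inner_diff_right inner_add_right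
        inner_gram[OF sym] flip: U_def V_def)
  moreover have "inner (grad f (fst W ** transpose (snd W))) (prod_polar W ?w) + \<mu> / 2 * inner ?D (gap_polar W ?w) = 0"
    using crit unfolding second_order_critical_def first_order_critical_regularized[OF f] by blast
  then have "inner ?D (gap_polar W ?w) = 0" using False p0 by simp
  ultimately have "inner (U ** ?D) (U ** ?D) + inner (V ** ?D) (V ** ?D) = 0" by simp
  then have UV: "U ** ?D = 0" "V ** ?D = 0"
    by (simp_all add: add_nonneg_eq_0_iff)
  have "inner ?D ?D = inner (transpose U ** U) ?D - inner (transpose V ** V) ?D"
    by (subst (1) gap_def) (simp add: inner_diff_left U_def V_def)
  also have "\<dots> = 0" by (simp add: inner_matrix_mult_left UV)
  finally show ?thesis by simp
qed simp

text \<open>As the gap or its weight is zero, the penalty drops out of the first-order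
  condition.\<close>

lemma critical_point_gradient: "inner G (prod_polar W w) = 0"
proof -
  have "inner G (prod_polar W w) + \<mu> / 2 * inner (gap W) (gap_polar W w) = 0"
    using crit unfolding second_order_critical_def first_order_critical_regularized[OF f] G_def U_def V_def
    by blast
  then show ?thesis using critical_point_balanced by auto
qed

lemma critical_point_hessian:
  "0 \<le> hessian f (U ** transpose V) (prod_polar W w) (prod_polar W w)
     + inner G (prod_polar w w) + \<mu> / 2 * (norm (gap_polar W w))\<^sup>2"
proof -
  have "0 \<le> hessian (regularized \<mu> f) W w w" using crit unfolding second_order_critical_def by blast
  then show ?thesis using critical_point_balanced
    unfolding hessian_regularized[OF f] G_def U_def V_def by auto
qed

lemma inner_gradient_row: "inner G (outer u (V *v a)) = 0"
  using critical_point_gradient[of "(outer u a, 0)"]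
  by (simp add: prod_polar_def outer_mult V_def transpose_linear_simps
      bounded_bilinear.zero_right[OF bounded_bilinear_matrix_mult] del: transpose_matrix_vector)

lemma inner_gradient_column: "inner G (outer (U *v a) v) = 0"
  using critical_point_gradient[of "(0, outer v a)"]
  by (simp add: prod_polar_def transpose_outer mult_outer U_def
      bounded_bilinear.zero_left[OF bounded_bilinear_matrix_mult])

lemma inner_gradient_point: "inner G (U ** transpose V) = 0"
  using critical_point_gradient[of W] by (simp add: prod_polar_self U_def V_def)

context
  fixes \<delta> u v
  assumes rip: "RIP \<delta> (2 * CARD('r)) (2 * CARD('r)) f" and \<delta>: "0 \<le> \<delta>"
    and uv: "norm u = 1" "norm v = 1" "transpose U *v u = 0" "transpose V *v v = 0"
begin

text \<open>The direction is (u a^T, v b^T) with \<open>u\<close>, \<open>v\<close> normal to the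
  ranges of \<open>U\<close>, \<open>V\<close>. It keeps the gap to first order and changes the
  product by the sum \<open>?K\<close> of two orthogonal matrices of rank at most one, so the RIP
  bounds the curvature, while the second variation is a multiple of u v^T.\<close>

lemma normal_direction_bound:
  "- 2 * inner a b * inner G (outer u v) \<le> (1 + \<delta>) * ((norm (V *v a))\<^sup>2 + (norm (U *v b))\<^sup>2)"
proof -
  let ?w = "(outer u a, outer v b)"
  let ?K = "outer u (V *v a) + outer (U *v b) v"
  have K: "prod_polar W ?w = ?K"
    by (simp add: prod_polar_def outer_mult mult_outer transpose_outer U_def V_def
        del: transpose_matrix_vector)
  have K2: "prod_polar ?w ?w = (2 * inner a b) *\<^sub>R outer u v"
    by (simp add: prod_polar_self transpose_outer mult_outer outer_mult_vec outer.scaleR_left inner_commute)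
  have gap0: "gap_polar W ?w = 0"
    using uv(3,4) by (simp add: gap_polar_def transpose_outer mult_outer outer_mult outer.zero_left
        outer.zero_right U_def[symmetric] V_def[symmetric] del: transpose_matrix_vector)
  have "?K *v w \<in> span {u, U *v b}" for w
    unfolding matrix_vector_mult_add_rdistrib outer_mult_vec
    by (intro span_add span_mul span_base) auto
  then have "rank ?K \<le> dim (span {u, U *v b})" by (rule rank_le_dim)
  also have "\<dots> \<le> card {u, U *v b}" by (simp add: dim_span dim_le_card')
  also have "\<dots> \<le> 2" by (simp add: card_insert_if)
  also have "2 \<le> 2 * CARD('r)" by simp
  finally have rK: "rank ?K \<le> 2 * CARD('r)" .
  have "rank (U ** transpose V) \<le> CARD('r)"
    using order_trans[OF rank_mul_le_left rank_bound, of U "transpose V"] by simp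
  then have "hessian f (U ** transpose V) ?K ?K \<le> (1 + \<delta>) * (norm ?K)\<^sup>2"
    using rip rK unfolding RIP_def by simp
  moreover have "inner u (U *v b) = 0" "inner v (V *v a) = 0"
    using uv(3,4) by (metis inner_transpose_mult_vec inner_zero_left)+
  then have "(norm ?K)\<^sup>2 = (norm (V *v a))\<^sup>2 + (norm (U *v b))\<^sup>2"
    using uv(1,2) by (simp add: power2_norm_eq_inner inner_add_left inner_add_right inner_outer_outer
        norm_eq_1 inner_commute)
  moreover have "0 \<le> hessian f (U ** transpose V) ?K ?K + 2 * inner a b * inner G (outer u v)"
    using critical_point_hessian[of ?w] unfolding K K2 gap0 by simp
  ultimately show ?thesis by simp
qed

text \<open>Scaling a kernel vector of one factor leaves the right side of the preceding bound fixed
  while the left side grows linearly.\<close>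

lemma injective_factors:
  assumes neg: "inner G (outer u v) < 0"
  shows "inj ((*v) U)" "inj ((*v) V)"
proof -
  have large: False if "\<And>t. t * c \<le> d" "c > 0" for c d :: real
    using that(1)[of "(d + 1) / c"] that(2) by simp
  have kernel: "b = 0" if "U *v b = 0" for b
  proof (rule ccontr)
    assume b: "b \<noteq> 0"
    have "t * (- 2 * inner b b * inner G (outer u v)) \<le> (1 + \<delta>) * (norm (V *v b))\<^sup>2" for t
      using normal_direction_bound[of b "t *\<^sub>R b"] that by (simp add: matrix_vector_mult_scaleR mult_ac)
    moreover have "- 2 * inner b b * inner G (outer u v) > 0" using b neg by (simp add: mult_less_0_iff)
    ultimately show False by (rule large)
  qed
  have kernel': "b = 0" if "V *v b = 0" for b
  proof (rule ccontr)
    assume b: "b \<noteq> 0"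
    have "t * (- 2 * inner b b * inner G (outer u v)) \<le> (1 + \<delta>) * (norm (U *v b))\<^sup>2" for t
      using normal_direction_bound[of "t *\<^sub>R b" b] that by (simp add: matrix_vector_mult_scaleR mult_ac)
    moreover have "- 2 * inner b b * inner G (outer u v) > 0" using b neg by (simp add: mult_less_0_iff)
    ultimately show False by (rule large)
  qed
  show "inj ((*v) U)" "inj ((*v) V)"
    using kernel kernel' by (simp_all add: linear_injective_0)
qed

text \<open>For a = U^T x_i and b = V^T y_i one has U b = \<sigma>_i x_i, V a = \<sigma>_i y_i and
  <a, b> = \<sigma>_i, and one factor \<sigma>_i cancels.\<close>

lemma singular_value_bound:
  assumes "svd k \<sigma> x y (U ** transpose V)" "i < k"
  shows "- inner G (outer u v) \<le> (1 + \<delta>) * \<sigma> i"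
proof -
  have \<sigma>: "\<sigma> i > 0" using assms by (simp add: svd_def)
  define a where "a = transpose U *v x i"
  define b where "b = transpose V *v y i"
  have Ub: "U *v b = \<sigma> i *\<^sub>R x i"
    using svd_right[OF assms] unfolding b_def by (simp only: matrix_vector_mul_assoc)
  have Va: "V *v a = \<sigma> i *\<^sub>R y i"
    using svd_left[OF assms] unfolding a_def by (simp only: matrix_vector_mul_assoc matrix_transpose_mul Finite_Cartesian_Product.transpose_transpose)
  have nx: "inner (x i) (x i) = 1" "inner (y i) (y i) = 1" using assms by (simp_all add: svd_def orthonormal_on_def)
  have n1: "norm (x i) = 1" "norm (y i) = 1" using nx by (simp_all add: norm_eq_1)
  have "inner a b = inner (x i) (U *v b)" unfolding a_def by (rule inner_transpose_mult_vec)
  then have "inner a b = \<sigma> i" using nx by (simp add: Ub)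
  then have "\<sigma> i * (- 2 * inner G (outer u v)) \<le> \<sigma> i * (2 * ((1 + \<delta>) * \<sigma> i))"
    using normal_direction_bound[of a b] n1 \<sigma> by (simp add: Ub Va algebra_simps power2_eq_square)
  then have "- 2 * inner G (outer u v) \<le> 2 * ((1 + \<delta>) * \<sigma> i)"
    using \<sigma> by (rule mult_left_le_imp_le)
  then show ?thesis by linarith
qed

end

end

text \<open>A left inverse of \<open>U\<close> recovers V^T from the product, so the product has at
  least the rank of \<open>V\<close>.\<close>

lemma rank_product_injective:
  fixes U :: "real^'r^'n" and V :: "real^'r^'m"
  assumes "inj ((*v) U)" "inj ((*v) V)"
  shows "rank (U ** transpose V) = CARD('r)"
proof (rule antisym)
  show "rank (U ** transpose V) \<le> CARD('r)"
    using order_trans[OF rank_mul_le_left rank_bound, of U "transpose V"] by simp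
  obtain U' where "U' ** U = Finite_Cartesian_Product.mat 1" using assms(1) matrix_left_invertible_injective by blast
  then have "transpose V = U' ** (U ** transpose V)" by (simp add: matrix_mul_assoc)
  then have "rank (transpose V) \<le> rank (U ** transpose V)" by (metis rank_mul_le_right)
  then show "CARD('r) \<le> rank (U ** transpose V)"
    using assms(2) full_rank_injective[of V] by (simp add: rank_transpose)
qed

section \<open>Necessity\<close>

text \<open>This is <diag w, a b^T>, and \<open>gram_sq\<close> is |a b^T|^2, for matrices given by
  their entries.\<close>

definition pairing :: "nat \<Rightarrow> nat \<Rightarrow> (nat \<Rightarrow> real) \<Rightarrow> (nat \<Rightarrow> nat \<Rightarrow> real) \<Rightarrow> (nat \<Rightarrow> nat \<Rightarrow> real) \<Rightarrow> real" where
  "pairing r s w a b = (\<Sum>i<s. w i * (\<Sum>k<r. a i k * b i k))"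

definition gram_sq :: "nat \<Rightarrow> nat \<Rightarrow> nat \<Rightarrow> (nat \<Rightarrow> nat \<Rightarrow> real) \<Rightarrow> (nat \<Rightarrow> nat \<Rightarrow> real) \<Rightarrow> real" where
  "gram_sq r s t a b = (\<Sum>i<s. \<Sum>j<t. (\<Sum>k<r. a i k * b j k)\<^sup>2)"

text \<open>System (C) with matrices replaced by functions of their indices. The comparison of
  maximum and minimum is entrywise, which covers \<open>s = 0\<close>.\<close>

definition scalar_system ::
  "nat \<Rightarrow> nat \<Rightarrow> real \<Rightarrow> real \<Rightarrow> (nat \<Rightarrow> real) \<Rightarrow> (nat \<Rightarrow> real) \<Rightarrow> (nat \<Rightarrow> nat \<Rightarrow> real) \<Rightarrow>
   (nat \<Rightarrow> nat \<Rightarrow> real) \<Rightarrow> (nat \<Rightarrow> nat \<Rightarrow> real) \<Rightarrow> (nat \<Rightarrow> nat \<Rightarrow> real) \<Rightarrow> bool" where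
  "scalar_system r s \<delta> \<alpha> \<sigma> \<tau> a b c d \<longleftrightarrow>
     1 - \<delta> < \<alpha> \<and> \<alpha> \<le> (1 + \<delta>) / 2 \<and>
     (\<forall>i<r. \<forall>j<s. \<tau> j \<le> (1 + \<delta>) * \<sigma> i) \<and> (\<forall>i<r. \<sigma> i > 0) \<and> (\<forall>j<s. \<tau> j \<ge> 0) \<and>
     pairing r s \<tau> c d = \<alpha> * ((\<Sum>i<r. (\<sigma> i)\<^sup>2) - 2 * pairing r r \<sigma> a b + gram_sq r r r a b
       + gram_sq r r s a d + gram_sq r s r c b + gram_sq r s s c d) \<and>
     (\<Sum>j<s. (\<tau> j)\<^sup>2) \<le> inverse \<alpha> * (2 * \<alpha> - 1 + \<delta>\<^sup>2) * pairing r s \<tau> c d \<and>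
     pairing r s \<tau> c d \<noteq> 0"

lemma gram_sq_nonneg: "gram_sq r s t a b \<ge> 0"
  by (simp add: gram_sq_def sum_nonneg)

text \<open>Supplies a positive leading coefficient for rescaling \<open>d\<close>: if this block
  vanished, so would the diagonal of c d^T and the pairing.\<close>

lemma gram_sq_pos:
  assumes "pairing r s w c d \<noteq> 0"
  shows "gram_sq r s s c d > 0"
proof (rule ccontr)
  assume "\<not> gram_sq r s s c d > 0"
  then have "gram_sq r s s c d = 0" using gram_sq_nonneg[of r s s c d] by simp
  then have "(\<Sum>k<r. c j k * d j k) = 0" if "j < s" for j
    using that by (simp add: gram_sq_def sum_nonneg_eq_0_iff sum_nonneg)
  then show False using assms by (simp add: pairing_def)
qed

lemma gram_sq_scale: "gram_sq r s t a (\<lambda>j k. x * b j k) = x\<^sup>2 * gram_sq r s t a b"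
proof -
  have "(\<Sum>k<r. a i k * (x * b j k)) = x * (\<Sum>k<r. a i k * b j k)" for i j
    by (simp add: sum_distrib_left mult_ac)
  then show ?thesis by (simp only: gram_sq_def power_mult_distrib sum_distrib_left[symmetric])
qed

lemma pairing_scale: "pairing r s w a (\<lambda>j k. x * b j k) = x * pairing r s w a b"
  by (simp add: pairing_def sum_distrib_left mult_ac)

text \<open>Enlarging \<open>d\<close> by a factor turns the inequality into the equality required by the system.\<close>

lemma scalar_system_from_inequality:
  assumes "1 - \<delta> < \<alpha>" "\<alpha> \<le> (1 + \<delta>) / 2" "\<delta> < 1" "0 \<le> \<delta>"
    and "\<forall>i<r. \<forall>j<s. \<tau> j \<le> (1 + \<delta>) * \<sigma> i" "\<forall>i<r. \<sigma> i > 0" "\<forall>j<s. \<tau> j \<ge> 0"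
    and le: "\<alpha> * ((\<Sum>i<r. (\<sigma> i)\<^sup>2) - 2 * pairing r r \<sigma> a b + gram_sq r r r a b
       + gram_sq r r s a d + gram_sq r s r c b + gram_sq r s s c d) \<le> pairing r s \<tau> c d"
    and sq: "(\<Sum>j<s. (\<tau> j)\<^sup>2) \<le> inverse \<alpha> * (2 * \<alpha> - 1 + \<delta>\<^sup>2) * pairing r s \<tau> c d"
    and pos: "pairing r s \<tau> c d > 0"
  shows "\<exists>d. scalar_system r s \<delta> \<alpha> \<sigma> \<tau> a b c d"
proof -
  have \<alpha>: "\<alpha> > 0" using assms by simp
  let ?q0 = "(\<Sum>i<r. (\<sigma> i)\<^sup>2) - 2 * pairing r r \<sigma> a b + gram_sq r r r a b + gram_sq r s r c b"
  let ?q2 = "gram_sq r r s a d + gram_sq r s s c d"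
  have "?q2 > 0" using gram_sq_pos[of r s \<tau> c d] pos by (simp add: add_nonneg_pos gram_sq_nonneg)
  moreover have "\<alpha> * (?q0 + ?q2) \<le> pairing r s \<tau> c d" using le by (simp add: algebra_simps)
  ultimately obtain t where t: "t \<ge> 1" "t * pairing r s \<tau> c d = \<alpha> * (?q0 + t\<^sup>2 * ?q2)"
    using scaling_exists[OF \<alpha>] by blast
  \<comment> \<open>The right side of the bound on the squares is nonnegative, so the factor
    \<open>t \<ge> 1\<close> preserves that bound.\<close>
  have "(\<Sum>j<s. (\<tau> j)\<^sup>2) \<ge> 0" by (simp add: sum_nonneg)
  then have "1 * (inverse \<alpha> * (2 * \<alpha> - 1 + \<delta>\<^sup>2) * pairing r s \<tau> c d)
      \<le> t * (inverse \<alpha> * (2 * \<alpha> - 1 + \<delta>\<^sup>2) * pairing r s \<tau> c d)"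
    using t(1) sq by (intro mult_right_mono) auto
  then have "(\<Sum>j<s. (\<tau> j)\<^sup>2) \<le> inverse \<alpha> * (2 * \<alpha> - 1 + \<delta>\<^sup>2) * (t * pairing r s \<tau> c d)"
    using sq by (simp add: mult_ac)
  moreover have "t * pairing r s \<tau> c d = \<alpha> * ((\<Sum>i<r. (\<sigma> i)\<^sup>2) - 2 * pairing r r \<sigma> a b + gram_sq r r r a b
       + t\<^sup>2 * gram_sq r r s a d + gram_sq r s r c b + t\<^sup>2 * gram_sq r s s c d)"
    unfolding t(2) by (simp add: algebra_simps)
  moreover have "t * pairing r s \<tau> c d \<noteq> 0" using t(1) pos by simp
  ultimately have "scalar_system r s \<delta> \<alpha> \<sigma> \<tau> a b c (\<lambda>j k. t * d j k)"
    using assms(1-7) unfolding scalar_system_def gram_sq_scale pairing_scale by simp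
  then show ?thesis by blast
qed

section \<open>Ranks of sums, and values below a spurious point\<close>

lemma dim_sums_le:
  fixes S T :: "'a::euclidean_space set"
  assumes "subspace S" "subspace T"
  shows "dim {x + y |x y. x \<in> S \<and> y \<in> T} \<le> dim S + dim T"
  using dim_sums_Int[OF assms] by simp

lemma rank_add_le: "rank (A + B) \<le> rank A + rank B" for A B :: "real^'m^'n"
proof -
  have "rank (A + B) \<le> dim {x + y |x y. x \<in> range ((*v) A) \<and> y \<in> range ((*v) B)}"
    by (rule rank_le_dim) (auto simp: matrix_vector_mult_add_rdistrib)
  also have "\<dots> \<le> rank A + rank B"
    unfolding rank_dim_range by (intro dim_sums_le linear_subspace_image) auto
  finally show ?thesis .
qed

lemma rank_scale_le: "rank (c *\<^sub>R A) \<le> rank A" for A :: "real^'m^'n"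
  unfolding rank_dim_range[of A]
  by (rule rank_le_dim) (metis matrix_vector_mult_scaleR rangeI scaleR_matrix_vector_assoc)

lemma rank_product_le: "rank (U ** transpose V) \<le> CARD('r)"
  for U :: "real^'r^'n" and V :: "real^'r^'m"
  using order_trans[OF rank_mul_le_left rank_bound, of U "transpose V"] by simp

text \<open>The expansion of |X - diag \<sigma>|^2; it produces the first three terms in the bracket
  of the system.\<close>

lemma sum_square_diagonal_shift:
  fixes g :: "nat \<Rightarrow> nat \<Rightarrow> real"
  shows "(\<Sum>i<r. \<Sum>j<r. (g i j - (if i = j then \<sigma> i else 0))\<^sup>2)
    = (\<Sum>i<r. (\<sigma> i)\<^sup>2) - 2 * (\<Sum>i<r. \<sigma> i * g i i) + (\<Sum>i<r. \<Sum>j<r. (g i j)\<^sup>2)"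
proof -
  have "(\<Sum>j<r. (g i j - (if i = j then \<sigma> i else 0))\<^sup>2)
      = (\<sigma> i)\<^sup>2 - 2 * (\<sigma> i * g i i) + (\<Sum>j<r. (g i j)\<^sup>2)" if "i < r" for i
  proof -
    have "(g i j - (if i = j then \<sigma> i else 0))\<^sup>2
        = (g i j)\<^sup>2 + (if j = i then (\<sigma> i)\<^sup>2 - 2 * (\<sigma> i * g i i) else 0)" for j
      by (simp add: power2_diff)
    then show ?thesis using that by (simp add: sum.distrib)
  qed
  then show ?thesis by (simp add: sum.distrib sum_subtractf sum_distrib_left)
qed

text \<open>The penalty contributes nothing at \<open>W\<close> and is nonnegative elsewhere, so a
  smaller regularized value means a smaller value of \<open>f\<close>.\<close>

lemma spurious_below:
  fixes W :: "('n::finite, 'm::finite, 'r::finite) factors"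
  assumes "C2_function f H" "\<mu> \<ge> 0" "spurious_second_order_critical (regularized \<mu> f) W"
  obtains K where "rank K \<le> CARD('r)" "f K < f (fst W ** transpose (snd W))"
proof -
  have crit: "second_order_critical (regularized \<mu> f) W"
    and ex: "\<exists>y :: ('n, 'm, 'r) factors. regularized \<mu> f y < regularized \<mu> f W"
    using assms(3) unfolding spurious_second_order_critical_def not_all not_le by simp_all
  from ex obtain y :: "('n, 'm, 'r) factors" where "regularized \<mu> f y < regularized \<mu> f W" by (elim exE)
  moreover have "regularized \<mu> f W = f (fst W ** transpose (snd W))"
    using critical_point_balanced[OF assms(1) crit assms(2)] by (auto simp: regularized_eq)
  moreover have "f (fst y ** transpose (snd y)) \<le> regularized \<mu> f y"
    using assms(2) by (simp add: regularized_eq)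
  ultimately have "f (fst y ** transpose (snd y)) < f (fst W ** transpose (snd W))" by linarith
  then show ?thesis by (rule that[OF rank_product_le])
qed

section \<open>From a spurious point to the system\<close>

lemma spurious_imp_scalar_system:
  fixes f :: "real^'m^'n \<Rightarrow> real" and W :: "('n::finite, 'm::finite, 'r::finite) factors"
  assumes tcd: "twice_continuously_differentiable f"
    and N: "first_order_critical f N" "rank N \<le> CARD('r)"
    and rip: "RIP \<delta> (2 * CARD('r)) (2 * CARD('r)) f"
    and \<delta>: "0 \<le> \<delta>" "\<delta> < 1" and \<mu>: "\<mu> \<ge> 0"
    and spur: "spurious_second_order_critical (regularized \<mu> f) W"
    and s: "s = min (min CARD('m) CARD('n)) (2 * CARD('r)) - CARD('r)"
  shows "\<exists>\<alpha> \<sigma> \<tau> a b c d. scalar_system CARD('r) s \<delta> \<alpha> \<sigma> \<tau> a b c d"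
proof -
  obtain H where C2: "C2_function f H" using tcd twice_continuously_differentiable_iff by blast
  then interpret C2_function f H .
  let ?r = "CARD('r)"
  define U where "U = fst W"
  define V where "V = snd W"
  define M where "M = U ** transpose V"
  define G where "G = grad f M"
  have crit: "second_order_critical (regularized \<mu> f) W"
    using spur by (simp add: spurious_second_order_critical_def)
  note cp = C2 crit \<mu>
  have row: "inner G (outer u (V *v a)) = 0" for u a
    using inner_gradient_row[OF cp] by (simp add: G_def M_def U_def V_def)
  have col: "inner G (outer (U *v a) v) = 0" for v a
    using inner_gradient_column[OF cp] by (simp add: G_def M_def U_def V_def)
  have GM: "inner G M = 0"
    using inner_gradient_point[OF cp] by (simp add: G_def M_def U_def V_def)
  have rM: "rank M \<le> ?r" unfolding M_def by (rule rank_product_le)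
  \<comment> \<open>If \<open>M\<close> were critical for \<open>f\<close>, the RIP along the line
    through \<open>M\<close> and a better \<open>K\<close> would keep \<open>f\<close> from
    decreasing on the way to \<open>K\<close>.\<close>
  have G0: "G \<noteq> 0"
  proof
    assume "G = 0"
    obtain K where K: "rank K \<le> ?r" "f K < f M"
      using spurious_below[OF C2 \<mu> spur] unfolding M_def U_def V_def by blast
    have rk: "rank (M + t *\<^sub>R (K - M)) \<le> 2 * ?r" for t
    proof -
      have "M + t *\<^sub>R (K - M) = (1 - t) *\<^sub>R M + t *\<^sub>R K" by (simp add: algebra_simps)
      also have "rank \<dots> \<le> rank M + rank K"
        by (rule order_trans[OF rank_add_le add_mono[OF rank_scale_le rank_scale_le]])
      finally show ?thesis using K rM by simp
    qed
    have "rank (K - M) \<le> 2 * ?r"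
      using order_trans[OF rank_add_le add_mono[OF order_refl rank_scale_le], of K "-1" M] K rM by simp
    then have "hessian f (M + t *\<^sub>R (K - M)) (K - M) (K - M) \<ge> (1 - \<delta>) * (norm (K - M))\<^sup>2" for t
      using rip rk unfolding RIP_def by blast
    moreover have "(1 - \<delta>) * (norm (K - M))\<^sup>2 \<ge> 0" using \<delta> by simp
    ultimately have "f M \<le> f (M + (K - M))"
      using \<open>G = 0\<close> unfolding G_def by (intro critical_le) (auto intro: order_trans)
    then show False using K by simp
  qed

  \<comment> \<open>\<open>U\<close> and \<open>N\<close> contribute at most r dimensions each, so
    every matrix with columns in \<open>X\<close> has rank at most 2r; \<open>M\<close>,
    \<open>N\<close> and the line through them are of this kind.\<close>
  define X where "X = {x + y |x y. x \<in> range ((*v) U) \<and> y \<in> range ((*v) N)}"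
  have subX: "subspace X" unfolding X_def by (intro subspace_sums linear_subspace_image) auto
  have dimX: "dim X \<le> 2 * ?r"
  proof -
    have "dim X \<le> rank U + rank N"
      unfolding X_def rank_dim_range by (intro dim_sums_le linear_subspace_image) auto
    then show ?thesis using N(2) rank_bound[of U] by simp
  qed
  have UX: "U *v a \<in> X" for a
  proof -
    have "U *v a = U *v a + N *v 0" by simp
    then show ?thesis unfolding X_def by blast
  qed
  have NX: "N *v a \<in> X" for a
  proof -
    have "N *v a = U *v 0 + N *v a" by simp
    then show ?thesis unfolding X_def by blast
  qed
  have MX: "M *v a \<in> X" for a using UX by (simp only: M_def matrix_vector_mul_assoc[symmetric])
  have rX: "rank K \<le> 2 * ?r" if "\<And>w. K *v w \<in> X" for K :: "real^'m^'n"
    using rank_le_dim[OF that] dimX by simp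

  define E where "E = N - M"
  have EX: "E *v w \<in> X" for w
    using NX MX subX by (simp add: E_def matrix_vector_mult_diff_rdistrib subspace_diff)
  obtain A :: "(real^'m^'n) \<Rightarrow>\<^sub>L (real^'m^'n)" where
    A: "A E = grad f (M + E) - grad f M" "\<And>u k. inner (A u) k = inner (A k) u"
    and Alo: "\<And>k c. (\<And>t. hessian f (M + t *\<^sub>R E) k k \<ge> c) \<Longrightarrow> inner (A k) k \<ge> c"
    and Ahi: "\<And>k c. (\<And>t. hessian f (M + t *\<^sub>R E) k k \<le> c) \<Longrightarrow> inner (A k) k \<le> c"
    using averaged_hessian[of E M] by blast
  have AE: "A E = - G"
    using A(1) grad_eq[OF N(1)[unfolded first_order_critical_def]] by (simp add: E_def G_def)
  have line: "rank (M + t *\<^sub>R E) \<le> 2 * ?r" for t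
    using MX EX subX
    by (intro rX) (simp add: matrix_vector_mult_add_rdistrib subspace_add subspace_mul
        flip: scaleR_matrix_vector_assoc)
  have lo: "(1 - \<delta>) * (norm K)\<^sup>2 \<le> inner (A K) K" and hi: "inner (A K) K \<le> (1 + \<delta>) * (norm K)\<^sup>2"
    if "\<And>w. K *v w \<in> X" for K
    using rip line rX[OF that] unfolding RIP_def by (blast intro: Alo Ahi)+

  obtain P where P: "transpose P = P" "\<And>x. P *v x \<in> X" "\<And>x. x \<in> X \<Longrightarrow> P *v x = x"
    using orthogonal_projection_exists[OF subX] by blast
  \<comment> \<open>The rank of \<open>G\<close> itself is not controlled. Projecting its columns to
    \<open>X\<close> brings it within reach of the RIP and preserves, up to the sign, its pairings
    with matrices whose columns lie in \<open>X\<close>.\<close>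
  define Q where "Q = - (P ** G)"
  have QX: "Q *v w \<in> X" for w
  proof -
    have "Q *v w = - (P *v (G *v w))"
      using matrix_vector_mult_diff_rdistrib[of 0 "P ** G" w]
      by (simp add: Q_def matrix_vector_mul_assoc)
    then show ?thesis using P(2) subX by (simp add: subspace_neg)
  qed
  have innerQ: "inner Q K = - inner G K" if "\<And>w. K *v w \<in> X" for K
  proof -
    have "P ** K = K" using P(3) that by (simp add: matrix_eq flip: matrix_vector_mul_assoc)
    then show ?thesis by (simp add: Q_def inner_matrix_mult_left P(1))
  qed
  have innerQ_outer: "inner Q (outer u v) = - inner G (outer u v)" if "u \<in> X" for u v
    using that subX by (intro innerQ) (simp add: outer_mult_vec subspace_mul)
  have AQ: "inner (A E) K = inner Q K" if "\<And>w. K *v w \<in> X" for K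
    using innerQ[OF that] by (simp add: AE)

  define p where "p = inner Q N"
  define e where "e = (norm E)\<^sup>2"
  have QM: "inner Q M = 0" using innerQ[OF MX] GM by simp
  have QE: "inner Q E = p" using QM by (simp add: E_def p_def inner_diff_right)
  have "E \<noteq> 0"
  proof
    assume "E = 0"
    then have "A E = 0" by (simp add: blinfun.zero_right)
    then show False using AE G0 by simp
  qed
  then have e: "e > 0" by (simp add: e_def)
  \<comment> \<open>As <A E, E> = <Q, E> = p, this is the Rayleigh quotient of the averaged Hessian
    at \<open>E\<close>, which the RIP confines to [1 - \<delta>, 1 + \<delta>].\<close>
  define \<alpha> where "\<alpha> = p / e"
  have p\<alpha>: "p = \<alpha> * e" using e by (simp add: \<alpha>_def)
  have "(1 - \<delta>) * e \<le> \<alpha> * e" "\<alpha> * e \<le> (1 + \<delta>) * e"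
    using lo[OF EX] hi[OF EX] AQ[OF EX] by (simp_all add: QE e_def[symmetric] p\<alpha>[symmetric])
  then have \<alpha>: "1 - \<delta> \<le> \<alpha>" "\<alpha> \<le> 1 + \<delta>" using e by (simp_all add: mult_le_cancel_right)
  then have \<alpha>0: "\<alpha> > 0" and p0: "p > 0" using \<delta> e by (simp_all add: p\<alpha>)

  \<comment> \<open>The component of \<open>Q\<close> orthogonal to \<open>E\<close>. The entry of
    \<open>A\<close> between \<open>E\<close> and \<open>Z\<close> is <Q, Z>, which equals the
    squared norm of \<open>Z\<close>.\<close>
  define Z where "Z = Q - \<alpha> *\<^sub>R E"
  define z where "z = (norm Z)\<^sup>2"
  have ZX: "Z *v w \<in> X" for w
    using QX EX subX by (simp add: Z_def matrix_vector_mult_diff_rdistrib subspace_diff subspace_mul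
        flip: scaleR_matrix_vector_assoc)
  have EZ: "inner E Z = 0"
    by (simp add: Z_def inner_diff_right inner_commute[of E Q] QE p\<alpha> e_def power2_norm_eq_inner)
  have Qdec: "Q = Z + \<alpha> *\<^sub>R E" by (simp add: Z_def)
  have QZ: "inner Q Z = z"
    by (subst Qdec) (simp add: inner_add_left EZ z_def power2_norm_eq_inner)
  have Qsq: "(norm Q)\<^sup>2 = z + \<alpha>\<^sup>2 * e"
    using EZ unfolding power2_norm_eq_inner Qdec z_def e_def
    by (simp add: inner_add_left inner_add_right inner_commute[of Z E] power2_eq_square)
  have zle: "z \<le> (\<alpha> - 1 + \<delta>) * (1 + \<delta> - \<alpha>) * e"
  proof (rule two_dimensional_rip[OF e _ \<alpha>])
    show "z \<ge> 0" by (simp add: z_def)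
    show "(1 - \<delta>) * z \<le> inner (A Z) Z" "inner (A Z) Z \<le> (1 + \<delta>) * z"
      using lo[OF ZX] hi[OF ZX] by (simp_all add: z_def)
    fix t
    let ?K = "E + t *\<^sub>R Z"
    have KX: "?K *v w \<in> X" for w
      using EX ZX subX by (simp add: matrix_vector_mult_add_rdistrib subspace_add subspace_mul
          flip: scaleR_matrix_vector_assoc)
    have AEZ: "inner (A E) Z = z" "inner (A Z) E = z" "inner (A E) E = \<alpha> * e"
      using AQ[OF ZX] AQ[OF EX] QZ A(2)[of Z E] QE p\<alpha> by simp_all
    have 1: "inner (A ?K) ?K = \<alpha> * e + 2 * t * z + t\<^sup>2 * inner (A Z) Z"
      by (simp add: blinfun.add_right blinfun.scaleR_right inner_add_left inner_add_right AEZ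
          power2_eq_square algebra_simps)
    have 2: "(norm ?K)\<^sup>2 = e + t\<^sup>2 * z"
      unfolding power2_norm_eq_inner e_def z_def
      by (simp add: inner_add_left inner_add_right EZ inner_commute[of Z E] power2_eq_square)
    show "(1 - \<delta>) * (e + t\<^sup>2 * z) \<le> \<alpha> * e + 2 * t * z + t\<^sup>2 * inner (A Z) Z"
      and "\<alpha> * e + 2 * t * z + t\<^sup>2 * inner (A Z) Z \<le> (1 + \<delta>) * (e + t\<^sup>2 * z)"
      using lo[OF KX] hi[OF KX] unfolding 1 2 by simp_all
  qed
  \<comment> \<open>Uses (\<alpha> - 1 + \<delta>) (1 + \<delta> - \<alpha>) + \<alpha>^2 = 2
    \<alpha> - 1 + \<delta>^2.\<close>
  have Qle: "(norm Q)\<^sup>2 \<le> inverse \<alpha> * (2 * \<alpha> - 1 + \<delta>\<^sup>2) * p"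
  proof -
    have "(norm Q)\<^sup>2 \<le> (2 * \<alpha> - 1 + \<delta>\<^sup>2) * e"
      using zle unfolding Qsq by (simp add: algebra_simps power2_eq_square)
    also have "e = inverse \<alpha> * p" using \<alpha>0 by (simp add: p\<alpha>)
    finally show ?thesis by (simp add: mult_ac)
  qed

  define k where "k = rank Q"
  obtain \<tau> u v where sQ: "svd k \<tau> u v Q" unfolding k_def using svd_exists by blast
  have "Q \<noteq> 0" using p0 by (auto simp: p_def)
  then have k0: "k > 0" unfolding k_def using rank_eq_0 by blast
  have \<tau>0: "\<tau> j > 0" and nuv: "norm (u j) = 1" "norm (v j) = 1" if "j < k" for j
    using sQ that by (simp_all add: svd_def orthonormal_on_def norm_eq_1)
  have uX: "u j \<in> X" if "j < k" for j
  proof -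
    have "u j = (1 / \<tau> j) *\<^sub>R (Q *v v j)" using svd_right[OF sQ that] \<tau>0[OF that] by simp
    then show ?thesis using QX subX by (simp add: subspace_mul)
  qed
  \<comment> \<open>The first-order condition annihilates all matrices U a v^T; dividing by the
    singular value leaves orthogonality of \<open>u j\<close> to the range of
    \<open>U\<close>.\<close>
  have Uu: "transpose U *v u j = 0" if "j < k" for j
  proof (rule vector_eq_ldot[THEN iffD1], intro allI)
    fix a
    have "\<tau> j * inner (U *v a) (u j) = inner Q (outer (U *v a) (v j))"
      by (simp add: inner_outer_right svd_right[OF sQ that])
    also have "\<dots> = 0" using innerQ_outer[OF UX] col by simp
    finally show "inner a (transpose U *v u j) = inner a 0"
      using \<tau>0[OF that] inner_transpose_mult_vec[of U "u j" a] by (simp add: inner_commute)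
  qed
  have Vv: "transpose V *v v j = 0" if "j < k" for j
  proof (rule vector_eq_ldot[THEN iffD1], intro allI)
    fix a
    have "\<tau> j * inner (V *v a) (v j) = inner Q (outer (u j) (V *v a))"
      unfolding inner_outer_right' svd_left[OF sQ that] by simp
    also have "\<dots> = 0" using innerQ_outer[OF uX[OF that]] row by simp
    finally show "inner a (transpose V *v v j) = inner a 0"
      using \<tau>0[OF that] inner_transpose_mult_vec[of V "v j" a] by (simp add: inner_commute)
  qed
  have Guv: "inner G (outer (u j) (v j)) = - \<tau> j" if "j < k" for j
  proof -
    have "inner Q (outer (u j) (v j)) = \<tau> j"
      using nuv(1)[OF that] by (simp add: inner_outer_right svd_right[OF sQ that] norm_eq_1)
    then show ?thesis using innerQ_outer[OF uX[OF that], of "v j"] by simp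
  qed
  note normal = nuv Uu[unfolded U_def] Vv[unfolded V_def]
  \<comment> \<open>A singular pair of \<open>Q\<close> is normal to both factors and pairs
    negatively with the gradient, so both factors are injective.\<close>
  have "rank M = ?r"
    unfolding M_def U_def V_def
    using injective_factors[OF cp rip \<delta>(1) normal[OF k0]] Guv[OF k0] \<tau>0[OF k0]
    by (intro rank_product_injective) (simp_all add: G_def M_def U_def V_def)
  then obtain \<sigma> x y where sM: "svd ?r \<sigma> x y M" using svd_exists by metis
  have \<sigma>0: "\<sigma> i > 0" if "i < ?r" for i using sM that by (simp add: svd_def)
  have \<tau>\<sigma>: "\<tau> j \<le> (1 + \<delta>) * \<sigma> i" if "i < ?r" "j < k" for i j
    using singular_value_bound[OF cp rip \<delta>(1) normal[OF that(2)]
        sM[unfolded M_def U_def V_def] that(1)] Guv[OF that(2)]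
    by (simp add: G_def M_def U_def V_def)
  have xU: "x i \<in> range ((*v) U)" if "i < ?r" for i
  proof -
    have "x i = U *v (transpose V *v ((1 / \<sigma> i) *\<^sub>R y i))"
      unfolding matrix_vector_mul_assoc M_def[symmetric]
      using svd_right[OF sM that] \<sigma>0[OF that] by (simp add: matrix_vector_mult_scaleR)
    then show ?thesis by blast
  qed
  have yV: "y i \<in> range ((*v) V)" if "i < ?r" for i
  proof -
    have "transpose M = V ** transpose U"
      by (simp only: M_def matrix_transpose_mul Finite_Cartesian_Product.transpose_transpose)
    then have "V *v (transpose U *v ((1 / \<sigma> i) *\<^sub>R x i)) = (1 / \<sigma> i) *\<^sub>R (transpose M *v x i)"
      unfolding matrix_vector_mul_assoc by (simp only: matrix_vector_mult_scaleR)
    also have "\<dots> = y i" using svd_left[OF sM that] \<sigma>0[OF that] by simp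
    finally show ?thesis by (metis rangeI)
  qed
  have xu: "inner (x i) (u j) = 0" if "i < ?r" "j < k" for i j
    using xU[OF that(1)] Uu[OF that(2)] by (metis imageE inner_commute inner_transpose_mult_vec inner_zero_left)
  have yv: "inner (y i) (v j) = 0" if "i < ?r" "j < k" for i j
    using yV[OF that(1)] Vv[OF that(2)] by (metis imageE inner_commute inner_transpose_mult_vec inner_zero_left)
  have onx: "orthonormal_on {..<?r + k} (append_fun ?r x u)"
    and ony: "orthonormal_on {..<?r + k} (append_fun ?r y v)"
    using sM sQ xu yv by (auto simp: svd_def intro!: orthonormal_append)
  \<comment> \<open>The left vectors \<open>x\<close>, \<open>u\<close> are r + k orthonormal
    vectors in \<open>X\<close>, and there are as many orthonormal right vectors; hence r + k is at
    most 2r, n and m.\<close>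
  have ks: "k \<le> s"
  proof -
    have "append_fun ?r x u i \<in> X" if "i < ?r + k" for i
      using that uX rev_subsetD[OF xU image_subsetI[OF UX]] by (cases "i < ?r") (auto simp: append_fun_def)
    then have "?r + k \<le> dim X" using card_orthonormal_le_dim[OF _ onx, of X] by auto
    moreover have "?r + k \<le> CARD('n)" using card_orthonormal_le_dim[OF _ onx, of UNIV] by simp
    moreover have "?r + k \<le> CARD('m)" using card_orthonormal_le_dim[OF _ ony, of UNIV] by simp
    ultimately show ?thesis using dimX s by linarith
  qed

  \<comment> \<open>At equality \<open>Z\<close> vanishes, so N = M + Q / \<alpha>, and this has
    rank r + k > r.\<close>
  have \<alpha>_strict: "1 - \<delta> < \<alpha>"
  proof (rule ccontr)
    assume "\<not> 1 - \<delta> < \<alpha>"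
    then have "\<alpha> = 1 - \<delta>" using \<alpha> by simp
    then have "z \<le> 0" using zle by simp
    then have "Z = 0" by (simp add: z_def)
    then have "N = M + (1 / \<alpha>) *\<^sub>R Q" using \<alpha>0 by (simp add: Z_def E_def)
    moreover have "svd k (\<lambda>j. \<tau> j / \<alpha>) u v ((1 / \<alpha>) *\<^sub>R Q)"
      using sQ \<alpha>0 by (simp add: svd_def scaleR_sum_right)
    ultimately have "svd (?r + k) (append_fun ?r \<sigma> (\<lambda>j. \<tau> j / \<alpha>)) (append_fun ?r x u) (append_fun ?r y v) N"
      using svd_append[OF sM] xu yv by simp
    then have "rank N = ?r + k" by (rule rank_svd)
    then show False using N(2) k0 by simp
  qed

  \<comment> \<open>The singular values \<tau>_j / (1 + \<delta>) of the second summand do not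
    exceed any \<sigma>_i. Thus the first r values of the joined list are the largest, as
    Eckart--Young requires, and their squares sum to |M|^2; what remains is 2 p / (1 + \<delta>)
    \<le> e.\<close>
  have \<alpha>_half: "\<alpha> \<le> (1 + \<delta>) / 2"
  proof -
    let ?c = "1 + \<delta>"
    have c: "?c > 0" using \<delta> by simp
    have "svd k (\<lambda>j. \<tau> j / ?c) u v ((1 / ?c) *\<^sub>R Q)"
      using sQ c by (simp add: svd_def scaleR_sum_right)
    then have "svd (?r + k) (append_fun ?r \<sigma> (\<lambda>j. \<tau> j / ?c)) (append_fun ?r x u) (append_fun ?r y v)
        (M + (1 / ?c) *\<^sub>R Q)"
      using svd_append[OF sM] xu yv by simp
    from eckart_young[OF this _ N(2)]
    have "2 * inner N (M + (1 / ?c) *\<^sub>R Q) \<le> (norm N)\<^sup>2 + (\<Sum>i<?r. (\<sigma> i)\<^sup>2)"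
      using \<tau>\<sigma> c by (simp add: pos_divide_le_eq mult.commute)
    also have "(\<Sum>i<?r. (\<sigma> i)\<^sup>2) = (norm M)\<^sup>2" by (simp add: svd_norm(2)[OF sM])
    finally have "2 * (1 / ?c) * p \<le> e"
      unfolding e_def E_def p_def power2_norm_eq_inner
      by (simp add: inner_add_right inner_diff_left inner_diff_right inner_commute)
    then have "2 / ?c * \<alpha> * e \<le> 1 * e" by (simp add: p\<alpha> mult_ac)
    then have "2 / ?c * \<alpha> \<le> 1" using e by (rule mult_right_le_imp_le)
    then show ?thesis using c by (simp add: field_simps)
  qed

  \<comment> \<open>The number \<open>k\<close> of singular values of \<open>Q\<close> may be
    smaller than \<open>s\<close>; the lists are filled up with zeros.\<close>
  define \<tau>' where "\<tau>' j = (if j < k then \<tau> j else 0)" for j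
  define u' where "u' j = (if j < k then u j else 0)" for j
  define v' where "v' j = (if j < k then v j else 0)" for j
  have "sub_orthonormal_on {..<s} u'" "sub_orthonormal_on {..<s} v'"
    using sQ by (auto simp: sub_orthonormal_on_def u'_def v'_def svd_def orthonormal_on_def)
  then have sub: "sub_orthonormal_on {..<?r + s} (append_fun ?r x u')"
      "sub_orthonormal_on {..<?r + s} (append_fun ?r y v')"
    using sM xu yv
    by (auto intro!: sub_orthonormal_append simp: orthonormal_imp_sub_orthonormal svd_def u'_def v'_def)

  \<comment> \<open>\<open>N\<close> is written with exactly r rank-one terms, singular values
    absorbed on the left and zero terms added, so that its coordinate blocks have r columns.\<close>
  obtain \<kappa> \<theta> l \<rho> where sN: "svd \<kappa> \<theta> l \<rho> N" and \<kappa>: "\<kappa> \<le> ?r" using svd_exists_le[OF N(2)] by blast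
  define L where "L c = (if c < \<kappa> then \<theta> c *\<^sub>R l c else 0)" for c
  have NL: "N = (\<Sum>c<?r. outer (L c) (\<rho> c))"
  proof -
    have "N = (\<Sum>c<\<kappa>. outer (L c) (\<rho> c))" using sN by (simp add: svd_def L_def outer.scaleR_left)
    also have "\<dots> = (\<Sum>c<?r. outer (L c) (\<rho> c))"
      using \<kappa> by (intro sum.mono_neutral_left) (auto simp: L_def outer.zero_left)
    finally show ?thesis .
  qed
  have innerN: "inner N (outer g h) = (\<Sum>c<?r. inner g (L c) * inner h (\<rho> c))" for g h
    unfolding NL inner_sum_left inner_outer_outer by (simp add: inner_commute)
  define a where "a i c = inner (x i) (L c)" for i c
  define b where "b i c = inner (y i) (\<rho> c)" for i c
  define c where "c i c' = inner (u' i) (L c')" for i c'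
  define d where "d i c = inner (v' i) (\<rho> c)" for i c
  have pairing: "pairing ?r s \<tau>' c d = p"
  proof -
    have "Q = (\<Sum>j<k. \<tau>' j *\<^sub>R outer (u' j) (v' j))"
      using sQ by (simp add: svd_def \<tau>'_def u'_def v'_def)
    also have "\<dots> = (\<Sum>j<s. \<tau>' j *\<^sub>R outer (u' j) (v' j))"
      using ks by (intro sum.mono_neutral_left) (auto simp: \<tau>'_def)
    finally have "p = (\<Sum>j<s. \<tau>' j * inner N (outer (u' j) (v' j)))"
      by (simp add: p_def inner_sum_left inner_commute[of N])
    then show ?thesis by (simp add: pairing_def innerN c_def d_def)
  qed
  have innerM: "inner M (outer g h) = (\<Sum>i<?r. \<sigma> i * (inner (x i) g * inner (y i) h))" for g h
    using sM by (simp add: svd_def inner_sum_left inner_outer_outer)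
  have innerMr: "inner M (outer (x i) h) = \<sigma> i * inner (y i) h" if "i < ?r" for i h
    using svd_left[OF sM that] by (simp only: inner_outer_right') (simp add: inner_commute)
  have innerM0: "inner M (outer (u' j) h) = 0" if "j < s" for j h
    using xu by (auto simp: innerM u'_def intro!: sum.neutral)
  \<comment> \<open>The coordinates of \<open>E\<close> in the padded bases. Their squares sum to
    the bracket of the system, and Bessel's inequality bounds that by \<open>e\<close>.\<close>
  let ?F = "\<lambda>i j. inner E (outer (append_fun ?r x u' i) (append_fun ?r y v' j))"
  have "(\<Sum>i<?r+s. \<Sum>j<?r+s. (?F i j)\<^sup>2) \<le> e"
    using bessel[OF _ sub_orthonormal_outer[OF sub], of E]
    unfolding sum.cartesian_product e_def by (simp add: case_prod_beta)
  moreover have "(\<Sum>i<?r+s. \<Sum>j<?r+s. (?F i j)\<^sup>2) = (\<Sum>i<?r. (\<sigma> i)\<^sup>2) - 2 * pairing ?r ?r \<sigma> a b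
      + gram_sq ?r ?r ?r a b + gram_sq ?r ?r s a d + gram_sq ?r s ?r c b + gram_sq ?r s s c d"
  proof -
    have 1: "inner E (outer (x i) (y j)) = (\<Sum>k<?r. a i k * b j k) - (if i = j then \<sigma> i else 0)"
      if "i < ?r" "j < ?r" for i j
      using that sM innerMr[OF that(1)]
      by (simp add: E_def inner_diff_left innerN a_def b_def svd_def orthonormal_on_def)
    have 2: "inner E (outer (x i) (v' j)) = (\<Sum>k<?r. a i k * d j k)" if "i < ?r" "j < s" for i j
      using that yv innerMr[OF that(1)] by (simp add: E_def inner_diff_left innerN a_def d_def v'_def)
    have 3: "inner E (outer (u' i) (y j)) = (\<Sum>k<?r. c i k * b j k)" if "i < s" "j < ?r" for i j
      using that innerM0 by (simp add: E_def inner_diff_left innerN c_def b_def)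
    have 4: "inner E (outer (u' i) (v' j)) = (\<Sum>k<?r. c i k * d j k)" if "i < s" "j < s" for i j
      using that innerM0 by (simp add: E_def inner_diff_left innerN c_def d_def)
    show ?thesis
      unfolding sum_append append_fun_simps(2)
      by (simp add: 1 2 3 4 sum.distrib sum_square_diagonal_shift gram_sq_def pairing_def)
  qed
  ultimately have "\<alpha> * ((\<Sum>i<?r. (\<sigma> i)\<^sup>2) - 2 * pairing ?r ?r \<sigma> a b
      + gram_sq ?r ?r ?r a b + gram_sq ?r ?r s a d + gram_sq ?r s ?r c b + gram_sq ?r s s c d)
      \<le> pairing ?r s \<tau>' c d"
    unfolding pairing p\<alpha> using \<alpha>0 by (intro mult_left_mono) auto
  moreover have "(\<Sum>j<s. (\<tau>' j)\<^sup>2) = (norm Q)\<^sup>2"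
  proof -
    have "(\<Sum>j<k. (\<tau> j)\<^sup>2) = (\<Sum>j<s. (\<tau>' j)\<^sup>2)"
      using ks by (intro sum.mono_neutral_cong_left) (auto simp: \<tau>'_def)
    then show ?thesis by (simp add: svd_norm(2)[OF sQ])
  qed
  moreover have "\<forall>i<?r. \<forall>j<s. \<tau>' j \<le> (1 + \<delta>) * \<sigma> i"
    using \<tau>\<sigma> \<sigma>0 \<delta>(1) by (auto simp: \<tau>'_def less_imp_le)
  moreover have "\<forall>j<s. \<tau>' j \<ge> 0" using \<tau>0 by (simp add: \<tau>'_def less_imp_le)
  ultimately have "\<exists>d. scalar_system ?r s \<delta> \<alpha> \<sigma> \<tau>' a b c d"
    using \<sigma>0 p0 Qle \<alpha>_strict \<alpha>_half \<delta> pairing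
    by (intro scalar_system_from_inequality[where d = d]) auto
  then show ?thesis by blast
qed

section \<open>The algebraic system in coordinates\<close>

lemma diagonal_quadratic_form:
  fixes S :: "real mat"
  assumes "S \<in> carrier_mat n n" "diagonal_mat S" "v \<in> carrier_vec n"
  shows "scalar_prod v (mult_mat_vec S v) = (\<Sum>i<n. S $$ (i, i) * (vec_index v i)\<^sup>2)"
proof -
  have "scalar_prod (Matrix.row S i) v = S $$ (i, i) * vec_index v i" if "i < n" for i
  proof -
    have "scalar_prod (Matrix.row S i) v = (\<Sum>j<n. S $$ (i, j) * vec_index v j)"
      using assms that by (simp add: scalar_prod_def lessThan_atLeast0)
    also have "\<dots> = (\<Sum>j<n. if j = i then S $$ (i, i) * vec_index v i else 0)"
      using assms that by (intro sum.cong) (auto simp: diagonal_mat_def)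
    finally show ?thesis using that by simp
  qed
  then have "scalar_prod v (mult_mat_vec S v) = (\<Sum>i<n. vec_index v i * (S $$ (i, i) * vec_index v i))"
    using assms by (simp add: scalar_prod_def[of v] lessThan_atLeast0)
  also have "\<dots> = (\<Sum>i<n. S $$ (i, i) * (vec_index v i)\<^sup>2)"
    by (rule sum.cong) (simp_all add: power2_eq_square)
  finally show ?thesis .
qed

lemma diagonal_symmetric:
  assumes "S \<in> carrier_mat n n" "diagonal_mat S"
  shows "square_mat S" "transpose_mat S = S"
  using assms by (auto simp: diagonal_mat_def intro!: eq_matI) metis

lemma pos_def_diagonal_iff:
  assumes "S \<in> carrier_mat n n" "diagonal_mat S"
  shows "pos_def S \<longleftrightarrow> (\<forall>i<n. S $$ (i, i) > 0)"
proof
  assume pd: "pos_def S"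
  show "\<forall>i<n. S $$ (i, i) > 0"
  proof (intro allI impI)
    fix i assume i: "i < n"
    have "(\<Sum>j<n. S $$ (j, j) * (vec_index (unit_vec n i) j)\<^sup>2) = (\<Sum>j<n. if j = i then S $$ (i, i) else 0)"
      using i by (intro sum.cong) (auto simp: unit_vec_def)
    moreover have "unit_vec n i \<noteq> (0\<^sub>v n :: real vec)" using i by simp
    ultimately show "S $$ (i, i) > 0"
      using pd i assms diagonal_quadratic_form[OF assms, of "unit_vec n i"]
      unfolding pos_def_def by (auto dest!: bspec[of _ _ "unit_vec n i"])
  qed
next
  assume pos: "\<forall>i<n. S $$ (i, i) > 0"
  have "scalar_prod v (mult_mat_vec S v) > 0" if v: "v \<in> carrier_vec n" "v \<noteq> 0\<^sub>v n" for v
  proof -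
    obtain i where i: "i < n" "vec_index v i \<noteq> 0" using v by (auto simp: Matrix.vec_eq_iff)
    have "(\<Sum>j<n. S $$ (j, j) * (vec_index v j)\<^sup>2) > 0"
      using pos i by (intro sum_pos2[of _ i]) (auto simp: less_imp_le)
    then show ?thesis using diagonal_quadratic_form[OF assms v(1)] by simp
  qed
  then show "pos_def S" using assms diagonal_symmetric[OF assms] unfolding pos_def_def by auto
qed

lemma pos_semidef_diagonal_iff:
  assumes "S \<in> carrier_mat n n" "diagonal_mat S"
  shows "pos_semidef S \<longleftrightarrow> (\<forall>i<n. S $$ (i, i) \<ge> 0)"
proof
  assume pd: "pos_semidef S"
  show "\<forall>i<n. S $$ (i, i) \<ge> 0"
  proof (intro allI impI)
    fix i assume i: "i < n"
    have "(\<Sum>j<n. S $$ (j, j) * (vec_index (unit_vec n i) j)\<^sup>2) = (\<Sum>j<n. if j = i then S $$ (i, i) else 0)"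
      using i by (intro sum.cong) (auto simp: unit_vec_def)
    then show "S $$ (i, i) \<ge> 0"
      using pd i assms diagonal_quadratic_form[OF assms, of "unit_vec n i"]
      unfolding pos_semidef_def by (auto dest!: bspec[of _ _ "unit_vec n i"])
  qed
next
  assume "\<forall>i<n. S $$ (i, i) \<ge> 0"
  then have "scalar_prod v (mult_mat_vec S v) \<ge> 0" if "v \<in> carrier_vec n" for v
    unfolding diagonal_quadratic_form[OF assms that] by (intro sum_nonneg) simp
  then show "pos_semidef S" using assms diagonal_symmetric[OF assms] unfolding pos_semidef_def by auto
qed

lemma mat_inner_eq:
  assumes "X \<in> carrier_mat n m" "Y \<in> carrier_mat n m"
  shows "mat_inner X Y = (\<Sum>i<n. \<Sum>j<m. X $$ (i, j) * Y $$ (i, j))"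
proof -
  have "mat_inner X Y = (\<Sum>j<m. \<Sum>i<n. X $$ (i, j) * Y $$ (i, j))"
    using assms by (simp add: mat_inner_def mat_trace_def scalar_prod_def lessThan_atLeast0)
  then show ?thesis by (subst sum.swap)
qed

lemma index_mult_transpose:
  assumes "A \<in> carrier_mat n r" "B \<in> carrier_mat m r" "i < n" "j < m"
  shows "(A * transpose_mat B) $$ (i, j) = (\<Sum>k<r. A $$ (i, k) * B $$ (j, k))"
  using assms by (simp add: scalar_prod_def lessThan_atLeast0)

lemma mat_inner_diagonal:
  assumes "S \<in> carrier_mat n n" "diagonal_mat S" "X \<in> carrier_mat n n"
  shows "mat_inner S X = (\<Sum>i<n. S $$ (i, i) * X $$ (i, i))"
proof -
  have "(\<Sum>j<n. S $$ (i, j) * X $$ (i, j)) = (\<Sum>j<n. if j = i then S $$ (i, i) * X $$ (i, i) else 0)"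
    if "i < n" for i
    using assms that by (intro sum.cong) (auto simp: diagonal_mat_def)
  then show ?thesis using mat_inner_eq[OF assms(1,3)] by simp
qed

lemma mat_trace_diagonal_square:
  assumes "S \<in> carrier_mat n n" "diagonal_mat S"
  shows "mat_trace (S * S) = (\<Sum>i<n. (S $$ (i, i))\<^sup>2)"
proof -
  have "mat_trace (S * S) = mat_inner S S"
    using diagonal_symmetric[OF assms] by (simp add: mat_inner_def)
  then show ?thesis using mat_inner_diagonal[OF assms assms(1)] by (simp add: power2_eq_square)
qed

lemma frob_norm_square:
  assumes "X \<in> carrier_mat n m"
  shows "(frob_norm X)\<^sup>2 = (\<Sum>i<n. \<Sum>j<m. (X $$ (i, j))\<^sup>2)"
  using mat_inner_eq[OF assms assms] by (simp add: frob_norm_def power2_eq_square sum_nonneg)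

text \<open>All conditions on diagonal matrices reduce to their diagonals. For the extremal entries,
  \<open>r > 0\<close> makes the minimum exist and 1 + \<delta> \<ge> 0 lets the inequality pass
  from the minimum to every entry.\<close>

lemma system_C_iff:
  assumes r: "r > 0" and \<delta>: "\<delta> \<ge> 0"
    and S: "S \<in> carrier_mat r r" "diagonal_mat S" and T: "T \<in> carrier_mat s s" "diagonal_mat T"
    and A: "A \<in> carrier_mat r r" and B: "B \<in> carrier_mat r r"
    and C: "C \<in> carrier_mat s r" and D: "D \<in> carrier_mat s r"
  shows "system_C r s \<delta> \<alpha> S T A B C D \<longleftrightarrow>
    scalar_system r s \<delta> \<alpha> (\<lambda>i. S $$ (i, i)) (\<lambda>i. T $$ (i, i)) (\<lambda>i k. A $$ (i, k))
      (\<lambda>i k. B $$ (i, k)) (\<lambda>i k. C $$ (i, k)) (\<lambda>i k. D $$ (i, k))"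
proof -
  have gram: "(frob_norm (X * transpose_mat Y))\<^sup>2 = gram_sq r n m (\<lambda>i k. X $$ (i, k)) (\<lambda>i k. Y $$ (i, k))"
    if "X \<in> carrier_mat n r" "Y \<in> carrier_mat m r" for X Y n m
  proof -
    have "X * transpose_mat Y \<in> carrier_mat n m" using that by simp
    from frob_norm_square[OF this] show ?thesis
      by (simp add: gram_sq_def index_mult_transpose[OF that])
  qed
  have pair: "mat_inner Z (X * transpose_mat Y) =
      pairing r n (\<lambda>i. Z $$ (i, i)) (\<lambda>i k. X $$ (i, k)) (\<lambda>i k. Y $$ (i, k))"
    if "Z \<in> carrier_mat n n" "diagonal_mat Z" "X \<in> carrier_mat n r" "Y \<in> carrier_mat n r" for X Y Z n
  proof -
    have "X * transpose_mat Y \<in> carrier_mat n n" using that by simp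
    from mat_inner_diagonal[OF that(1,2) this] show ?thesis
      by (simp add: pairing_def index_mult_transpose[OF that(3,4)])
  qed
  have ord: "(s > 0 \<longrightarrow> (1 + \<delta>) * Min ((\<lambda>i. S $$ (i, i)) ` {..<r}) \<ge> Max ((\<lambda>i. T $$ (i, i)) ` {..<s}))
      \<longleftrightarrow> (\<forall>i<r. \<forall>j<s. T $$ (j, j) \<le> (1 + \<delta>) * S $$ (i, i))"
  proof (cases "s > 0")
    case True
    let ?I = "(\<lambda>i. S $$ (i, i)) ` {..<r}" and ?J = "(\<lambda>i. T $$ (i, i)) ` {..<s}"
    have ne: "?I \<noteq> {}" "?J \<noteq> {}" "finite ?I" "finite ?J" using True r by auto
    show ?thesis
    proof
      assume "s > 0 \<longrightarrow> (1 + \<delta>) * Min ?I \<ge> Max ?J"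
      then have le: "Max ?J \<le> (1 + \<delta>) * Min ?I" using True by simp
      show "\<forall>i<r. \<forall>j<s. T $$ (j, j) \<le> (1 + \<delta>) * S $$ (i, i)"
      proof (intro allI impI)
        fix i j assume ij: "i < r" "j < s"
        have "T $$ (j, j) \<le> Max ?J" using ij ne by (intro Max_ge) auto
        also note le
        also have "(1 + \<delta>) * Min ?I \<le> (1 + \<delta>) * S $$ (i, i)"
          using ij ne \<delta> by (intro mult_left_mono Min_le) auto
        finally show "T $$ (j, j) \<le> (1 + \<delta>) * S $$ (i, i)" .
      qed
    next
      assume all: "\<forall>i<r. \<forall>j<s. T $$ (j, j) \<le> (1 + \<delta>) * S $$ (i, i)"
      have "Max ?J \<in> ?J" "Min ?I \<in> ?I" using ne by (intro Max_in Min_in; simp)+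
      then obtain i j where "i < r" "j < s" "Max ?J = T $$ (j, j)" "Min ?I = S $$ (i, i)" by blast
      then show "s > 0 \<longrightarrow> (1 + \<delta>) * Min ?I \<ge> Max ?J" using all by simp
    qed
  qed simp
  show ?thesis
    unfolding system_C_def scalar_system_def ord pos_def_diagonal_iff[OF S] pos_semidef_diagonal_iff[OF T]
      mat_trace_diagonal_square[OF S] mat_trace_diagonal_square[OF T] pair[OF S A B] pair[OF T C D]
      gram[OF A B] gram[OF A D] gram[OF C B] gram[OF C D]
    using assms by auto
qed

text \<open>Entries of a matrix built from a function are known inside its dimensions only, and only
  those enter the system.\<close>

lemma scalar_system_cong:
  assumes "\<And>i. i < r \<Longrightarrow> \<sigma> i = \<sigma>' i" "\<And>j. j < s \<Longrightarrow> \<tau> j = \<tau>' j"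
    "\<And>i k. i < r \<Longrightarrow> k < r \<Longrightarrow> a i k = a' i k" "\<And>i k. i < r \<Longrightarrow> k < r \<Longrightarrow> b i k = b' i k"
    "\<And>i k. i < s \<Longrightarrow> k < r \<Longrightarrow> c i k = c' i k" "\<And>i k. i < s \<Longrightarrow> k < r \<Longrightarrow> d i k = d' i k"
  shows "scalar_system r s \<delta> \<alpha> \<sigma> \<tau> a b c d \<longleftrightarrow> scalar_system r s \<delta> \<alpha> \<sigma>' \<tau>' a' b' c' d'"
  using assms by (simp add: scalar_system_def pairing_def gram_sq_def)

lemma ex_system_C_if_scalar:
  assumes "r > 0" "\<delta> \<ge> 0" "scalar_system r s \<delta> \<alpha> \<sigma> \<tau> a b c d"
  shows "\<exists>S T A B C D. system_C r s \<delta> \<alpha> S T A B C D"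
proof -
  let ?diag = "\<lambda>n f. Matrix.mat n n (\<lambda>(i, j). if i = j then f i else 0 :: real)"
  let ?mat = "\<lambda>n f. Matrix.mat n r (\<lambda>(i, k). f i k :: real)"
  have "system_C r s \<delta> \<alpha> (?diag r \<sigma>) (?diag s \<tau>) (?mat r a) (?mat r b) (?mat s c) (?mat s d)"
  proof (subst system_C_iff)
    show "scalar_system r s \<delta> \<alpha> (\<lambda>i. ?diag r \<sigma> $$ (i, i)) (\<lambda>i. ?diag s \<tau> $$ (i, i))
        (\<lambda>i k. ?mat r a $$ (i, k)) (\<lambda>i k. ?mat r b $$ (i, k)) (\<lambda>i k. ?mat s c $$ (i, k))
        (\<lambda>i k. ?mat s d $$ (i, k))"
      using assms(3) by (subst scalar_system_cong[where \<sigma>'=\<sigma> and \<tau>'=\<tau> and a'=a and b'=b and c'=c and d'=d]) auto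
  qed (use assms in \<open>auto simp: diagonal_mat_def\<close>)
  then show ?thesis by blast
qed

section \<open>Sufficiency\<close>

lemma quadratic_function:
  fixes T :: "'a::euclidean_space \<Rightarrow> 'a" and x0 :: 'a
  assumes T: "bounded_linear T" and sym: "\<And>x y. inner (T x) y = inner (T y) x"
  defines "f \<equiv> \<lambda>x. 1 / 2 * inner (T (x - x0)) (x - x0)"
  shows "C2_function f (\<lambda>_. Blinfun T)" "grad f x = T (x - x0)" "hessian f x u k = inner (T u) k"
proof -
  interpret T: bounded_linear T by (rule T)
  have d: "((\<lambda>x. x - x0) has_derivative (\<lambda>k. k)) (at x)" for x
    using has_derivative_diff[OF has_derivative_ident has_derivative_const[of x0]] by simp
  note Tx = T.has_derivative[OF d]
  have D: "(f has_derivative (\<lambda>k. inner (T (x - x0)) k)) (at x)" for x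
    using has_derivative_mult_right[OF has_derivative_inner[OF Tx d], of "1 / 2" x]
    by (simp add: f_def sym[of _ "x - x0"])
  have g: "grad f = (\<lambda>x. T (x - x0))" 
    using inner_grad[OF D] by (intro ext) (metis vector_eq_rdot)
  then show "grad f x = T (x - x0)" by simp
  have "C2_function f (\<lambda>_. Blinfun T)"
  proof
    show "(f has_derivative inner (grad f x)) (at x)" for x
      using D[of x] by (simp add: g)
    show "(grad f has_derivative blinfun_apply (Blinfun T)) (at x)" for x
      using Tx by (simp add: g bounded_linear_Blinfun_apply[OF T])
  qed simp
  then show C2: "C2_function f (\<lambda>_. Blinfun T)" .
  show "hessian f x u k = inner (T u) k"
    using C2_function.hessian_H[OF C2] by (simp add: bounded_linear_Blinfun_apply[OF T])
qed

text \<open>Subtracting from \<open>x\<close> its components along the \<open>e i\<close> does not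
  change its pairing with \<open>w\<close>; Cauchy--Schwarz is applied to what is left.\<close>

lemma cauchy_schwarz_orthogonal:
  fixes x w :: "'a::real_inner"
  assumes "finite I" "orthonormal_on I e" "\<And>i. i \<in> I \<Longrightarrow> inner w (e i) = 0"
  shows "(inner w x)\<^sup>2 \<le> (norm w)\<^sup>2 * ((norm x)\<^sup>2 - (\<Sum>i\<in>I. (inner x (e i))\<^sup>2))"
proof -
  let ?S = "\<Sum>i\<in>I. inner x (e i) *\<^sub>R e i"
  have wS: "inner w ?S = 0" using assms(3) by (simp add: inner_sum_right)
  have SS: "inner ?S ?S = (\<Sum>i\<in>I. (inner x (e i))\<^sup>2)"
    using inner_orthonormal_sums[OF assms(1,2)] by (simp add: power2_eq_square)
  have xS: "inner x ?S = (\<Sum>i\<in>I. (inner x (e i))\<^sup>2)"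
    by (simp add: inner_sum_right power2_eq_square)
  have "(inner w x)\<^sup>2 = (inner w (x - ?S))\<^sup>2" by (simp add: inner_diff_right wS)
  also have "\<dots> \<le> inner w w * inner (x - ?S) (x - ?S)" by (rule Cauchy_Schwarz_ineq)
  also have "inner (x - ?S) (x - ?S) = inner x x - 2 * inner x ?S + inner ?S ?S"
    by (simp add: inner_diff_left inner_diff_right inner_commute)
  finally show ?thesis unfolding SS xS by (simp add: power2_norm_eq_inner)
qed

text \<open>Splitting each \<sigma>_i into two square roots and using one family \<epsilon> in both
  factors makes their Gram matrices equal.\<close>

definition balanced_factor ::
  "nat \<Rightarrow> (nat \<Rightarrow> real) \<Rightarrow> (nat \<Rightarrow> real^'r) \<Rightarrow> (nat \<Rightarrow> real^'n) \<Rightarrow> real^'r^'n" where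
  "balanced_factor k \<sigma> \<epsilon> x = (\<Sum>i<k. sqrt (\<sigma> i) *\<^sub>R outer (x i) (\<epsilon> i))"

lemma balanced_factor_mult_vec:
  "balanced_factor k \<sigma> \<epsilon> x *v w = (\<Sum>i<k. (sqrt (\<sigma> i) * inner (\<epsilon> i) w) *\<^sub>R x i)"
  unfolding balanced_factor_def by (rule outer_sum_mult_vec)

lemma transpose_balanced_factor: "transpose (balanced_factor k \<sigma> \<epsilon> x) = balanced_factor k \<sigma> x \<epsilon>"
  unfolding balanced_factor_def
  by (simp add: bounded_linear.linear[OF bounded_linear_transpose] linear_sum linear_cmul transpose_outer)

text \<open>The inner orthonormal family cancels. The families are kept free so that U V^T, U^T U
  and V^T V are all instances.\<close>

lemma balanced_factor_mult:
  assumes "\<And>i. i < k \<Longrightarrow> \<sigma> i \<ge> 0" "orthonormal_on {..<k} e"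
  shows "balanced_factor k \<sigma> e x ** balanced_factor k \<sigma> y e = (\<Sum>i<k. \<sigma> i *\<^sub>R outer (x i) (y i))"
proof (subst matrix_eq, intro allI)
  fix w
  let ?z = "\<Sum>i<k. (sqrt (\<sigma> i) * inner (y i) w) *\<^sub>R e i"
  have "(balanced_factor k \<sigma> e x ** balanced_factor k \<sigma> y e) *v w = (\<Sum>i<k. (sqrt (\<sigma> i) * inner (e i) ?z) *\<^sub>R x i)"
    unfolding matrix_vector_mul_assoc[symmetric] balanced_factor_mult_vec ..
  also have "\<dots> = (\<Sum>i<k. (\<sigma> i * inner (y i) w) *\<^sub>R x i)"
  proof (rule sum.cong[OF refl])
    fix i assume i: "i \<in> {..<k}"
    have "inner (e i) ?z = sqrt (\<sigma> i) * inner (y i) w"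
      using inner_orthonormal_sum[OF _ assms(2) i] by (simp add: inner_commute)
    then show "(sqrt (\<sigma> i) * inner (e i) ?z) *\<^sub>R x i = (\<sigma> i * inner (y i) w) *\<^sub>R x i"
      using assms(1) i by (simp flip: mult.assoc)
  qed
  finally show "(balanced_factor k \<sigma> e x ** balanced_factor k \<sigma> y e) *v w
      = (\<Sum>i<k. \<sigma> i *\<^sub>R outer (x i) (y i)) *v w"
    unfolding outer_sum_mult_vec .
qed

lemma balanced_factor_product:
  fixes \<epsilon> :: "nat \<Rightarrow> real^'r" and x :: "nat \<Rightarrow> real^'n" and y :: "nat \<Rightarrow> real^'m"
  assumes "\<And>i. i < k \<Longrightarrow> \<sigma> i \<ge> 0" "orthonormal_on {..<k} \<epsilon>"
    "orthonormal_on {..<k} x" "orthonormal_on {..<k} y"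
  shows "balanced_factor k \<sigma> \<epsilon> x ** transpose (balanced_factor k \<sigma> \<epsilon> y) = (\<Sum>i<k. \<sigma> i *\<^sub>R outer (x i) (y i))"
    and "gap (balanced_factor k \<sigma> \<epsilon> x, balanced_factor k \<sigma> \<epsilon> y) = 0"
  using assms by (simp_all add: gap_def transpose_balanced_factor balanced_factor_mult)

lemma orthonormal_coordinates:
  assumes "k \<le> CARD('k::finite)"
  shows "\<exists>e :: nat \<Rightarrow> real^'k. orthonormal_on {..<k} e \<and>
    (k = CARD('k) \<longrightarrow> (\<forall>w. (\<Sum>i<k. (inner (e i) w)\<^sup>2) = (norm w)\<^sup>2))"
proof -
  obtain g where g: "inj_on g {..<k}" "g ` {..<k} \<subseteq> (UNIV :: 'k set)"
    using card_le_inj[of "{..<k}" "UNIV :: 'k set"] assms by auto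
  show ?thesis
  proof (intro exI[of _ "\<lambda>i. axis (g i) 1"] conjI impI allI)
    show "orthonormal_on {..<k} (\<lambda>i. axis (g i) (1::real))"
      using g by (auto simp: orthonormal_on_def inner_axis_axis inj_on_def)
    fix w :: "real^'k" assume "k = CARD('k)"
    then have "g ` {..<k} = UNIV"
      using g card_image[OF g(1)] by (intro card_subset_eq) auto
    then have "(\<Sum>i<k. (vec_nth w (g i))\<^sup>2) = (\<Sum>i\<in>UNIV. (vec_nth w i)\<^sup>2)"
      using sum.reindex[OF g(1), of "\<lambda>i. (vec_nth w i)\<^sup>2"] by simp
    moreover have "(norm w)\<^sup>2 = (\<Sum>i\<in>UNIV. (vec_nth w i)\<^sup>2)"
      by (simp only: power2_norm_eq_inner inner_vec_def) (simp add: power2_eq_square)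
    ultimately show "(\<Sum>i<k. (inner (axis (g i) 1) w)\<^sup>2) = (norm w)\<^sup>2"
      by (simp add: inner_axis')
  qed
qed

section \<open>From the system to a function with a spurious point\<close>

text \<open>One function serves all weights \<mu> because the critical point and the better
  comparison point are both balanced.\<close>

lemma scalar_system_imp_spurious:
  fixes \<delta> \<alpha> :: real
  assumes sys: "scalar_system CARD('r) s \<delta> \<alpha> \<sigma> \<tau> a b c d"
    and dims: "CARD('r) + s \<le> CARD('n)" "CARD('r) + s \<le> CARD('m)" and \<delta>: "0 \<le> \<delta>" "\<delta> < 1"
    and CB: "\<And>i j. i < s \<Longrightarrow> j < CARD('r) \<Longrightarrow> (\<Sum>k<CARD('r). c i k * b j k) = 0"
    and AD: "\<And>i j. i < CARD('r) \<Longrightarrow> j < s \<Longrightarrow> (\<Sum>k<CARD('r). a i k * d j k) = 0"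
  shows "\<exists>f :: real^'m^'n \<Rightarrow> real.
    admissible CARD('r) f \<and> RIP \<delta> (2 * CARD('r)) (2 * CARD('r)) f \<and>
    (\<forall>\<mu>\<ge>0. \<exists>W :: ('n::finite, 'm::finite, 'r::finite) factors.
      spurious_second_order_critical (regularized \<mu> f) W)"
proof -
  let ?r = "CARD('r)"
  let ?t = "?r + s"
  obtain p :: "nat \<Rightarrow> real^'n" where p: "orthonormal_on {..<?t} p"
    using orthonormal_coordinates[OF dims(1)] by blast
  obtain q :: "nat \<Rightarrow> real^'m" where q: "orthonormal_on {..<?t} q"
    using orthonormal_coordinates[OF dims(2)] by blast
  obtain \<epsilon> :: "nat \<Rightarrow> real^'r" where \<epsilon>: "orthonormal_on {..<?r} \<epsilon>"
    "\<And>w. (\<Sum>i<?r. (inner (\<epsilon> i) w)\<^sup>2) = (norm w)\<^sup>2"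
    using orthonormal_coordinates[where 'k = 'r, OF order_refl] by auto
  have pr: "orthonormal_on {..<?r} p" and qr: "orthonormal_on {..<?r} q"
    using p q by (auto intro: orthonormal_on_subset)
  have pp: "inner (p i) (p j) = (if i = j then 1 else 0)" "inner (q i) (q j) = (if i = j then 1 else 0)"
    if "i < ?t" "j < ?t" for i j
    using p q that by (auto simp: orthonormal_on_def)
  from sys have \<alpha>: "1 - \<delta> < \<alpha>" "\<alpha> \<le> (1 + \<delta>) / 2"
    and \<tau>\<sigma>: "\<And>i j. i < ?r \<Longrightarrow> j < s \<Longrightarrow> \<tau> j \<le> (1 + \<delta>) * \<sigma> i"
    and \<sigma>: "\<And>i. i < ?r \<Longrightarrow> \<sigma> i > 0" and \<tau>: "\<And>j. j < s \<Longrightarrow> \<tau> j \<ge> 0"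
    and eq: "pairing ?r s \<tau> c d = \<alpha> * ((\<Sum>i<?r. (\<sigma> i)\<^sup>2) - 2 * pairing ?r ?r \<sigma> a b + gram_sq ?r ?r ?r a b
       + gram_sq ?r ?r s a d + gram_sq ?r s ?r c b + gram_sq ?r s s c d)"
    and sq: "(\<Sum>j<s. (\<tau> j)\<^sup>2) \<le> inverse \<alpha> * (2 * \<alpha> - 1 + \<delta>\<^sup>2) * pairing ?r s \<tau> c d"
    and nz: "pairing ?r s \<tau> c d \<noteq> 0"
    unfolding scalar_system_def by auto
  have \<alpha>0: "\<alpha> > 0" using \<alpha> \<delta> by simp

  define M where "M = (\<Sum>i<?r. \<sigma> i *\<^sub>R outer (p i) (q i))"
  define Q where "Q = (\<Sum>j<s. \<tau> j *\<^sub>R outer (p (?r + j)) (q (?r + j)))"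
  \<comment> \<open>\<open>g\<close> stacks \<open>a\<close> over \<open>c\<close> and
    \<open>h\<close> stacks \<open>b\<close> over \<open>d\<close>; \<open>N\<close> is the product
    g h^T transported to the bases \<open>p\<close> and \<open>q\<close>.\<close>
  define g where "g k = append_fun ?r a c k" for k
  define h where "h k = append_fun ?r b d k" for k
  define L where "L k = (\<Sum>i<?t. g i k *\<^sub>R p i)" for k
  define R where "R k = (\<Sum>i<?t. h i k *\<^sub>R q i)" for k
  define N where "N = (\<Sum>k<?r. outer (L k) (R k))"
  have Np: "inner N (outer (p i) (q j)) = (\<Sum>k<?r. g i k * h j k)" if "i < ?t" "j < ?t" for i j
    using that inner_orthonormal_sum[OF _ p] inner_orthonormal_sum[OF _ q]
    by (simp add: N_def inner_sum_left inner_outer_outer L_def R_def)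
  have Mp: "inner M (outer (p i) (q j)) = (if i = j \<and> i < ?r then \<sigma> i else 0)" if "i < ?t" "j < ?t" for i j
  proof -
    have "inner M (outer (p i) (q j)) = (\<Sum>k<?r. if k = i then (if i = j then \<sigma> i else 0) else 0)"
      unfolding M_def inner_sum_left using that by (intro sum.cong) (auto simp: inner_outer_outer pp)
    then show ?thesis by simp
  qed
  have Qp: "inner Q (outer (p i) (q j)) = (if i = j \<and> i \<ge> ?r then \<tau> (i - ?r) else 0)" if "i < ?t" "j < ?t" for i j
  proof -
    have "inner Q (outer (p i) (q j)) = (\<Sum>k<s. if k = i - ?r then (if i = j \<and> i \<ge> ?r then \<tau> (i - ?r) else 0) else 0)"
      unfolding Q_def inner_sum_left using that by (intro sum.cong) (auto simp: inner_outer_outer pp)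
    then show ?thesis using that by auto
  qed
  have Nsq: "inner N N = (\<Sum>i<?t. \<Sum>j<?t. (\<Sum>k<?r. g i k * h j k)\<^sup>2)"
  proof -
    have "inner N N = (\<Sum>k<?r. \<Sum>i<?t. \<Sum>j<?t. g i k * h j k * inner N (outer (p i) (q j)))"
    proof -
      have "outer (L k) (R k) = (\<Sum>i<?t. \<Sum>j<?t. (g i k * h j k) *\<^sub>R outer (p i) (q j))" for k
        unfolding L_def outer.sum_left unfolding R_def outer.sum_right
        by (simp add: outer.scaleR_left outer.scaleR_right mult.commute)
      then show ?thesis by (subst (2) N_def) (simp add: inner_sum_right)
    qed
    also have "\<dots> = (\<Sum>k<?r. \<Sum>i<?t. \<Sum>j<?t. g i k * h j k * (\<Sum>k'<?r. g i k' * h j k'))"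
      by (simp add: Np)
    also have "\<dots> = (\<Sum>i<?t. \<Sum>j<?t. \<Sum>k<?r. g i k * h j k * (\<Sum>k'<?r. g i k' * h j k'))"
      by (subst sum.swap) (simp add: sum.swap[of _ "{..<?t}" "{..<?r}"])
    finally show ?thesis by (simp add: power2_eq_square sum_distrib_right)
  qed
  also have "\<dots> = gram_sq ?r ?r ?r a b + gram_sq ?r ?r s a d + gram_sq ?r s ?r c b + gram_sq ?r s s c d"
    unfolding sum_append g_def h_def by (simp add: gram_sq_def sum.distrib)
  finally have NN: "inner N N = gram_sq ?r ?r ?r a b + gram_sq ?r ?r s a d + gram_sq ?r s ?r c b + gram_sq ?r s s c d" .
  have NM: "inner N M = pairing ?r ?r \<sigma> a b"
    unfolding M_def by (simp add: inner_sum_right Np pairing_def g_def h_def)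
  have NQ: "inner N Q = pairing ?r s \<tau> c d"
    unfolding Q_def by (simp add: inner_sum_right Np pairing_def g_def h_def)
  have MQ: "inner M Q = 0"
    unfolding Q_def by (simp add: inner_sum_right Mp)
  have MM: "inner M M = (\<Sum>i<?r. (\<sigma> i)\<^sup>2)"
    by (subst (2) M_def) (simp add: inner_sum_right Mp power2_eq_square)
  have QQ: "inner Q Q = (\<Sum>j<s. (\<tau> j)\<^sup>2)"
    by (subst (2) Q_def) (simp add: inner_sum_right Qp power2_eq_square)

  define E where "E = N - M"
  define e where "e = inner E E"
  \<comment> \<open>This is the equality in the system: the pairing is <Q, N> = <Q, E>, and the
    bracket is |E|^2.\<close>
  have QE: "inner Q E = \<alpha> * e"
    using eq by (simp add: E_def e_def inner_diff_left inner_diff_right inner_commute[of Q] inner_commute[of M N]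
        NN NM NQ MM MQ algebra_simps)
  then have pe: "pairing ?r s \<tau> c d = \<alpha> * e"
    by (simp add: E_def inner_diff_right inner_commute[of Q] NQ MQ)
  have e: "e > 0" using nz pe by (metis e_def inner_gt_zero_iff inner_zero_left mult_zero_right)
  have QQle: "inner Q Q \<le> (2 * \<alpha> - 1 + \<delta>\<^sup>2) * e"
  proof -
    have "inverse \<alpha> * x * (\<alpha> * e) = x * e" for x using \<alpha>0 by simp
    then show ?thesis using sq unfolding QQ pe by (simp only:)
  qed
  define w where "w = (1 + \<delta>) *\<^sub>R E - Q"
  \<comment> \<open>Normalized such that \<open>\<gamma> * inner w E = 1\<close>, which makes the
    operator \<open>T\<close> below send \<open>E\<close> to (1 + \<delta>) E - w = Q.\<close>
  define \<gamma> where "\<gamma> = 1 / ((1 + \<delta> - \<alpha>) * e)"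
  have gap_pos: "1 + \<delta> - \<alpha> > 0" using \<alpha> \<delta> by (simp add: field_simps)
  have \<gamma>: "\<gamma> > 0" using gap_pos e by (simp add: \<gamma>_def)
  have wE: "inner w E = (1 + \<delta> - \<alpha>) * e" by (simp add: w_def inner_diff_left QE e_def algebra_simps)
  \<comment> \<open>The bound on the squares of \<tau> says precisely that the rank-one correction
    lowers the eigenvalue 1 + \<delta> to no less than 1 - \<delta>.\<close>
  have ww: "\<gamma> * inner w w \<le> 2 * \<delta>"
  proof -
    have "inner w w = (1 + \<delta>)\<^sup>2 * e - 2 * (1 + \<delta>) * \<alpha> * e + inner Q Q"
      by (simp add: w_def inner_diff_left inner_diff_right inner_commute[of E Q] QE e_def[symmetric]
          power2_eq_square algebra_simps)
    also have "\<dots> \<le> 2 * \<delta> * ((1 + \<delta> - \<alpha>) * e)"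
      using QQle by (simp add: algebra_simps power2_eq_square)
    finally have "\<gamma> * inner w w \<le> \<gamma> * (2 * \<delta> * ((1 + \<delta> - \<alpha>) * e))" using \<gamma> by simp
    also have "\<dots> = 2 * \<delta>" using gap_pos e by (simp add: \<gamma>_def)
    finally show ?thesis .
  qed

  define T where "T K = (1 + \<delta>) *\<^sub>R K - (\<gamma> * inner w K) *\<^sub>R w" for K
  have T: "bounded_linear T"
    unfolding T_def
    by (intro bounded_linear_sub bounded_linear_scaleR_right bounded_linear_scaleR_left
        bounded_linear_compose[OF bounded_linear_scaleR_left] bounded_linear_const_mult bounded_linear_inner_right)
  have Tsym: "inner (T x) y = inner (T y) x" for x y
    unfolding T_def inner_diff_left inner_scaleR_left by (simp add: inner_commute mult_ac)
  have TT: "inner (T K) K = (1 + \<delta>) * (norm K)\<^sup>2 - \<gamma> * (inner w K)\<^sup>2" for K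
    unfolding T_def power2_norm_eq_inner by (simp add: inner_diff_left power2_eq_square)
  have TE: "T E = Q"
  proof -
    have "\<gamma> * inner w E = 1" using gap_pos e by (simp add: wE \<gamma>_def)
    then show ?thesis by (simp add: T_def w_def)
  qed
  define f where "f = (\<lambda>K. 1 / 2 * inner (T (K - N)) (K - N))"
  note quad = quadratic_function[OF T Tsym, of N, folded f_def]
  have C2: "C2_function f (\<lambda>_. Blinfun T)" by (rule quad(1))
  have tcd: "twice_continuously_differentiable f" using C2 twice_continuously_differentiable_iff by blast
  have T0: "T 0 = 0" by (simp add: T_def)
  have critN: "first_order_critical f N"
  proof -
    have "GDERIV f N :> grad f N"
      using C2_function.f_derivative[OF C2, of N] by (simp add: gderiv_def inner_commute)
    then show ?thesis by (simp add: first_order_critical_def quad(2) T0)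
  qed
  have rN: "rank N \<le> ?r"
  proof -
    have "N *v z \<in> span (L ` {..<?r})" for z
      using outer_sum_mult_vec[of "\<lambda>_. 1" L R "{..<?r}" z] unfolding N_def
      by (simp, intro span_sum span_mul span_base) auto
    then have "rank N \<le> dim (span (L ` {..<?r}))" by (rule rank_le_dim)
    then show ?thesis using dim_family_le order_trans by blast
  qed
  have rip: "RIP \<delta> (2 * ?r) (2 * ?r) f"
  proof -
    have "(1 - \<delta>) * (norm K)\<^sup>2 \<le> inner (T K) K" "inner (T K) K \<le> (1 + \<delta>) * (norm K)\<^sup>2" for K
    proof -
      have "\<gamma> * (inner w K)\<^sup>2 \<le> \<gamma> * (inner w w * inner K K)"
        using \<gamma> by (intro mult_left_mono Cauchy_Schwarz_ineq) auto
      also have "\<dots> \<le> 2 * \<delta> * inner K K"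
        using mult_right_mono[OF ww, of "inner K K"] by (simp add: mult_ac)
      finally show "(1 - \<delta>) * (norm K)\<^sup>2 \<le> inner (T K) K"
        unfolding TT by (simp add: power2_norm_eq_inner algebra_simps)
      show "inner (T K) K \<le> (1 + \<delta>) * (norm K)\<^sup>2" using \<gamma> by (simp add: TT)
    qed
    then show ?thesis unfolding RIP_def quad(3) by blast
  qed

  define U where "U = balanced_factor ?r \<sigma> \<epsilon> p"
  define V where "V = balanced_factor ?r \<sigma> \<epsilon> q"
  have UV: "U ** transpose V = M" and gapUV: "gap (U, V) = 0"
    using balanced_factor_product[OF _ \<epsilon>(1) pr qr, of \<sigma>] \<sigma> unfolding U_def V_def M_def
    by (simp_all add: less_imp_le)
  have Up: "transpose U *v p (?r + j) = 0" and Vq: "transpose V *v q (?r + j) = 0" if "j < s" for j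
    using that pp unfolding U_def V_def transpose_balanced_factor balanced_factor_mult_vec
    by (simp_all add: sum.neutral)
  have pU: "inner (p i) (U *v x) = sqrt (\<sigma> i) * inner (\<epsilon> i) x"
    and qV: "inner (q i) (V *v x) = sqrt (\<sigma> i) * inner (\<epsilon> i) x" if "i < ?r" for i x
    using inner_orthonormal_sum[OF _ pr, of i] inner_orthonormal_sum[OF _ qr, of i] that
    unfolding U_def V_def balanced_factor_mult_vec by (simp_all add: inner_commute)
  have gradM: "grad f M = - Q"
  proof -
    have "M - N = (-1) *\<^sub>R E" by (simp add: E_def)
    then have "T (M - N) = (-1) *\<^sub>R T E" using T by (simp only: linear_cmul bounded_linear.linear)
    then show ?thesis by (simp add: quad(2) TE)
  qed
  \<comment> \<open>\<open>Q\<close> is built from basis vectors beyond the first r, which the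
    transposed factors annihilate, while each term of a first variation has \<open>U\<close> on the
    left or V^T on the right.\<close>
  have Qpolar: "inner Q (prod_polar (U, V) z) = 0" for z
  proof -
    have "inner (outer (p (?r + j)) (q (?r + j))) (prod_polar (U, V) z) = 0" if "j < s" for j
    proof -
      have "prod_polar (U, V) z *v q (?r + j) = U *v (transpose (snd z) *v q (?r + j))"
        using Vq[OF that] by (simp add: prod_polar_def matrix_vector_mult_add_rdistrib
            del: transpose_matrix_vector flip: matrix_vector_mul_assoc)
      then show ?thesis
        using Up[OF that] inner_transpose_mult_vec[of U "p (?r + j)"]
        by (simp only: inner_commute[of "outer _ _"] inner_outer_right) (metis inner_zero_left)
    qed
    then show ?thesis by (simp add: Q_def inner_sum_left)
  qed
  \<comment> \<open>The curvature of \<open>f\<close> along the first variation must outweigh the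
    slope along the second one; both are compared with (1 + \<delta>) S.\<close>
  have second: "inner (T (prod_polar (U, V) z)) (prod_polar (U, V) z) \<ge> inner Q (prod_polar z z)" for z
  proof -
    define K where "K = prod_polar (U, V) z"
    define \<xi> where "\<xi> j = transpose (fst z) *v p (?r + j)" for j
    define \<eta> where "\<eta> j = transpose (snd z) *v q (?r + j)" for j
    \<comment> \<open>The squared norm of the two off-diagonal blocks of \<open>K\<close>, which
      couple the first r basis vectors with the other s.\<close>
    define S where "S = (\<Sum>i<?r. \<Sum>j<s. \<sigma> i * ((inner (\<epsilon> i) (\<xi> j))\<^sup>2 + (inner (\<epsilon> i) (\<eta> j))\<^sup>2))"
    have K1: "inner K (outer (p i) (q (?r + j))) = sqrt (\<sigma> i) * inner (\<epsilon> i) (\<eta> j)"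
      if "i < ?r" "j < s" for i j
    proof -
      have "K *v q (?r + j) = U *v \<eta> j"
        using Vq[OF that(2)] by (simp add: K_def \<eta>_def prod_polar_def matrix_vector_mult_add_rdistrib
            del: transpose_matrix_vector flip: matrix_vector_mul_assoc)
      then show ?thesis using pU[OF that(1)] by (simp add: inner_outer_right)
    qed
    have K2: "inner K (outer (p (?r + j)) (q i)) = sqrt (\<sigma> i) * inner (\<epsilon> i) (\<xi> j)"
      if "i < ?r" "j < s" for i j
    proof -
      have "transpose K = V ** transpose (fst z) + snd z ** transpose U"
        unfolding K_def prod_polar_def
        by (simp add: matrix_bilinear_simps matrix_transpose_mul add.commute)
      then have "transpose K *v p (?r + j) = V *v \<xi> j"
        using Up[OF that(2)] by (simp add: \<xi>_def matrix_vector_mult_add_rdistrib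
            del: transpose_matrix_vector flip: matrix_vector_mul_assoc)
      then show ?thesis using qV[OF that(1)] unfolding inner_outer_right' by simp
    qed
    let ?I1 = "{..<?r} \<times> {?r..<?t}" and ?I2 = "{?r..<?t} \<times> {..<?r}"
    let ?e = "\<lambda>(i, j). outer (p i) (q j)"
    have on: "orthonormal_on (?I1 \<union> ?I2) ?e"
      by (rule orthonormal_on_subset[OF orthonormal_outer[OF p q]]) auto
    have shift: "(\<Sum>j\<in>{?r..<?t}. F j) = (\<Sum>j<s. F (?r + j))" for F :: "nat \<Rightarrow> real"
      using sum.shift_bounds_nat_ivl[of F 0 ?r s] by (simp add: lessThan_atLeast0 add.commute)
    have prod: "(\<Sum>z\<in>I \<times> J. F z) = (\<Sum>i\<in>I. \<Sum>j\<in>J. F (i, j))"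
      for F :: "nat \<times> nat \<Rightarrow> real" and I J
      by (simp add: sum.cartesian_product)
    have "(\<Sum>i\<in>?I1 \<union> ?I2. (inner K (?e i))\<^sup>2) = (\<Sum>i\<in>?I1. (inner K (?e i))\<^sup>2) + (\<Sum>i\<in>?I2. (inner K (?e i))\<^sup>2)"
      by (rule sum.union_disjoint) auto
    also have "(\<Sum>i\<in>?I1. (inner K (?e i))\<^sup>2) = (\<Sum>i<?r. \<Sum>j<s. \<sigma> i * (inner (\<epsilon> i) (\<eta> j))\<^sup>2)"
      using \<sigma> by (simp add: prod shift K1 power_mult_distrib less_imp_le)
    also have "(\<Sum>i\<in>?I2. (inner K (?e i))\<^sup>2) = (\<Sum>j<s. \<Sum>i<?r. \<sigma> i * (inner (\<epsilon> i) (\<xi> j))\<^sup>2)"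
      using \<sigma> by (simp add: prod shift K2 power_mult_distrib less_imp_le)
    also have "\<dots> = (\<Sum>i<?r. \<Sum>j<s. \<sigma> i * (inner (\<epsilon> i) (\<xi> j))\<^sup>2)" by (rule sum.swap)
    finally have S: "(\<Sum>i\<in>?I1 \<union> ?I2. (inner K (?e i))\<^sup>2) = S"
      by (simp add: S_def sum.distrib algebra_simps)
    \<comment> \<open>In these blocks \<open>M\<close> and \<open>Q\<close> vanish, and those of
      \<open>N\<close> are A D^T and C B^T.\<close>
    have "inner w (outer (p i) (q j)) = 0" if "(i, j) \<in> ?I1 \<union> ?I2" for i j
    proof -
      have ij: "i < ?t" "j < ?t" "i \<noteq> j" using that by auto
      have "(\<Sum>k<?r. g i k * h j k) = 0"
        using that CB[of "i - ?r" j] AD[of i "j - ?r"] by (auto simp: g_def h_def append_fun_def)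
      then show ?thesis
        using ij by (simp add: w_def E_def inner_diff_left Np[OF ij(1,2)] Mp[OF ij(1,2)] Qp[OF ij(1,2)])
    qed
    then have "(inner w K)\<^sup>2 \<le> (norm w)\<^sup>2 * ((norm K)\<^sup>2 - S)"
      using cauchy_schwarz_orthogonal[OF _ on, of w K] unfolding S by auto
    then have "\<gamma> * (inner w K)\<^sup>2 \<le> \<gamma> * ((norm w)\<^sup>2 * ((norm K)\<^sup>2 - S))" using \<gamma> by simp
    moreover have SK: "S \<le> (norm K)\<^sup>2"
      using bessel[OF _ orthonormal_imp_sub_orthonormal[OF on], of K] unfolding S by simp
    then have "\<gamma> * ((norm w)\<^sup>2 * ((norm K)\<^sup>2 - S)) \<le> 2 * \<delta> * ((norm K)\<^sup>2 - S)"
      using mult_right_mono[OF ww, of "(norm K)\<^sup>2 - S"] by (simp add: power2_norm_eq_inner mult_ac)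
    \<comment> \<open>Here \<delta> \<le> 1 enters; subtracting the result from (1 + \<delta>) |K|^2
      leaves (1 + \<delta>) S.\<close>
    moreover have "2 * \<delta> * ((norm K)\<^sup>2 - S) \<le> (1 + \<delta>) * ((norm K)\<^sup>2 - S)"
      using SK \<delta> by (intro mult_right_mono) auto
    ultimately have "inner (T K) K \<ge> (1 + \<delta>) * S"
      unfolding TT by (simp add: algebra_simps)
    \<comment> \<open>Parseval in the coordinates \<epsilon> spreads |\<xi>_j|^2 + |\<eta>_j|^2 over
      all \<open>i\<close>, and \<open>\<tau> j \<le> (1 + \<delta>) * \<sigma> i\<close> applies
      term by term.\<close>
    moreover have "inner Q (prod_polar z z) \<le> (1 + \<delta>) * S"
    proof -
      have "inner Q (fst z ** transpose (snd z)) = (\<Sum>j<s. \<tau> j * inner (\<xi> j) (\<eta> j))"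
      proof -
        have "inner (outer (p (?r + j)) (q (?r + j))) (fst z ** transpose (snd z)) = inner (\<xi> j) (\<eta> j)" for j
          unfolding \<xi>_def \<eta>_def inner_commute[of "outer _ _"] inner_outer_right inner_transpose_mult_vec
          by (simp only: matrix_vector_mul_assoc)
        then show ?thesis by (simp add: Q_def inner_sum_left)
      qed
      then have "inner Q (prod_polar z z) = (\<Sum>j<s. \<tau> j * (2 * inner (\<xi> j) (\<eta> j)))"
        by (simp add: prod_polar_self sum_distrib_left mult_ac)
      also have "\<dots> \<le> (\<Sum>j<s. \<tau> j * ((norm (\<xi> j))\<^sup>2 + (norm (\<eta> j))\<^sup>2))"
      proof (intro sum_mono mult_left_mono)
        fix j assume "j \<in> {..<s}"
        then show "\<tau> j \<ge> 0" using \<tau> by simp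
        have "0 \<le> inner (\<xi> j - \<eta> j) (\<xi> j - \<eta> j)" by simp
        then show "2 * inner (\<xi> j) (\<eta> j) \<le> (norm (\<xi> j))\<^sup>2 + (norm (\<eta> j))\<^sup>2"
          unfolding power2_norm_eq_inner by (simp add: inner_diff_left inner_diff_right inner_commute)
      qed
      also have "\<dots> = (\<Sum>j<s. \<Sum>i<?r. \<tau> j * ((inner (\<epsilon> i) (\<xi> j))\<^sup>2 + (inner (\<epsilon> i) (\<eta> j))\<^sup>2))"
        by (simp add: \<epsilon>(2)[symmetric] sum.distrib[symmetric] sum_distrib_left)
      also have "\<dots> \<le> (\<Sum>j<s. \<Sum>i<?r. ((1 + \<delta>) * \<sigma> i) * ((inner (\<epsilon> i) (\<xi> j))\<^sup>2 + (inner (\<epsilon> i) (\<eta> j))\<^sup>2))"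
        using \<tau>\<sigma> by (intro sum_mono mult_right_mono) auto
      also have "\<dots> = (1 + \<delta>) * S"
        unfolding S_def sum_distrib_left by (subst sum.swap) (simp add: mult.assoc)
      finally show ?thesis .
    qed
    ultimately show ?thesis unfolding K_def by simp
  qed
  \<comment> \<open>The value at \<open>M\<close> is \<alpha> |E|^2 / 2, against 0 at
    \<open>N\<close>.\<close>
  have fM: "f M > 0"
  proof -
    have "f M = 1 / 2 * inner (- Q) (M - N)" using gradM[unfolded quad(2)] by (simp add: f_def)
    also have "\<dots> = 1 / 2 * (\<alpha> * e)" using QE by (simp add: E_def inner_diff_right)
    also have "\<dots> > 0" using \<alpha>0 e by simp
    finally show ?thesis .
  qed
  obtain \<kappa> \<theta> x y where sN: "svd \<kappa> \<theta> x y N" and \<kappa>: "\<kappa> \<le> ?r" using svd_exists_le[OF rN] by blast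
  \<comment> \<open>A balanced factorization of \<open>N\<close>, so that the value 0 is attained
    with zero penalty for every \<mu>.\<close>
  define W' :: "('n, 'm, 'r) factors" where "W' = (balanced_factor \<kappa> \<theta> \<epsilon> x, balanced_factor \<kappa> \<theta> \<epsilon> y)"
  have W': "fst W' ** transpose (snd W') = N" "gap W' = 0"
    using balanced_factor_product[of \<kappa> \<theta> \<epsilon> x y] sN orthonormal_on_subset[OF \<epsilon>(1), of "{..<\<kappa>}"] \<kappa>
    unfolding W'_def svd_def by (simp_all add: less_imp_le)
  have "spurious_second_order_critical (regularized \<mu> f) (U, V)" if "\<mu> \<ge> 0" for \<mu>
    unfolding spurious_second_order_critical_def second_order_critical_def
  proof (intro conjI allI)
    show "first_order_critical (regularized \<mu> f) (U, V)"
      unfolding first_order_critical_regularized[OF C2] using Qpolar by (simp add: UV gradM gapUV)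
    show "hessian (regularized \<mu> f) (U, V) z z \<ge> 0" for z
    proof -
      have "0 \<le> \<mu> / 2 * (norm (gap_polar (U, V) z))\<^sup>2" using that by simp
      then show ?thesis
        using second[of z] unfolding hessian_regularized[OF C2] by (simp add: UV gradM gapUV quad(3))
    qed
    have "regularized \<mu> f W' = 0" by (simp add: regularized_eq W' f_def T0)
    moreover have "regularized \<mu> f (U, V) = f M" by (simp add: regularized_eq UV gapUV)
    ultimately have "\<not> regularized \<mu> f (U, V) \<le> regularized \<mu> f W'" using fM by simp
    then show "\<not> (\<forall>y :: ('n, 'm, 'r) factors. regularized \<mu> f (U, V) \<le> regularized \<mu> f y)" by blast
  qed
  moreover have "admissible ?r f" unfolding admissible_def using tcd critN rN by blast
  ultimately show ?thesis using rip by blast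
qed

theorem theorem4:
  fixes \<delta> \<mu> :: real and l s :: nat
  assumes "CARD('r::finite) \<le> min CARD('n::finite) CARD('m::finite)"
    and "l = min (min CARD('m) CARD('n)) (2 * CARD('r))"
    and "s = l - CARD('r)"
    and "0 \<le> \<delta>" and "\<delta> < 1" and "\<mu> > 0"
  shows
    "((\<exists>f :: real ^ 'm ^ 'n \<Rightarrow> real.
         admissible CARD('r) f \<and> RIP \<delta> (2 * CARD('r)) (2 * CARD('r)) f \<and>
         (\<exists>W :: (real ^ 'r ^ 'n) \<times> (real ^ 'r ^ 'm).
            spurious_second_order_critical (factorized f) W))
      \<longrightarrow> (\<exists>\<alpha> \<Sigma> \<Lambda> A B C D. system_C CARD('r) s \<delta> \<alpha> \<Sigma> \<Lambda> A B C D))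
   \<and> ((\<exists>f :: real ^ 'm ^ 'n \<Rightarrow> real.
         admissible CARD('r) f \<and> RIP \<delta> (2 * CARD('r)) (2 * CARD('r)) f \<and>
         (\<exists>W :: (real ^ 'r ^ 'n) \<times> (real ^ 'r ^ 'm).
            spurious_second_order_critical (regularized \<mu> f) W))
      \<longrightarrow> (\<exists>\<alpha> \<Sigma> \<Lambda> A B C D. system_C CARD('r) s \<delta> \<alpha> \<Sigma> \<Lambda> A B C D))
   \<and> ((\<exists>\<alpha> \<Sigma> \<Lambda> A B C D. system_C CARD('r) s \<delta> \<alpha> \<Sigma> \<Lambda> A B C D \<and>
         C * transpose_mat B = 0\<^sub>m s CARD('r) \<and> A * transpose_mat D = 0\<^sub>m CARD('r) s)
      \<longrightarrow> (\<exists>f :: real ^ 'm ^ 'n \<Rightarrow> real.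
             admissible CARD('r) f \<and> RIP \<delta> (2 * CARD('r)) (2 * CARD('r)) f \<and>
             (\<exists>W :: (real ^ 'r ^ 'n) \<times> (real ^ 'r ^ 'm).
                spurious_second_order_critical (factorized f) W) \<and>
             (\<exists>W :: (real ^ 'r ^ 'n) \<times> (real ^ 'r ^ 'm).
                spurious_second_order_critical (regularized \<mu> f) W)))"
proof -
  let ?r = "CARD('r)"
  have s: "s = min (min CARD('m) CARD('n)) (2 * ?r) - ?r" using assms(2,3) by simp
  \<comment> \<open>Since r is at most l, the truncated difference is exact and r + s = l.\<close>
  have dims: "?r + s \<le> CARD('n)" "?r + s \<le> CARD('m)" using assms(1-3) by simp_all
  have necessity: "\<exists>\<alpha> \<Sigma> \<Lambda> A B C D. system_C ?r s \<delta> \<alpha> \<Sigma> \<Lambda> A B C D"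
    if asm: "admissible ?r f" "RIP \<delta> (2 * ?r) (2 * ?r) f" "\<nu> \<ge> 0"
      "spurious_second_order_critical (regularized \<nu> f) W"
    for f :: "real ^ 'm ^ 'n \<Rightarrow> real" and W :: "(real ^ 'r ^ 'n) \<times> (real ^ 'r ^ 'm)" and \<nu>
  proof -
    obtain \<alpha> \<sigma> \<tau> a b c d where "scalar_system ?r s \<delta> \<alpha> \<sigma> \<tau> a b c d"
      using spurious_imp_scalar_system[OF _ _ _ asm(2) assms(4,5) asm(3,4) s] asm(1)
      unfolding admissible_def by blast
    then show ?thesis using ex_system_C_if_scalar[of ?r \<delta>] assms(4) by (metis zero_less_card_finite)
  qed
  have sufficiency: "\<exists>f :: real ^ 'm ^ 'n \<Rightarrow> real.
      admissible ?r f \<and> RIP \<delta> (2 * ?r) (2 * ?r) f \<and>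
      (\<exists>W :: (real ^ 'r ^ 'n) \<times> (real ^ 'r ^ 'm). spurious_second_order_critical (factorized f) W) \<and>
      (\<exists>W :: (real ^ 'r ^ 'n) \<times> (real ^ 'r ^ 'm). spurious_second_order_critical (regularized \<mu> f) W)"
    if sys: "system_C ?r s \<delta> \<alpha> \<Sigma> \<Lambda> A B C D" and CB: "C * transpose_mat B = 0\<^sub>m s ?r"
      and AD: "A * transpose_mat D = 0\<^sub>m ?r s" for \<alpha> \<Sigma> \<Lambda> A B C D
  proof -
    have carriers: "\<Sigma> \<in> carrier_mat ?r ?r" "diagonal_mat \<Sigma>" "\<Lambda> \<in> carrier_mat s s" "diagonal_mat \<Lambda>"
      "A \<in> carrier_mat ?r ?r" "B \<in> carrier_mat ?r ?r" "C \<in> carrier_mat s ?r" "D \<in> carrier_mat s ?r"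
      using sys unfolding system_C_def by auto
    have scalar: "scalar_system ?r s \<delta> \<alpha> (\<lambda>i. \<Sigma> $$ (i, i)) (\<lambda>i. \<Lambda> $$ (i, i)) (\<lambda>i k. A $$ (i, k))
        (\<lambda>i k. B $$ (i, k)) (\<lambda>i k. C $$ (i, k)) (\<lambda>i k. D $$ (i, k))"
      using sys system_C_iff[OF zero_less_card_finite assms(4) carriers] by blast
    have "(\<Sum>k<?r. C $$ (i, k) * B $$ (j, k)) = 0" if "i < s" "j < ?r" for i j
      using index_mult_transpose[OF carriers(7,6) that] that CB by simp
    moreover have "(\<Sum>k<?r. A $$ (i, k) * D $$ (j, k)) = 0" if "i < ?r" "j < s" for i j
      using index_mult_transpose[OF carriers(5,8) that] that AD by simp
    ultimately obtain f :: "real ^ 'm ^ 'n \<Rightarrow> real"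
      where f: "admissible ?r f" "RIP \<delta> (2 * ?r) (2 * ?r) f"
        "\<forall>\<nu>\<ge>0. \<exists>W :: (real ^ 'r ^ 'n) \<times> (real ^ 'r ^ 'm).
          spurious_second_order_critical (regularized \<nu> f) W"
      using scalar_system_imp_spurious[OF scalar dims assms(4,5)] by blast
    then show ?thesis using assms(6) unfolding factorized_eq_regularized
      by (intro exI[of _ f] conjI) simp_all
  qed
  show ?thesis
  proof (intro conjI impI)
    assume "\<exists>f :: real ^ 'm ^ 'n \<Rightarrow> real. admissible ?r f \<and> RIP \<delta> (2 * ?r) (2 * ?r) f \<and>
      (\<exists>W :: (real ^ 'r ^ 'n) \<times> (real ^ 'r ^ 'm). spurious_second_order_critical (factorized f) W)"
    then show "\<exists>\<alpha> \<Sigma> \<Lambda> A B C D. system_C ?r s \<delta> \<alpha> \<Sigma> \<Lambda> A B C D"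
      unfolding factorized_eq_regularized by (elim exE conjE) (rule necessity, simp_all)
  next
    assume "\<exists>f :: real ^ 'm ^ 'n \<Rightarrow> real. admissible ?r f \<and> RIP \<delta> (2 * ?r) (2 * ?r) f \<and>
      (\<exists>W :: (real ^ 'r ^ 'n) \<times> (real ^ 'r ^ 'm). spurious_second_order_critical (regularized \<mu> f) W)"
    then show "\<exists>\<alpha> \<Sigma> \<Lambda> A B C D. system_C ?r s \<delta> \<alpha> \<Sigma> \<Lambda> A B C D"
      using assms(6) by (elim exE conjE) (rule necessity[where \<nu> = \<mu>], simp_all)
  next
    assume "\<exists>\<alpha> \<Sigma> \<Lambda> A B C D. system_C ?r s \<delta> \<alpha> \<Sigma> \<Lambda> A B C D \<and>
      C * transpose_mat B = 0\<^sub>m s ?r \<and> A * transpose_mat D = 0\<^sub>m ?r s"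
    then show "\<exists>f :: real ^ 'm ^ 'n \<Rightarrow> real.
      admissible ?r f \<and> RIP \<delta> (2 * ?r) (2 * ?r) f \<and>
      (\<exists>W :: (real ^ 'r ^ 'n) \<times> (real ^ 'r ^ 'm). spurious_second_order_critical (factorized f) W) \<and>
      (\<exists>W :: (real ^ 'r ^ 'n) \<times> (real ^ 'r ^ 'm). spurious_second_order_critical (regularized \<mu> f) W)"
      by (elim exE conjE) (rule sufficiency)
  qed
qed

end
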